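(* Let $(\overline{M}^{n+1},\overline{g})$ be a Lorentz manifold and let $\xi$ be a timelike closed conformal vector field on $\overline{M}$ with constant norm $1$ (i.e. $\overline{g}(\xi,\xi)=-1$). Let $\mathcal{F}$ be a codimension-one foliation of $\overline{M}$ by complete noncompact spacelike hypersurfaces, with unit timelike normal vector field $N$ with $\overline{g}(N,\xi)<0$, such that $\mathcal{F}$ is transversal to $\xi$ and $\overline{g}(N,H_\xi\cdot\xi)\ge0$. If the second fundamental form $A$ of each leaf $L\in\mathcal{F}$ with respect to $N$ is nonnegative and $N$ converges to $\xi$ at infinity, then $\mathcal{F}$ is a totally geodesic foliation (every leaf is totally geodesic).
   Context: A Lorentz manifold has a metric of signature $(+,\dots,+,-)$. A hypersurface is spacelike if its induced metric is Riemannian; completeness refers to the induced metric of the leaves. A vector field $\xi$ is closed and conformal if there is a function $\sigma\in C^\infty(\overline{M})$ with $\overline{\nabla}_X\xi=\sigma X$ for all vector fields $X$, where $\overline{\nabla}$ is the Levi-Civita connection; then $\sigma=\frac{1}{n+1}\operatorname{div}\xi$. Set $H_\xi=-\frac{\operatorname{div}\xi}{(n+1)\|\xi\|}=-\frac{\sigma}{\|\xi\|}$, where $\|\xi\|=\sqrt{-\overline{g}(\xi,\xi)}$. The second fundamental form of a leaf with respect to $N$ is $A(Y)=-\overline{\nabla}_YN$ for $Y$ tangent to the leaf; it is nonnegative if $\overline{g}(A(Y),Y)\ge0$ for all tangent $Y$. Let $\theta:\overline{M}\to[0,\infty)$ be the hyperbolic angle between $N$ and $\xi$, defined by $\overline{g}(N,\xi)=-\cosh\theta$.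 We say that $N$ converges to $\xi$ at infinity if $\theta$ converges to $0$ at infinity, i.e. for every $\varepsilon>0$ there is a compact $K\subset\overline{M}$ with $\theta<\varepsilon$ on $\overline{M}\setminus K$. *)

theory Defs
  imports "HOL-Analysis.Analysis"
begin

section \<open>Smooth manifolds\<close>

text \<open>\<open>Ck_on k S f\<close> means that \<open>f\<close> is of class \<open>C\<^sup>k\<close> on the open set \<open>S\<close>: all iterated
  directional derivatives up to order \<open>k\<close> exist and are continuous.\<close>

primrec Ck_on ::
  "nat \<Rightarrow> 'a::real_normed_vector set \<Rightarrow> ('a \<Rightarrow> 'b::real_normed_vector) \<Rightarrow> bool" where
  "Ck_on 0 S f \<longleftrightarrow> continuous_on S f"
| "Ck_on (Suc k) S f \<longleftrightarrow>
     (\<forall>x\<in>S. f differentiable (at x)) \<and> (\<forall>v. Ck_on k S (\<lambda>x. frechet_derivative f (at x) v))"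

definition smooth_on ::
  "'a::real_normed_vector set \<Rightarrow> ('a \<Rightarrow> 'b::real_normed_vector) \<Rightarrow> bool" where
  "smooth_on S f \<longleftrightarrow> (\<forall>k. Ck_on k S f)"

text \<open>A chart is a pair of its domain and its coordinate map; values of the map outside the
  domain are irrelevant. The dimension of the manifold is \<open>DIM('e)\<close>.\<close>

type_synonym ('m, 'e) chart = "'m set \<times> ('m \<Rightarrow> 'e)"

definition chart_inv :: "('m, 'e) chart \<Rightarrow> 'e \<Rightarrow> 'm" where
  "chart_inv c = inv_into (fst c) (snd c)"

definition is_chart :: "('m::topological_space, 'e::euclidean_space) chart \<Rightarrow> bool" where
  "is_chart c \<longleftrightarrow> open (fst c) \<and> open (snd c ` fst c) \<and>
     homeomorphism (fst c) (snd c ` fst c) (snd c) (chart_inv c)"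

definition compatible :: "('m, 'e::euclidean_space) chart \<Rightarrow> ('m, 'e) chart \<Rightarrow> bool" where
  "compatible c d \<longleftrightarrow>
     smooth_on (snd c ` (fst c \<inter> fst d)) (snd d \<circ> chart_inv c) \<and>
     smooth_on (snd d ` (fst c \<inter> fst d)) (snd c \<circ> chart_inv d)"

definition smooth_atlas :: "('m::topological_space, 'e::euclidean_space) chart set \<Rightarrow> bool" where
  "smooth_atlas A \<longleftrightarrow> (\<forall>c\<in>A. is_chart c) \<and> (\<Union>c\<in>A. fst c) = UNIV \<and>
     (\<forall>c\<in>A. \<forall>d\<in>A. compatible c d)"

section \<open>Tangent vectors and vector fields\<close>

text \<open>The tangent space at \<open>p\<close> is \<open>'e\<close>: a tangent vector at \<open>p\<close> is represented by its components
  with respect to the chart \<open>chart_at A p\<close>, chosen once and for all for every point \<open>p\<close>. In another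
  chart \<open>c\<close> around \<open>p\<close> it has the components \<open>components A c p v\<close>; conversely
  \<open>coord_vector A c p u\<close> is the tangent vector at \<open>p\<close> whose components in the chart \<open>c\<close> are \<open>u\<close>.
  Since the chosen chart varies with the point, continuity and smoothness of a vector field
  always refer to its components in a fixed chart.\<close>

definition chart_at :: "('m, 'e) chart set \<Rightarrow> 'm \<Rightarrow> ('m, 'e) chart" where
  "chart_at A p = (SOME c. c \<in> A \<and> p \<in> fst c)"

definition components ::
  "('m, 'e::euclidean_space) chart set \<Rightarrow> ('m, 'e) chart \<Rightarrow> 'm \<Rightarrow> 'e \<Rightarrow> 'e" where
  "components A c p v =
     frechet_derivative (snd c \<circ> chart_inv (chart_at A p)) (at (snd (chart_at A p) p)) v"

definition coord_vector ::
  "('m, 'e::euclidean_space) chart set \<Rightarrow> ('m, 'e) chart \<Rightarrow> 'm \<Rightarrow> 'e \<Rightarrow> 'e" where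
  "coord_vector A c p u =
     frechet_derivative (snd (chart_at A p) \<circ> chart_inv c) (at (snd c p)) u"

definition smooth_fun :: "('m, 'e::euclidean_space) chart set \<Rightarrow> ('m \<Rightarrow> real) \<Rightarrow> bool" where
  "smooth_fun A f \<longleftrightarrow> (\<forall>c\<in>A. smooth_on (snd c ` fst c) (f \<circ> chart_inv c))"

definition smooth_field :: "('m, 'e::euclidean_space) chart set \<Rightarrow> ('m \<Rightarrow> 'e) \<Rightarrow> bool" where
  "smooth_field A X \<longleftrightarrow>
     (\<forall>c\<in>A. smooth_on (snd c ` fst c)
        (\<lambda>x. components A c (chart_inv c x) (X (chart_inv c x))))"

definition dir_deriv ::
  "('m, 'e::euclidean_space) chart set \<Rightarrow> ('m \<Rightarrow> real) \<Rightarrow> 'm \<Rightarrow> 'e \<Rightarrow> real" where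
  "dir_deriv A f p v =
     frechet_derivative (f \<circ> chart_inv (chart_at A p)) (at (snd (chart_at A p) p)) v"

section \<open>Lorentz metrics and the Levi-Civita connection\<close>

text \<open>Signature \<open>(+,\<dots>,+,-)\<close>: there is a basis of the tangent space, namely the image under \<open>E\<close> of
  the standard basis, which is orthonormal up to exactly one sign.\<close>

definition lorentz_form :: "('e::euclidean_space \<Rightarrow> 'e \<Rightarrow> real) \<Rightarrow> bool" where
  "lorentz_form q \<longleftrightarrow> bilinear q \<and> (\<forall>v w. q v w = q w v) \<and>
     (\<exists>E::'e \<Rightarrow> 'e. \<exists>e0\<in>Basis. linear E \<and> bij E \<and>
        (\<forall>b\<in>Basis. \<forall>b'\<in>Basis.
           q (E b) (E b') = (if b \<noteq> b' then 0 else if b = e0 then -1 else 1)))"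

definition lorentz_metric ::
  "('m, 'e::euclidean_space) chart set \<Rightarrow> ('m \<Rightarrow> 'e \<Rightarrow> 'e \<Rightarrow> real) \<Rightarrow> bool" where
  "lorentz_metric A g \<longleftrightarrow> (\<forall>p. lorentz_form (g p)) \<and>
     (\<forall>c\<in>A. \<forall>u w. smooth_on (snd c ` fst c)
        (\<lambda>x. g (chart_inv c x)
              (coord_vector A c (chart_inv c x) u) (coord_vector A c (chart_inv c x) w)))"

definition timelike :: "('m \<Rightarrow> 'e \<Rightarrow> 'e \<Rightarrow> real) \<Rightarrow> ('m \<Rightarrow> 'e) \<Rightarrow> bool" where
  "timelike g X \<longleftrightarrow> (\<forall>p. g p (X p) (X p) < 0)"

definition timelike_norm :: "('m \<Rightarrow> 'e \<Rightarrow> 'e \<Rightarrow> real) \<Rightarrow> ('m \<Rightarrow> 'e) \<Rightarrow> 'm \<Rightarrow> real" where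
  "timelike_norm g X p = sqrt (- g p (X p) (X p))"

text \<open>\<open>nabla p v X\<close> is the covariant derivative at \<open>p\<close> of the vector field \<open>X\<close> in the direction of
  the tangent vector \<open>v\<close>; only smooth \<open>X\<close> matter. In the clause before the last one, the bracket
  \<open>[X, Y]\<close> is expressed through its action on smooth functions.\<close>

definition levi_civita ::
  "('m, 'e::euclidean_space) chart set \<Rightarrow> ('m \<Rightarrow> 'e \<Rightarrow> 'e \<Rightarrow> real) \<Rightarrow>
   ('m \<Rightarrow> 'e \<Rightarrow> ('m \<Rightarrow> 'e) \<Rightarrow> 'e) \<Rightarrow> bool" where
  "levi_civita A g nabla \<longleftrightarrow>
     (\<forall>X p. smooth_field A X \<longrightarrow> linear (\<lambda>v. nabla p v X)) \<and>
     (\<forall>X Y. smooth_field A X \<longrightarrow> smooth_field A Y \<longrightarrow> smooth_field A (\<lambda>p. nabla p (X p) Y)) \<and>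
     (\<forall>X Y p v. smooth_field A X \<longrightarrow> smooth_field A Y \<longrightarrow>
        nabla p v (\<lambda>q. X q + Y q) = nabla p v X + nabla p v Y) \<and>
     (\<forall>f X p v. smooth_fun A f \<longrightarrow> smooth_field A X \<longrightarrow>
        nabla p v (\<lambda>q. f q *\<^sub>R X q) = dir_deriv A f p v *\<^sub>R X p + f p *\<^sub>R nabla p v X) \<and>
     (\<forall>X Y f p. smooth_field A X \<longrightarrow> smooth_field A Y \<longrightarrow> smooth_fun A f \<longrightarrow>
        dir_deriv A f p (nabla p (X p) Y - nabla p (Y p) X) =
          dir_deriv A (\<lambda>q. dir_deriv A f q (Y q)) p (X p) -
          dir_deriv A (\<lambda>q. dir_deriv A f q (X q)) p (Y p)) \<and>
     (\<forall>X Y p v. smooth_field A X \<longrightarrow> smooth_field A Y \<longrightarrow>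
        dir_deriv A (\<lambda>q. g q (X q) (Y q)) p v =
          g p (nabla p v X) (Y p) + g p (X p) (nabla p v Y))"

definition closed_conformal ::
  "('m, 'e::euclidean_space) chart set \<Rightarrow> ('m \<Rightarrow> 'e \<Rightarrow> ('m \<Rightarrow> 'e) \<Rightarrow> 'e) \<Rightarrow> ('m \<Rightarrow> 'e) \<Rightarrow> bool" where
  "closed_conformal A nabla X \<longleftrightarrow> smooth_field A X \<and>
     (\<exists>\<sigma>. smooth_fun A \<sigma> \<and> (\<forall>p v. nabla p v X = \<sigma> p *\<^sub>R v))"

text \<open>The divergence is the trace of \<open>v \<mapsto> \<nabla>\<^sub>v X\<close>, which can be computed in any basis of the tangent
  space, in particular in the one that is orthonormal for the inner product of \<open>'e\<close>.\<close>

definition divergence ::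
  "('m \<Rightarrow> 'e \<Rightarrow> ('m \<Rightarrow> 'e) \<Rightarrow> 'e) \<Rightarrow> ('m \<Rightarrow> 'e::euclidean_space) \<Rightarrow> 'm \<Rightarrow> real" where
  "divergence nabla X p = (\<Sum>b\<in>Basis. nabla p b X \<bullet> b)"

definition H_conf ::
  "('m \<Rightarrow> 'e \<Rightarrow> 'e \<Rightarrow> real) \<Rightarrow> ('m \<Rightarrow> 'e \<Rightarrow> ('m \<Rightarrow> 'e) \<Rightarrow> 'e) \<Rightarrow> ('m \<Rightarrow> 'e::euclidean_space) \<Rightarrow>
   'm \<Rightarrow> real" where
  "H_conf g nabla X p = - divergence nabla X p / (real DIM('e) * timelike_norm g X p)"

section \<open>Foliations of codimension one\<close>

text \<open>The transversal coordinate of a foliated chart is the coordinate along the basis vector \<open>b\<close>.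
  The last clause says that the transversal component of a change of foliated charts does not
  depend, locally, on the remaining coordinates, i.e. that it is of the form
  \<open>(x, y) \<mapsto> (h\<^sub>1(x, y), h\<^sub>2(y))\<close>.\<close>

definition foliated_atlas ::
  "('m::topological_space, 'e::euclidean_space) chart set \<Rightarrow> 'e \<Rightarrow> ('m, 'e) chart set \<Rightarrow> bool" where
  "foliated_atlas A b F \<longleftrightarrow> b \<in> Basis \<and>
     (\<forall>c\<in>F. is_chart c \<and> (\<exists>l u. snd c ` fst c = box l u)) \<and>
     (\<Union>c\<in>F. fst c) = UNIV \<and>
     (\<forall>c\<in>F. \<forall>d\<in>A. compatible c d) \<and>
     (\<forall>c\<in>F. \<forall>d\<in>F. compatible c d \<and>
        (\<forall>x\<in>snd c ` (fst c \<inter> fst d). \<forall>v.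
           v \<bullet> b = 0 \<longrightarrow> frechet_derivative (snd d \<circ> chart_inv c) (at x) v \<bullet> b = 0))"

definition plaque :: "'e::euclidean_space \<Rightarrow> ('m, 'e) chart \<Rightarrow> real \<Rightarrow> 'm set" where
  "plaque b c t = {p \<in> fst c. snd c p \<bullet> b = t}"

definition leaf_through :: "'e::euclidean_space \<Rightarrow> ('m, 'e) chart set \<Rightarrow> 'm \<Rightarrow> 'm set" where
  "leaf_through b F p =
     {q. (\<lambda>x y. \<exists>c\<in>F. \<exists>t. x \<in> plaque b c t \<and> y \<in> plaque b c t)\<^sup>*\<^sup>* p q}"

definition leaves :: "'e::euclidean_space \<Rightarrow> ('m, 'e) chart set \<Rightarrow> 'm set set" where
  "leaves b F = range (leaf_through b F)"

text \<open>The leaf topology on the whole manifold. Its restriction to a leaf is the manifold topology of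
  the leaf, which may be finer than the topology induced by the ambient manifold.\<close>

definition leaf_topology ::
  "'e::euclidean_space \<Rightarrow> ('m::topological_space, 'e) chart set \<Rightarrow> 'm topology" where
  "leaf_topology b F = topology_generated_by {plaque b c t \<inter> V | c t V. c \<in> F \<and> open V}"

definition compact_leaf ::
  "'e::euclidean_space \<Rightarrow> ('m::topological_space, 'e) chart set \<Rightarrow> 'm set \<Rightarrow> bool" where
  "compact_leaf b F L \<longleftrightarrow> compactin (leaf_topology b F) L"

text \<open>The tangent space at \<open>p\<close> to the leaf through \<open>p\<close>.\<close>

definition leaf_tangent ::
  "('m, 'e::euclidean_space) chart set \<Rightarrow> 'e \<Rightarrow> ('m, 'e) chart set \<Rightarrow> 'm \<Rightarrow> 'e set" where
  "leaf_tangent A b F p = {v. \<forall>c\<in>F. p \<in> fst c \<longrightarrow> components A c p v \<bullet> b = 0}"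

definition transversal ::
  "('m, 'e::euclidean_space) chart set \<Rightarrow> 'e \<Rightarrow> ('m, 'e) chart set \<Rightarrow> ('m \<Rightarrow> 'e) \<Rightarrow> bool" where
  "transversal A b F X \<longleftrightarrow> (\<forall>p. X p \<notin> leaf_tangent A b F p)"

definition spacelike_leaf ::
  "('m, 'e::euclidean_space) chart set \<Rightarrow> ('m \<Rightarrow> 'e \<Rightarrow> 'e \<Rightarrow> real) \<Rightarrow>
   'e \<Rightarrow> ('m, 'e) chart set \<Rightarrow> 'm set \<Rightarrow> bool" where
  "spacelike_leaf A g b F L \<longleftrightarrow>
     (\<forall>p\<in>L. \<forall>v\<in>leaf_tangent A b F p. v \<noteq> 0 \<longrightarrow> g p v v > 0)"

text \<open>Curves are parametrized by \<open>{0..1}\<close>. The velocity may vanish, so \<open>C\<^sup>1\<close> curves give the same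
  Riemannian distance as piecewise \<open>C\<^sup>1\<close> ones: a corner can be passed with velocity zero. A \<open>C\<^sup>1\<close>
  curve whose velocity is everywhere tangent to the leaves stays inside a single leaf and is
  continuous for the leaf topology.\<close>

definition C1_curve ::
  "('m::topological_space, 'e::euclidean_space) chart set \<Rightarrow> (real \<Rightarrow> 'm) \<Rightarrow> bool" where
  "C1_curve A \<gamma> \<longleftrightarrow> continuous_on {0..1} \<gamma> \<and>
     (\<forall>c\<in>A. (\<forall>t\<in>{0..1}. \<gamma> t \<in> fst c \<longrightarrow> (snd c \<circ> \<gamma>) differentiable (at t within {0..1})) \<and>
        continuous_on {t\<in>{0..1}. \<gamma> t \<in> fst c}
          (\<lambda>t. vector_derivative (snd c \<circ> \<gamma>) (at t within {0..1})))"

definition velocity ::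
  "('m, 'e::euclidean_space) chart set \<Rightarrow> (real \<Rightarrow> 'm) \<Rightarrow> real \<Rightarrow> 'e" where
  "velocity A \<gamma> t = vector_derivative (snd (chart_at A (\<gamma> t)) \<circ> \<gamma>) (at t within {0..1})"

definition leaf_curve ::
  "('m::topological_space, 'e::euclidean_space) chart set \<Rightarrow> 'e \<Rightarrow> ('m, 'e) chart set \<Rightarrow>
   (real \<Rightarrow> 'm) \<Rightarrow> bool" where
  "leaf_curve A b F \<gamma> \<longleftrightarrow> C1_curve A \<gamma> \<and>
     (\<forall>t\<in>{0..1}. velocity A \<gamma> t \<in> leaf_tangent A b F (\<gamma> t))"

definition curve_length ::
  "('m, 'e::euclidean_space) chart set \<Rightarrow> ('m \<Rightarrow> 'e \<Rightarrow> 'e \<Rightarrow> real) \<Rightarrow> (real \<Rightarrow> 'm) \<Rightarrow> real" where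
  "curve_length A g \<gamma> =
     integral {0..1} (\<lambda>t. sqrt (g (\<gamma> t) (velocity A \<gamma> t) (velocity A \<gamma> t)))"

text \<open>The Riemannian distance of the metric induced on the leaf \<open>L\<close>. The value \<open>0\<close> outside \<open>L\<close> is
  a dummy, chosen because the locale \<^locale>\<open>Metric_space\<close> requires nonnegativity and symmetry for
  all arguments.\<close>

definition leaf_dist ::
  "('m::topological_space, 'e::euclidean_space) chart set \<Rightarrow> ('m \<Rightarrow> 'e \<Rightarrow> 'e \<Rightarrow> real) \<Rightarrow>
   'e \<Rightarrow> ('m, 'e) chart set \<Rightarrow> 'm set \<Rightarrow> 'm \<Rightarrow> 'm \<Rightarrow> real" where
  "leaf_dist A g b F L p q =
     (if p \<in> L \<and> q \<in> L
      then Inf {curve_length A g \<gamma> | \<gamma>. leaf_curve A b F \<gamma> \<and> \<gamma> 0 = p \<and> \<gamma> 1 = q}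
      else 0)"

definition complete_leaf ::
  "('m::topological_space, 'e::euclidean_space) chart set \<Rightarrow> ('m \<Rightarrow> 'e \<Rightarrow> 'e \<Rightarrow> real) \<Rightarrow>
   'e \<Rightarrow> ('m, 'e) chart set \<Rightarrow> 'm set \<Rightarrow> bool" where
  "complete_leaf A g b F L \<longleftrightarrow> Metric_space.mcomplete L (leaf_dist A g b F L)"

definition timelike_unit_normal ::
  "('m, 'e::euclidean_space) chart set \<Rightarrow> ('m \<Rightarrow> 'e \<Rightarrow> 'e \<Rightarrow> real) \<Rightarrow>
   'e \<Rightarrow> ('m, 'e) chart set \<Rightarrow> ('m \<Rightarrow> 'e) \<Rightarrow> bool" where
  "timelike_unit_normal A g b F N \<longleftrightarrow> smooth_field A N \<and>
     (\<forall>p. g p (N p) (N p) = -1 \<and> (\<forall>v\<in>leaf_tangent A b F p. g p (N p) v = 0))"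

definition second_ff ::
  "('m \<Rightarrow> 'e \<Rightarrow> ('m \<Rightarrow> 'e) \<Rightarrow> 'e::euclidean_space) \<Rightarrow> ('m \<Rightarrow> 'e) \<Rightarrow> 'm \<Rightarrow> 'e \<Rightarrow> 'e" where
  "second_ff nabla N p v = - nabla p v N"

definition second_ff_nonneg ::
  "('m, 'e::euclidean_space) chart set \<Rightarrow> ('m \<Rightarrow> 'e \<Rightarrow> 'e \<Rightarrow> real) \<Rightarrow>
   ('m \<Rightarrow> 'e \<Rightarrow> ('m \<Rightarrow> 'e) \<Rightarrow> 'e) \<Rightarrow> 'e \<Rightarrow> ('m, 'e) chart set \<Rightarrow> ('m \<Rightarrow> 'e) \<Rightarrow> 'm set \<Rightarrow> bool" where
  "second_ff_nonneg A g nabla b F N L \<longleftrightarrow>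
     (\<forall>p\<in>L. \<forall>v\<in>leaf_tangent A b F p. g p (second_ff nabla N p v) v \<ge> 0)"

definition totally_geodesic_leaf ::
  "('m, 'e::euclidean_space) chart set \<Rightarrow> ('m \<Rightarrow> 'e \<Rightarrow> ('m \<Rightarrow> 'e) \<Rightarrow> 'e) \<Rightarrow>
   'e \<Rightarrow> ('m, 'e) chart set \<Rightarrow> ('m \<Rightarrow> 'e) \<Rightarrow> 'm set \<Rightarrow> bool" where
  "totally_geodesic_leaf A nabla b F N L \<longleftrightarrow>
     (\<forall>p\<in>L. \<forall>v\<in>leaf_tangent A b F p. second_ff nabla N p v = 0)"

section \<open>Convergence at infinity\<close>

definition hyperbolic_angle ::
  "('m \<Rightarrow> 'e \<Rightarrow> 'e \<Rightarrow> real) \<Rightarrow> ('m \<Rightarrow> 'e) \<Rightarrow> ('m \<Rightarrow> 'e) \<Rightarrow> ('m \<Rightarrow> real) \<Rightarrow> bool" where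
  "hyperbolic_angle g N X \<theta> \<longleftrightarrow> (\<forall>p. \<theta> p \<ge> 0 \<and> g p (N p) (X p) = - cosh (\<theta> p))"

definition tends_to_zero_at_infinity :: "('m::topological_space \<Rightarrow> real) \<Rightarrow> bool" where
  "tends_to_zero_at_infinity \<theta> \<longleftrightarrow> (\<forall>\<epsilon>>0. \<exists>K. compact K \<and> (\<forall>p. p \<notin> K \<longrightarrow> \<theta> p < \<epsilon>))"

end

(*
A closed conformal field xi of constant norm is parallel: differentiating g(xi, xi) = -1 along xi
gives sigma = 0. Put f = g(N, xi) = - cosh theta and T = xi + f N, the tangential part of xi.
For functions alpha, beta of one real variable with alpha'(u) = u beta'(u), the divergence of
W = alpha(f) N + beta(f) xi on the whole manifold is

  alpha(f) div N + beta'(f) g(nabla_T N, T),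

because the terms with nabla_N N cancel. Since A >= 0 we have div N <= 0 and g(nabla_T N, T) <= 0,
so alpha <= 0 and beta' <= 0 make div W nonnegative. Choosing alpha and beta to vanish where
f >= -a, for some a > 1, gives W compact support, as theta tends to zero at infinity. The divergence
theorem then forces div W = 0, hence div N = 0 wherever theta > 0. On the interior of {theta = 0} the
fields N and xi agree and N is parallel, so div N = 0 everywhere by continuity. A symmetric
nonnegative operator with vanishing trace is zero.
*)

theory Submission
  imports Defs
begin

section \<open>Calculus of \<open>C\<^sup>k\<close> maps\<close>

text \<open>Integrating over the ambient manifold instead of over leaves makes the decay of \<theta>
  outside a compact set exactly the compact support that the divergence theorem asks for. With xi =
  T - f N one has g(nabla_T N, T) = g(nabla_xi N, xi) + f g(nabla_N N, xi). The first summand arises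
  from differentiating \<beta>(f) along xi, the second from differentiating \<alpha>(f) along N;
  this is the origin of \<alpha>'(u) = u \<beta>'(u). The required signs are compatible because f is
  negative: \<beta>' \<le> 0 gives \<alpha>' \<ge> 0 there, and \<alpha> vanishes for u \<ge> -a, so
  \<alpha> \<le> 0.

  Two obstacles shape the rest. No orientation is given, so integration uses densities that change
  by the absolute value of the Jacobian. The connection acts on globally defined smooth fields,
  while W is only C^1; hence the divergence of W is expressed by the coordinate formula with a
  density, which is matched with the trace of nabla for the smooth fields N and xi alone. For the
  same reason local coordinate frames enter only after multiplication by a cutoff.\<close>

lemma frechet_derivative_eqI:
  "(f has_derivative f') (at x) \<Longrightarrow> frechet_derivative f (at x) = f'"
  using frechet_derivative_at by metis

lemma has_derivative_cong_open:
  assumes "open S" "x \<in> S" "\<And>y. y \<in> S \<Longrightarrow> f y = g y"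
  shows "(f has_derivative D) (at x) \<longleftrightarrow> (g has_derivative D) (at x)"
  using has_derivative_transform_within_open[of f D x UNIV S g]
    has_derivative_transform_within_open[of g D x UNIV S f] assms by auto

lemma frechet_derivative_cong_open:
  assumes "open S" "x \<in> S" "\<And>y. y \<in> S \<Longrightarrow> f y = g y"
  shows "frechet_derivative f (at x) = frechet_derivative g (at x)"
  unfolding frechet_derivative_def using has_derivative_cong_open[OF assms] by simp

lemma differentiable_cong_open:
  assumes "open S" "x \<in> S" "\<And>y. y \<in> S \<Longrightarrow> f y = g y"
  shows "f differentiable (at x) \<longleftrightarrow> g differentiable (at x)"
  unfolding differentiable_def using has_derivative_cong_open[OF assms] by simp

lemma Ck_on_cong:
  assumes "open S" "\<And>x. x \<in> S \<Longrightarrow> f x = g x"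
  shows "Ck_on k S f \<longleftrightarrow> Ck_on k S g"
  using assms(2)
proof (induction k arbitrary: f g)
  case 0
  then show ?case by (simp cong: continuous_on_cong)
next
  case (Suc k)
  have "Ck_on k S (\<lambda>x. frechet_derivative f (at x) v) \<longleftrightarrow>
      Ck_on k S (\<lambda>x. frechet_derivative g (at x) v)" for v
    by (rule Suc.IH) (metis frechet_derivative_cong_open[OF assms(1)] Suc.prems)
  moreover have "f differentiable (at x) \<longleftrightarrow> g differentiable (at x)" if "x \<in> S" for x
    by (rule differentiable_cong_open[OF assms(1) that Suc.prems])
  ultimately show ?case by simp
qed

text \<open>\<open>frechet_derivative\<close> is a choice operator. On an open set it agrees with
  any explicit derivative, so regularity proofs can exhibit a formula and continue by induction on
  that formula.\<close>

lemma Ck_on_SucI: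
  assumes "open S" "\<And>x. x \<in> S \<Longrightarrow> (f has_derivative f' x) (at x)"
    "\<And>v. Ck_on k S (\<lambda>x. f' x v)"
  shows "Ck_on (Suc k) S f"
proof -
  have "Ck_on k S (\<lambda>x. frechet_derivative f (at x) v)" for v
    using assms(3)[of v]
    by (subst Ck_on_cong[OF assms(1), where g = "\<lambda>x. f' x v"])
       (auto simp: frechet_derivative_eqI[OF assms(2)])
  then show ?thesis using assms(2) by (auto simp: differentiable_def)
qed

lemma Ck_on_Suc_has_derivative:
  assumes "Ck_on (Suc k) S f" "x \<in> S"
  shows "(f has_derivative frechet_derivative f (at x)) (at x)"
  using assms by (simp add: frechet_derivative_works)

lemma Ck_on_SucD: "Ck_on (Suc k) S f \<Longrightarrow> Ck_on k S f"
proof (induction k arbitrary: f)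
  case 0
  then show ?case
    by (auto intro!: continuous_at_imp_continuous_on differentiable_imp_continuous_within)
next
  case (Suc k)
  from Suc.prems have "\<forall>v. Ck_on (Suc k) S (\<lambda>x. frechet_derivative f (at x) v)"
    and "\<forall>x\<in>S. f differentiable (at x)"
    by (simp_all del: Ck_on.simps(2) add: Ck_on.simps(2)[of "Suc k"])
  with Suc.IH show ?case by simp
qed

lemma Ck_on_mono: "Ck_on k S f \<Longrightarrow> j \<le> k \<Longrightarrow> Ck_on j S f"
  by (induction k) (auto simp: le_Suc_eq dest: Ck_on_SucD simp del: Ck_on.simps(2))

lemma Ck_on_continuous: "Ck_on k S f \<Longrightarrow> continuous_on S f"
  using Ck_on_mono[of k S f 0] by simp

lemma Ck_on_subset: "Ck_on k S f \<Longrightarrow> T \<subseteq> S \<Longrightarrow> Ck_on k T f"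
  by (induction k arbitrary: f) (auto intro: continuous_on_subset)

text \<open>Continuity and derivatives at a point see only a neighbourhood. This is how functions
  and fields with different local descriptions are glued, in particular extensions by zero.\<close>

lemma Ck_on_local:
  assumes "\<And>x. x \<in> S \<Longrightarrow> \<exists>U. open U \<and> x \<in> U \<and> Ck_on k U f"
  shows "Ck_on k S f"
  using assms
proof (induction k arbitrary: f)
  case 0
  have "continuous (at x within S) f" if x: "x \<in> S" for x
  proof -
    obtain U where "open U" "x \<in> U" "continuous_on U f" using 0 x by auto
    then show ?thesis
      using continuous_on_eq_continuous_at continuous_at_imp_continuous_at_within by blast
  qed
  then show ?case by (simp add: continuous_on_eq_continuous_within)
next
  case (Suc k)
  have "Ck_on k S (\<lambda>x. frechet_derivative f (at x) v)" for v
  proof (rule Suc.IH)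
    fix x assume "x \<in> S"
    then obtain U where "open U" "x \<in> U" "Ck_on (Suc k) U f" using Suc.prems by blast
    then show "\<exists>U. open U \<and> x \<in> U \<and> Ck_on k U (\<lambda>x. frechet_derivative f (at x) v)"
      by auto
  qed
  moreover have "f differentiable (at x)" if "x \<in> S" for x
    using Suc.prems[OF that] by auto
  ultimately show ?case by simp
qed

lemma Ck_on_const: "Ck_on k S (\<lambda>x. c)"
  by (induction k arbitrary: c) auto

lemma Ck_on_bounded_linear:
  assumes "open S" "bounded_linear L"
  shows "Ck_on k S L"
proof (cases k)
  case 0
  then show ?thesis by (simp add: linear_continuous_on assms)
next
  case (Suc j)
  show ?thesis
    unfolding Suc
    by (rule Ck_on_SucI[OF assms(1), where f' = "\<lambda>x. L"])
      (simp_all add: bounded_linear_imp_has_derivative assms Ck_on_const)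
qed

lemma Ck_on_add:
  assumes "open S" "Ck_on k S f" "Ck_on k S g"
  shows "Ck_on k S (\<lambda>x. f x + g x)"
  using assms(2,3)
proof (induction k arbitrary: f g)
  case 0
  then show ?case by (auto intro: continuous_on_add)
next
  case (Suc k)
  show ?case
  proof (rule Ck_on_SucI[OF assms(1)])
    show "((\<lambda>x. f x + g x) has_derivative
        (\<lambda>v. frechet_derivative f (at x) v + frechet_derivative g (at x) v)) (at x)"
      if "x \<in> S" for x
      by (intro has_derivative_add Ck_on_Suc_has_derivative[OF Suc.prems(1) that]
          Ck_on_Suc_has_derivative[OF Suc.prems(2) that])
    show "Ck_on k S (\<lambda>x. frechet_derivative f (at x) v + frechet_derivative g (at x) v)" for v
      using Suc.prems by (intro Suc.IH) simp_all
  qed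
qed

lemma Ck_on_sum:
  assumes "open S" "\<And>i. i \<in> I \<Longrightarrow> Ck_on k S (f i)"
  shows "Ck_on k S (\<lambda>x. \<Sum>i\<in>I. f i x)"
  using assms(2)
  by (induction I rule: infinite_finite_induct) (auto intro: Ck_on_const Ck_on_add[OF assms(1)])

text \<open>One induction covers scalar multiples, products and inner products. In each Leibniz term
  one factor is a derivative and has lost an order, so the other is lowered to the same order before
  the induction hypothesis applies.\<close>

lemma (in bounded_bilinear) Ck_on:
  assumes "open S" "Ck_on k S f" "Ck_on k S g"
  shows "Ck_on k S (\<lambda>x. prod (f x) (g x))"
  using assms(2,3)
proof (induction k arbitrary: f g)
  case 0
  then show ?case by (auto intro: continuous_on)
next
  case (Suc k)
  note f = Ck_on_Suc_has_derivative[OF Suc.prems(1)] and g = Ck_on_Suc_has_derivative[OF Suc.prems(2)]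
  show ?case
  proof (rule Ck_on_SucI[OF assms(1)])
    show "((\<lambda>x. prod (f x) (g x)) has_derivative
        (\<lambda>v. prod (f x) (frechet_derivative g (at x) v) + prod (frechet_derivative f (at x) v) (g x))) (at x)"
      if "x \<in> S" for x
      by (rule FDERIV[OF f[OF that] g[OF that]])
    show "Ck_on k S (\<lambda>x. prod (f x) (frechet_derivative g (at x) v) +
        prod (frechet_derivative f (at x) v) (g x))" for v
      using Suc.prems
      by (intro Ck_on_add[OF assms(1)] Suc.IH Ck_on_SucD[OF Suc.prems(1)] Ck_on_SucD[OF Suc.prems(2)])
        simp_all
  qed
qed

lemmas Ck_on_scaleR = bounded_bilinear.Ck_on[OF bounded_bilinear_scaleR]
lemmas Ck_on_mult = bounded_bilinear.Ck_on[OF bounded_bilinear_mult]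
lemmas Ck_on_inner = bounded_bilinear.Ck_on[OF bounded_bilinear_inner]

text \<open>The chain rule evaluates the derivative of \<open>f\<close> at a vector depending on
  \<open>x\<close>, whereas \<open>Ck_on\<close> controls derivatives in fixed directions only.
  Expanding that vector in the basis gives products of fixed-direction derivatives; hence the
  intermediate space is Euclidean.\<close>

lemma Ck_on_compose:
  fixes f :: "'b::euclidean_space \<Rightarrow> 'c::real_normed_vector"
    and h :: "'a::real_normed_vector \<Rightarrow> 'b"
  assumes "open S" "open T" "h ` S \<subseteq> T" "Ck_on k T f" "Ck_on k S h"
  shows "Ck_on k S (\<lambda>x. f (h x))"
  using assms(4,5)
proof (induction k arbitrary: f)
  case 0
  then show ?case using assms(3) continuous_on_compose2 by auto
next
  case (Suc k)
  show ?case
  proof (rule Ck_on_SucI[OF assms(1)])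
    show "((\<lambda>x. f (h x)) has_derivative (\<lambda>v. \<Sum>b\<in>Basis. (frechet_derivative h (at x) v \<bullet> b) *\<^sub>R
        frechet_derivative f (at (h x)) b)) (at x)" if "x \<in> S" for x
    proof -
      have d: "(f has_derivative frechet_derivative f (at (h x))) (at (h x))"
        using Ck_on_Suc_has_derivative[OF Suc.prems(1)] assms(3) that by blast
      have "linear (frechet_derivative f (at (h x)))"
        using d has_derivative_linear by blast
      then have eq: "frechet_derivative f (at (h x)) w =
          (\<Sum>b\<in>Basis. (w \<bullet> b) *\<^sub>R frechet_derivative f (at (h x)) b)" for w
        by (subst (1) euclidean_representation[symmetric]) (simp add: linear_sum linear_scale)
      have "((\<lambda>x. f (h x)) has_derivative
          (\<lambda>v. frechet_derivative f (at (h x)) (frechet_derivative h (at x) v))) (at x)"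
        using has_derivative_compose[OF Ck_on_Suc_has_derivative[OF Suc.prems(2) that] d] .
      then show ?thesis by (subst (asm) eq)
    qed
    show "Ck_on k S (\<lambda>x. \<Sum>b\<in>Basis. (frechet_derivative h (at x) v \<bullet> b) *\<^sub>R
        frechet_derivative f (at (h x)) b)" for v
    proof (intro Ck_on_sum[OF assms(1)] Ck_on_scaleR[OF assms(1)] Ck_on_inner[OF assms(1)] Ck_on_const)
      show "Ck_on k S (\<lambda>x. frechet_derivative h (at x) v)"
        using Suc.prems(2) by simp
      show "Ck_on k S (\<lambda>x. frechet_derivative f (at (h x)) b)" for b
        by (rule Suc.IH[OF _ Ck_on_SucD[OF Suc.prems(2)]]) (use Suc.prems(1) in simp)
    qed
  qed
qed

lemma Ck_on_prod:
  fixes f :: "'i \<Rightarrow> 'a::real_normed_vector \<Rightarrow> real"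
  assumes "open S" "\<And>i. i \<in> I \<Longrightarrow> Ck_on k S (f i)"
  shows "Ck_on k S (\<lambda>x. \<Prod>i\<in>I. f i x)"
  using assms(2)
  by (induction I rule: infinite_finite_induct) (auto intro: Ck_on_const Ck_on_mult[OF assms(1)])

lemma Ck_on_uminus:
  assumes "open S" "Ck_on k S f"
  shows "Ck_on k S (\<lambda>x. - f x)"
  using Ck_on_scaleR[OF assms(1) Ck_on_const assms(2), of "-1"] by simp

lemma Ck_on_diff:
  assumes "open S" "Ck_on k S f" "Ck_on k S g"
  shows "Ck_on k S (\<lambda>x. f x - g x)"
  using Ck_on_add[OF assms(1,2) Ck_on_uminus[OF assms(1,3)]] by simp

text \<open>The derivative is again a product built from \<open>inverse\<close>, so the induction
  closes on itself.\<close>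

lemma Ck_on_inverse: "Ck_on k ({0<..} :: real set) inverse"
proof (induction k)
  case 0
  then show ?case by (auto intro!: continuous_intros)
next
  case (Suc k)
  show ?case
    by (rule Ck_on_SucI[where f' = "\<lambda>x v. - (inverse x * v * inverse x)"])
      (auto intro!: has_derivative_inverse' Ck_on_uminus Ck_on_mult Suc Ck_on_const)
qed

section \<open>Flat functions, smooth steps and bumps\<close>

text \<open>The polynomial factor makes this family of flat functions closed under differentiation.\<close>

definition flat_exp :: "real poly \<Rightarrow> real \<Rightarrow> real" where
  "flat_exp P x = (if x \<le> 0 then 0 else poly P (1 / x) * exp (- (1 / x)))"

lemma poly_times_exp_neg_tendsto_0: "((\<lambda>y::real. poly P y * exp (- y)) \<longlongrightarrow> 0) at_top"
proof -
  have "((\<lambda>y. \<Sum>i\<le>degree P. coeff P i * (y ^ i / exp y)) \<longlongrightarrow> (\<Sum>i\<le>degree P. coeff P i * 0)) at_top"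
    by (intro tendsto_sum tendsto_mult tendsto_const tendsto_power_div_exp_0)
  then show ?thesis
    by (simp add: poly_altdef sum_distrib_right exp_minus divide_inverse mult.assoc)
qed

lemma flat_exp_tendsto_0: "(flat_exp P \<longlongrightarrow> 0) (at 0)"
proof -
  have "((\<lambda>x. poly P (1 / x) * exp (- (1 / x))) \<longlongrightarrow> 0) (at_right 0)"
    by (rule filterlim_compose[OF poly_times_exp_neg_tendsto_0])
      (simp add: divide_inverse filterlim_inverse_at_top_right)
  then have "(flat_exp P \<longlongrightarrow> 0) (at_right 0)"
    by (rule Lim_transform_eventually)
      (auto simp: eventually_at_filter flat_exp_def)
  moreover have "(flat_exp P \<longlongrightarrow> 0) (at_left 0)"
    by (rule Lim_transform_eventually[OF tendsto_const])
      (auto simp: eventually_at_filter flat_exp_def)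
  ultimately show ?thesis by (simp add: filterlim_at_split)
qed

text \<open>With y = 1 / x one has y' = - y^2, so P(y) exp(-y) has derivative y^2 (P - P')(y)
  exp(-y); \<open>[:0, 0, 1:]\<close> is the factor y^2.\<close>

lemma flat_exp_has_derivative:
  "(flat_exp P has_real_derivative flat_exp ([:0, 0, 1:] * (P - pderiv P)) x) (at x)"
proof -
  consider "x < 0" | "x = 0" | "x > 0" by linarith
  then show ?thesis
  proof cases
    case 1
    have "((\<lambda>x. 0) has_real_derivative 0) (at x)" by simp
    then have "(flat_exp P has_real_derivative 0) (at x)"
      by (rule DERIV_cong_ev[THEN iffD1, rotated -1])
        (use 1 in \<open>auto simp: flat_exp_def eventually_nhds intro!: exI[of _ "{..<0}"]\<close>)
    then show ?thesis using 1 by (simp add: flat_exp_def)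
  next
    case 2
    \<comment> \<open>Dividing by \<open>h\<close> multiplies the polynomial in 1 / h by its
      variable, so the difference quotient at 0 is itself a flat function and tends to 0.\<close>
    have "flat_exp P h / h = flat_exp ([:0, 1:] * P) h" for h
      by (simp add: flat_exp_def)
    then have "((\<lambda>h. (flat_exp P (0 + h) - flat_exp P 0) / h) \<longlongrightarrow> 0) (at 0)"
      using flat_exp_tendsto_0[of "[:0, 1:] * P"] by (simp add: flat_exp_def[of _ 0] del: mult_pCons_left)
    then show ?thesis using 2 by (simp add: DERIV_def flat_exp_def[of _ 0])
  next
    case 3
    have "((\<lambda>x. poly P (1 / x) * exp (- (1 / x))) has_real_derivative
        poly ([:0, 0, 1:] * (P - pderiv P)) (1 / x) * exp (- (1 / x))) (at x)"
      using 3
      by (auto intro!: derivative_eq_intros DERIV_chain'[OF _ poly_DERIV] simp: divide_simps)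
        (auto simp: algebra_simps power2_eq_square)
    then have "(flat_exp P has_real_derivative
        poly ([:0, 0, 1:] * (P - pderiv P)) (1 / x) * exp (- (1 / x))) (at x)"
      by (rule DERIV_cong_ev[THEN iffD1, rotated -1])
        (use 3 in \<open>auto simp: flat_exp_def eventually_nhds intro!: exI[of _ "{0<..}"]\<close>)
    then show ?thesis using 3 by (simp add: flat_exp_def)
  qed
qed

lemma Ck_on_flat_exp: "Ck_on k UNIV (flat_exp P)"
proof (induction k arbitrary: P)
  case 0
  have "isCont (flat_exp P) x" for x using flat_exp_has_derivative DERIV_isCont by blast
  then show ?case by (simp add: continuous_on_eq_continuous_at)
next
  case (Suc k)
  show ?case
    by (rule Ck_on_SucI[OF open_UNIV flat_exp_has_derivative[THEN has_field_derivative_imp_has_derivative]])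
      (intro Ck_on_mult open_UNIV Suc Ck_on_const)
qed

definition smooth_step :: "real \<Rightarrow> real" where
  "smooth_step x = flat_exp 1 x * inverse (flat_exp 1 x + flat_exp 1 (1 - x))"

lemma flat_exp_1_nonneg: "flat_exp 1 x \<ge> 0" by (simp add: flat_exp_def)

text \<open>The numbers \<open>x\<close> and \<open>1 - x\<close> cannot both be nonpositive, so the
  denominator of \<open>smooth_step\<close> never vanishes.\<close>

lemma flat_exp_1_sum_pos: "flat_exp 1 x + flat_exp 1 (1 - x) > 0"
  by (auto simp: flat_exp_def add_pos_pos)

lemma Ck_on_smooth_step: "Ck_on k UNIV smooth_step"
  unfolding smooth_step_def
proof (intro Ck_on_mult[OF open_UNIV Ck_on_flat_exp] Ck_on_compose[OF open_UNIV _ _ Ck_on_inverse])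
  have "Ck_on k UNIV (\<lambda>x::real. 1 - x)"
    by (intro Ck_on_diff open_UNIV Ck_on_const Ck_on_bounded_linear bounded_linear_ident)
  then have "Ck_on k UNIV (\<lambda>x. flat_exp 1 (1 - x))"
    by (intro Ck_on_compose[OF open_UNIV open_UNIV _ Ck_on_flat_exp]) auto
  then show "Ck_on k UNIV (\<lambda>x. flat_exp 1 x + flat_exp 1 (1 - x))"
    by (intro Ck_on_add[OF open_UNIV] Ck_on_flat_exp)
qed (use flat_exp_1_sum_pos in auto)

lemma smooth_step_bounds: "0 \<le> smooth_step x" "smooth_step x \<le> 1"
  using flat_exp_1_nonneg[of x] flat_exp_1_nonneg[of "1 - x"] flat_exp_1_sum_pos[of x]
  by (simp_all add: smooth_step_def field_simps)

lemma smooth_step_eq_0: "x \<le> 0 \<Longrightarrow> smooth_step x = 0"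
  by (simp add: smooth_step_def flat_exp_def)

lemma smooth_step_eq_1: "x \<ge> 1 \<Longrightarrow> smooth_step x = 1"
  by (simp add: smooth_step_def flat_exp_def)

lemma Ck_bump_function:
  fixes x0 :: "'a::euclidean_space"
  assumes "r > 0"
  obtains f :: "'a \<Rightarrow> real" where "\<And>k. Ck_on k UNIV f" "\<And>x. 0 \<le> f x" "\<And>x. f x \<le> 1"
    "\<And>x. dist x x0 < r / 2 \<Longrightarrow> f x = 1" "\<And>x. dist x x0 \<ge> r \<Longrightarrow> f x = 0"
proof
  \<comment> \<open>The argument of the step is affine in the squared relative distance s: it equals
    1 at s = 1/4 and 0 at s = 1. The square keeps the function smooth at the centre.\<close>
  define f where "f x = smooth_step (4 / 3 - 4 / 3 * (((x - x0) \<bullet> (x - x0)) / r\<^sup>2))" for x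
  have ip: "(x - x0) \<bullet> (x - x0) = (dist x x0)\<^sup>2" for x
    by (simp add: dist_norm power2_norm_eq_inner)
  have "Ck_on k UNIV (\<lambda>x. x - x0)" for k
    by (intro Ck_on_diff open_UNIV Ck_on_const Ck_on_bounded_linear bounded_linear_ident)
  then have "Ck_on k UNIV (\<lambda>x. (x - x0) \<bullet> (x - x0))" for k
    by (intro Ck_on_inner open_UNIV)
  then have "Ck_on k UNIV (\<lambda>x. 4 / 3 - 4 / 3 * (((x - x0) \<bullet> (x - x0)) / r\<^sup>2))" for k
    unfolding divide_inverse by (intro Ck_on_diff Ck_on_mult open_UNIV Ck_on_const)
  then show "Ck_on k UNIV f" for k
    unfolding f_def by (intro Ck_on_compose[OF open_UNIV open_UNIV _ Ck_on_smooth_step]) auto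
  show "0 \<le> f x" "f x \<le> 1" for x by (simp_all add: f_def smooth_step_bounds)
  show "f x = 1" if "dist x x0 < r / 2" for x
  proof -
    have "(dist x x0)\<^sup>2 \<le> (r / 2)\<^sup>2" using that by (intro power_mono) auto
    then have "(dist x x0)\<^sup>2 / r\<^sup>2 \<le> 1 / 4" using assms by (simp add: field_simps)
    then show ?thesis unfolding f_def ip by (intro smooth_step_eq_1) linarith
  qed
  show "f x = 0" if "dist x x0 \<ge> r" for x
  proof -
    have "r\<^sup>2 \<le> (dist x x0)\<^sup>2" using that assms by (intro power_mono) auto
    then have "(dist x x0)\<^sup>2 / r\<^sup>2 \<ge> 1" using assms by (simp add: field_simps)
    then show ?thesis unfolding f_def ip by (intro smooth_step_eq_0) linarith
  qed
qed

section \<open>Charts and cutoff functions\<close>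

lemma
  assumes "is_chart c"
  shows is_chart_open: "open (fst c)"
    and is_chart_open_image: "open (snd c ` fst c)"
    and chart_inv_in: "x \<in> snd c ` fst c \<Longrightarrow> chart_inv c x \<in> fst c"
    and chart_chart_inv: "x \<in> snd c ` fst c \<Longrightarrow> snd c (chart_inv c x) = x"
    and chart_inv_chart: "p \<in> fst c \<Longrightarrow> chart_inv c (snd c p) = p"
    and is_chart_continuous: "continuous_on (fst c) (snd c)"
    and chart_inv_continuous: "continuous_on (snd c ` fst c) (chart_inv c)"
  using assms unfolding is_chart_def by (auto simp: homeomorphism_def)

lemma open_chart_image:
  assumes "is_chart c" "open V"
  shows "open (snd c ` (fst c \<inter> V))"
proof -
  have "snd c ` (fst c \<inter> V) = snd c ` fst c \<inter> chart_inv c -` V"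
    using assms(1) by (force simp: chart_inv_chart chart_chart_inv chart_inv_in)
  then show ?thesis
    using continuous_open_preimage[OF chart_inv_continuous[OF assms(1)]
        is_chart_open_image[OF assms(1)] assms(2)] by simp
qed

lemma compatible_sym: "compatible c d \<longleftrightarrow> compatible d c"
  by (auto simp: compatible_def Int_commute)

section \<open>Jacobians of chart changes\<close>

text \<open>Both \<open>components\<close> and \<open>coord_vector\<close> are transitions with
  \<open>chart_at A p\<close> as one of the two charts, so their algebra reduces to the cocycle law
  \<open>transition_transition\<close>.\<close>

definition transition ::
  "('m, 'e::euclidean_space) chart \<Rightarrow> ('m, 'e) chart \<Rightarrow> 'm \<Rightarrow> 'e \<Rightarrow> 'e" where
  "transition c d p = frechet_derivative (snd d \<circ> chart_inv c) (at (snd c p))"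

lemma components_eq_transition: "components A c p = transition (chart_at A p) c p"
  by (auto simp: components_def transition_def)

lemma coord_vector_eq_transition: "coord_vector A c p = transition c (chart_at A p) p"
  by (auto simp: coord_vector_def transition_def)

lemma compatible_Ck_on:
  "compatible c d \<Longrightarrow> Ck_on k (snd c ` (fst c \<inter> fst d)) (snd d \<circ> chart_inv c)"
  by (auto simp: compatible_def smooth_on_def)

lemma transition_has_derivative:
  assumes "compatible c d" "p \<in> fst c" "p \<in> fst d"
  shows "((snd d \<circ> chart_inv c) has_derivative transition c d p) (at (snd c p))"
  unfolding transition_def
  by (rule Ck_on_Suc_has_derivative[OF compatible_Ck_on[OF assms(1), of "Suc 0"]]) (use assms in auto)

lemma linear_transition:
  assumes "compatible c d" "p \<in> fst c" "p \<in> fst d"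
  shows "linear (transition c d p)"
  using transition_has_derivative[OF assms] has_derivative_linear by blast

lemma transition_self:
  assumes "is_chart c" "p \<in> fst c"
  shows "transition c c p u = u"
proof -
  have "((snd c \<circ> chart_inv c) has_derivative (\<lambda>u. u)) (at (snd c p))"
    by (subst has_derivative_cong_open[OF is_chart_open_image[OF assms(1)], where g = "\<lambda>x. x"])
      (use assms in \<open>auto simp: chart_chart_inv\<close>)
  then show ?thesis by (simp add: transition_def frechet_derivative_eqI)
qed

lemma function_transition_has_derivative:
  assumes "is_chart c" "is_chart d" "compatible c d" "p \<in> fst c" "p \<in> fst d"
    and "((f \<circ> chart_inv d) has_derivative D) (at (snd d p))"
  shows "((f \<circ> chart_inv c) has_derivative (\<lambda>u. D (transition c d p u))) (at (snd c p))"
proof -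
  have p: "(snd d \<circ> chart_inv c) (snd c p) = snd d p"
    using assms by (simp add: chart_inv_chart)
  have "(((f \<circ> chart_inv d) \<circ> (snd d \<circ> chart_inv c)) has_derivative (D \<circ> transition c d p)) (at (snd c p))"
    by (rule diff_chain_at[OF transition_has_derivative[OF assms(3-5)]]) (use assms(6) p in simp)
  then show ?thesis
    by (subst has_derivative_cong_open[OF open_chart_image[OF assms(1) is_chart_open[OF assms(2)]],
          where g = "(f \<circ> chart_inv d) \<circ> (snd d \<circ> chart_inv c)"])
      (use assms in \<open>auto simp: chart_inv_chart o_def\<close>)
qed

lemma transition_transition:
  assumes "is_chart c" "is_chart d" "compatible c d" "compatible d e"
    "p \<in> fst c" "p \<in> fst d" "p \<in> fst e"
  shows "transition d e p (transition c d p u) = transition c e p u"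
  using function_transition_has_derivative[OF assms(1-3,5,6)
      transition_has_derivative[OF assms(4,6,7)]]
  by (simp add: transition_def[of c e] frechet_derivative_eqI)

section \<open>Components, functions and fields on a smooth manifold\<close>

locale smooth_manifold =
  fixes A :: "('m::t2_space, 'e::euclidean_space) chart set"
  assumes atlas: "smooth_atlas A"
begin

text \<open>Foliated charts are compatible with the atlas but need not belong to it; this notion
  covers both kinds.\<close>

definition admissible :: "('m, 'e) chart \<Rightarrow> bool" where
  "admissible c \<longleftrightarrow> is_chart c \<and> (\<forall>d\<in>A. compatible c d)"

lemma admissible_is_chart: "admissible c \<Longrightarrow> is_chart c"
  and admissible_compatible: "admissible c \<Longrightarrow> d \<in> A \<Longrightarrow> compatible c d"
  by (auto simp: admissible_def)

lemma atlas_admissible: "c \<in> A \<Longrightarrow> admissible c"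
  using atlas by (auto simp: smooth_atlas_def admissible_def)

lemma atlas_is_chart: "c \<in> A \<Longrightarrow> is_chart c"
  by (simp add: atlas_admissible admissible_is_chart)

lemma chart_at: "chart_at A p \<in> A" "p \<in> fst (chart_at A p)"
proof -
  have "\<exists>c. c \<in> A \<and> p \<in> fst c" using atlas unfolding smooth_atlas_def by blast
  then show "chart_at A p \<in> A" "p \<in> fst (chart_at A p)"
    unfolding chart_at_def by (metis (mono_tags, lifting) someI_ex)+
qed

lemma chart_at_admissible [simp]: "admissible (chart_at A p)"
  by (simp add: atlas_admissible chart_at)

lemma linear_components: "admissible c \<Longrightarrow> p \<in> fst c \<Longrightarrow> linear (components A c p)"
  unfolding components_eq_transition
  by (rule linear_transition) (auto simp: chart_at compatible_sym[of _ c] admissible_compatible)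

lemma linear_coord_vector: "admissible c \<Longrightarrow> p \<in> fst c \<Longrightarrow> linear (coord_vector A c p)"
  unfolding coord_vector_eq_transition
  by (rule linear_transition) (auto simp: chart_at admissible_compatible)

lemma components_coord_vector:
  assumes "admissible c" "admissible d" "p \<in> fst c" "p \<in> fst d"
  shows "components A d p (coord_vector A c p u) = transition c d p u"
  unfolding components_eq_transition coord_vector_eq_transition
  by (rule transition_transition)
    (use assms in \<open>auto simp: chart_at admissible_is_chart admissible_compatible compatible_sym[of _ d]\<close>)

lemma components_coord_vector_self [simp]:
  assumes "admissible c" "p \<in> fst c"
  shows "components A c p (coord_vector A c p u) = u"
  using assms by (simp add: components_coord_vector transition_self admissible_is_chart)

lemma coord_vector_components [simp]:
  assumes "admissible c" "p \<in> fst c"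
  shows "coord_vector A c p (components A c p v) = v"
proof -
  have "transition c (chart_at A p) p (transition (chart_at A p) c p v) =
      transition (chart_at A p) (chart_at A p) p v"
    by (rule transition_transition)
      (use assms in \<open>auto simp: chart_at admissible_is_chart admissible_compatible compatible_sym[of _ c]\<close>)
  then show ?thesis
    by (simp add: components_eq_transition coord_vector_eq_transition transition_self chart_at
        admissible_is_chart)
qed

lemma transition_components:
  assumes "admissible c" "admissible d" "p \<in> fst c" "p \<in> fst d"
  shows "transition c d p (components A c p v) = components A d p v"
  using components_coord_vector[OF assms, of "components A c p v"] assms by simp

lemma dir_deriv_chart:
  assumes "admissible c" "p \<in> fst c" "((f \<circ> chart_inv c) has_derivative D) (at (snd c p))"
  shows "dir_deriv A f p v = D (components A c p v)"
  using function_transition_has_derivative[OF _ _ _ _ _ assms(3), of "chart_at A p"]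
    assms(1,2)
  by (simp add: dir_deriv_def components_eq_transition admissible_is_chart chart_at
      compatible_sym[of _ c] admissible_compatible frechet_derivative_eqI)

text \<open>A finite order is kept because the field in the divergence argument is built from powers
  of a positive part and is only C^1.\<close>

definition Ck_fun :: "nat \<Rightarrow> ('m \<Rightarrow> real) \<Rightarrow> bool" where
  "Ck_fun k f \<longleftrightarrow> (\<forall>c\<in>A. Ck_on k (snd c ` fst c) (f \<circ> chart_inv c))"

definition chart_field :: "('m, 'e) chart \<Rightarrow> ('m \<Rightarrow> 'e) \<Rightarrow> 'e \<Rightarrow> 'e" where
  "chart_field c X x = components A c (chart_inv c x) (X (chart_inv c x))"

definition Ck_field :: "nat \<Rightarrow> ('m \<Rightarrow> 'e) \<Rightarrow> bool" where
  "Ck_field k X \<longleftrightarrow> (\<forall>c\<in>A. Ck_on k (snd c ` fst c) (chart_field c X))"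

lemma smooth_fun_iff: "smooth_fun A f \<longleftrightarrow> (\<forall>k. Ck_fun k f)"
  by (auto simp: smooth_fun_def smooth_on_def Ck_fun_def)

lemma smooth_field_iff: "smooth_field A X \<longleftrightarrow> (\<forall>k. Ck_field k X)"
  by (auto simp: smooth_field_def smooth_on_def Ck_field_def chart_field_def[abs_def])

lemma Ck_funD: "Ck_fun k f \<Longrightarrow> c \<in> A \<Longrightarrow> Ck_on k (snd c ` fst c) (f \<circ> chart_inv c)"
  by (simp add: Ck_fun_def)

lemma Ck_fieldD: "Ck_field k X \<Longrightarrow> c \<in> A \<Longrightarrow> Ck_on k (snd c ` fst c) (chart_field c X)"
  by (simp add: Ck_field_def)

lemma Ck_fun_has_derivative:
  assumes "Ck_fun (Suc 0) f" "c \<in> A" "p \<in> fst c"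
  shows "((f \<circ> chart_inv c) has_derivative
    (\<lambda>u. dir_deriv A f p (coord_vector A c p u))) (at (snd c p))"
proof -
  have d: "((f \<circ> chart_inv c) has_derivative frechet_derivative (f \<circ> chart_inv c) (at (snd c p))) (at (snd c p))"
    by (rule Ck_on_Suc_has_derivative[OF Ck_funD[OF assms(1,2)]]) (use assms in auto)
  then show ?thesis
    using dir_deriv_chart[OF atlas_admissible[OF assms(2)] assms(3) d]
    by (simp add: assms atlas_admissible)
qed

text \<open>In a Hausdorff space \<open>K\<close> is closed. Every point therefore lies in the chart
  domain, where regularity is assumed, or in the open complement of \<open>K\<close>, where the
  function vanishes.\<close>

lemma Ck_fun_extend:
  assumes c: "admissible c" and K: "compact K" "K \<subseteq> fst c" "\<And>q. q \<notin> K \<Longrightarrow> f q = 0"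
    and f: "Ck_on k (snd c ` fst c) (f \<circ> chart_inv c)"
  shows "Ck_fun k f"
  unfolding Ck_fun_def
proof
  fix d assume d: "d \<in> A"
  note ch = admissible_is_chart[OF c] atlas_is_chart[OF d]
  have cmp: "compatible d c" using c d by (simp add: compatible_sym admissible_compatible)
  show "Ck_on k (snd d ` fst d) (f \<circ> chart_inv d)"
  proof (rule Ck_on_local)
    fix x assume "x \<in> snd d ` fst d"
    then obtain q where q: "q \<in> fst d" "x = snd d q" by blast
    show "\<exists>U. open U \<and> x \<in> U \<and> Ck_on k U (f \<circ> chart_inv d)"
    proof (cases "q \<in> fst c")
      case True
      let ?U = "snd d ` (fst d \<inter> fst c)"
      have o: "open ?U" by (rule open_chart_image[OF ch(2) is_chart_open[OF ch(1)]])
      have "Ck_on k ?U (\<lambda>x. (f \<circ> chart_inv c) ((snd c \<circ> chart_inv d) x))"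
        by (rule Ck_on_compose[OF o is_chart_open_image[OF ch(1)] _ f compatible_Ck_on[OF cmp]])
          (use ch in \<open>auto simp: chart_inv_chart\<close>)
      then have "Ck_on k ?U (f \<circ> chart_inv d)"
        by (subst Ck_on_cong[OF o, where g = "\<lambda>x. (f \<circ> chart_inv c) ((snd c \<circ> chart_inv d) x)"])
          (use ch in \<open>auto simp: chart_inv_chart\<close>)
      then show ?thesis using o q True by blast
    next
      case False
      let ?U = "snd d ` (fst d \<inter> - K)"
      have o: "open ?U"
        by (rule open_chart_image[OF ch(2)]) (simp add: K compact_imp_closed open_Compl)
      have "Ck_on k ?U (f \<circ> chart_inv d)"
        by (subst Ck_on_cong[OF o, where g = "\<lambda>x. 0"])
          (use ch K in \<open>auto simp: chart_inv_chart Ck_on_const\<close>)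
      then show ?thesis using o q False K by blast
    qed
  qed
qed

lemma Ck_field_extend:
  assumes c: "admissible c" and K: "compact K" "K \<subseteq> fst c" "\<And>q. q \<notin> K \<Longrightarrow> X q = 0"
    and w: "Ck_on k (snd c ` fst c) w" "\<And>q. q \<in> fst c \<Longrightarrow> X q = coord_vector A c q (w (snd c q))"
  shows "Ck_field k X"
  unfolding Ck_field_def
proof
  fix d assume d: "d \<in> A"
  note ch = admissible_is_chart[OF c] atlas_is_chart[OF d]
  have cmp: "compatible d c" "compatible c d"
    using c d by (simp_all add: compatible_sym admissible_compatible)
  show "Ck_on k (snd d ` fst d) (chart_field d X)"
  proof (rule Ck_on_local)
    fix x assume "x \<in> snd d ` fst d"
    then obtain q where q: "q \<in> fst d" "x = snd d q" by blast
    show "\<exists>U. open U \<and> x \<in> U \<and> Ck_on k U (chart_field d X)"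
    proof (cases "q \<in> fst c")
      case True
      let ?U = "snd d ` (fst d \<inter> fst c)" and ?V = "snd c ` (fst c \<inter> fst d)"
      have o: "open ?U" "open ?V"
        by (rule open_chart_image[OF ch(2) is_chart_open[OF ch(1)]])
          (rule open_chart_image[OF ch(1) is_chart_open[OF ch(2)]])
      \<comment> \<open>This is the Jacobian from \<open>c\<close> to \<open>d\<close> applied to
        \<open>w\<close>. It is expanded in the basis because only derivatives in fixed directions
        are known to be of class C^k.\<close>
      define h where "h y = (\<Sum>b\<in>Basis. (w y \<bullet> b) *\<^sub>R
          frechet_derivative (snd d \<circ> chart_inv c) (at y) b)" for y
      have "Ck_on k ?V h"
        unfolding h_def
      proof (intro Ck_on_sum[OF o(2)] Ck_on_scaleR[OF o(2)] Ck_on_inner[OF o(2)] Ck_on_const)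
        show "Ck_on k ?V w" using w(1) by (rule Ck_on_subset) auto
        show "Ck_on k ?V (\<lambda>y. frechet_derivative (snd d \<circ> chart_inv c) (at y) b)" for b
          using compatible_Ck_on[OF cmp(2), of "Suc k"] by simp
      qed
      then have "Ck_on k ?U (\<lambda>x. h ((snd c \<circ> chart_inv d) x))"
        by (intro Ck_on_compose[OF o _ _ compatible_Ck_on[OF cmp(1)]])
          (use ch in \<open>auto simp: chart_inv_chart\<close>)
      moreover have "chart_field d X y = h ((snd c \<circ> chart_inv d) y)" if "y \<in> ?U" for y
      proof -
        obtain r where r: "r \<in> fst d" "r \<in> fst c" "y = snd d r" using \<open>y \<in> ?U\<close> by blast
        have "linear (transition c d r)" using linear_transition[OF cmp(2) r(2,1)] .
        then have "transition c d r (w (snd c r)) =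
            (\<Sum>b\<in>Basis. (w (snd c r) \<bullet> b) *\<^sub>R transition c d r b)"
          by (subst (1) euclidean_representation[symmetric]) (simp add: linear_sum linear_scale)
        then show ?thesis
          using r ch c d
          by (simp add: chart_field_def chart_inv_chart w(2) components_coord_vector atlas_admissible
              h_def transition_def)
      qed
      ultimately have "Ck_on k ?U (chart_field d X)"
        by (subst Ck_on_cong[OF o(1), where g = "\<lambda>x. h ((snd c \<circ> chart_inv d) x)"]) auto
      then show ?thesis using o q True by blast
    next
      case False
      let ?U = "snd d ` (fst d \<inter> - K)"
      have o: "open ?U"
        by (rule open_chart_image[OF ch(2)]) (simp add: K compact_imp_closed open_Compl)
      have "Ck_on k ?U (chart_field d X)"
        by (subst Ck_on_cong[OF o, where g = "\<lambda>x. 0"])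
          (use ch K d in \<open>auto simp: chart_inv_chart Ck_on_const chart_field_def
             linear_0[OF linear_components[OF atlas_admissible]]\<close>)
      then show ?thesis using o q False K by blast
    qed
  qed
qed

text \<open>A bump in coordinates is pulled back and extended by zero. Its support fits into a
  closed ball inside the chart image, whose preimage is the compact set \<open>K\<close>.\<close>

lemma cutoff_function:
  assumes c: "admissible c" and p: "p \<in> fst c" and U: "open U" "p \<in> U"
  obtains \<eta> V K where "smooth_fun A \<eta>" "\<And>q. 0 \<le> \<eta> q" "\<And>q. \<eta> q \<le> 1"
    "open V" "p \<in> V" "V \<subseteq> U" "V \<subseteq> fst c" "\<And>q. q \<in> V \<Longrightarrow> \<eta> q = 1"
    "compact K" "K \<subseteq> fst c" "K \<subseteq> U" "\<And>q. q \<notin> K \<Longrightarrow> \<eta> q = 0"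
proof -
  note ch = admissible_is_chart[OF c]
  let ?W = "snd c ` (fst c \<inter> U)"
  have "open ?W" by (rule open_chart_image[OF ch U(1)])
  then obtain r where r: "r > 0" "cball (snd c p) r \<subseteq> ?W"
    using p U open_contains_cball by blast
  obtain f :: "'e \<Rightarrow> real" where f: "\<And>k. Ck_on k UNIV f" "\<And>x. 0 \<le> f x" "\<And>x. f x \<le> 1"
    "\<And>x. dist x (snd c p) < r / 2 \<Longrightarrow> f x = 1" "\<And>x. dist x (snd c p) \<ge> r \<Longrightarrow> f x = 0"
    using Ck_bump_function[OF r(1), of "snd c p"] by blast
  define \<eta> where "\<eta> q = (if q \<in> fst c then f (snd c q) else 0)" for q
  define K where "K = chart_inv c ` cball (snd c p) r"
  define V where "V = fst c \<inter> snd c -` ball (snd c p) (r / 2)"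
  have sub: "cball (snd c p) r \<subseteq> snd c ` fst c" using r by blast
  have K: "compact K" "K \<subseteq> fst c" "K \<subseteq> U"
  proof -
    show "compact K" unfolding K_def
      by (rule compact_continuous_image[OF continuous_on_subset[OF chart_inv_continuous[OF ch] sub]])
        simp
    show "K \<subseteq> fst c" using sub ch by (auto simp: K_def chart_inv_in)
    show "K \<subseteq> U"
    proof
      fix q assume "q \<in> K"
      then obtain x where x: "x \<in> ?W" "q = chart_inv c x" using r(2) unfolding K_def by blast
      then show "q \<in> U" using ch by (auto simp: chart_inv_chart)
    qed
  qed
  have out: "\<eta> q = 0" if "q \<notin> K" for q
  proof (cases "q \<in> fst c")
    case True
    have "snd c q \<notin> cball (snd c p) r"
    proof
      assume "snd c q \<in> cball (snd c p) r"
      then have "chart_inv c (snd c q) \<in> K" by (auto simp: K_def)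
      then show False using that True ch by (simp add: chart_inv_chart)
    qed
    then show ?thesis using f(5) by (simp add: \<eta>_def dist_commute)
  qed (simp add: \<eta>_def)
  have V: "open V"
    unfolding V_def using continuous_open_preimage[OF is_chart_continuous[OF ch] is_chart_open[OF ch]] by simp
  have VK: "V \<subseteq> K"
  proof
    fix q assume "q \<in> V"
    then show "q \<in> K"
      using ch r by (auto simp: V_def K_def chart_inv_chart intro!: image_eqI[where x = "snd c q"])
  qed
  have "Ck_fun k \<eta>" for k
  proof (rule Ck_fun_extend[OF c K(1,2) out])
    show "Ck_on k (snd c ` fst c) (\<eta> \<circ> chart_inv c)"
      by (subst Ck_on_cong[OF is_chart_open_image[OF ch], where g = f])
        (use ch in \<open>auto simp: \<eta>_def chart_inv_chart intro: Ck_on_subset[OF f(1)]\<close>)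
  qed
  then have "smooth_fun A \<eta>" by (simp add: smooth_fun_iff)
  then show thesis
    by (rule that[of \<eta> V K])
      (use f V VK K out p r in \<open>auto simp: \<eta>_def V_def dist_commute\<close>)
qed

end

section \<open>Determinants, traces and Lorentz forms\<close>

definition operator_trace :: "('e::euclidean_space \<Rightarrow> 'e) \<Rightarrow> real" where
  "operator_trace L = (\<Sum>b\<in>Basis. L b \<bullet> b)"

lemma linear_euclidean_sum:
  fixes L :: "'e::euclidean_space \<Rightarrow> 'f::real_vector"
  assumes "linear L"
  shows "L v = (\<Sum>b\<in>Basis. (v \<bullet> b) *\<^sub>R L b)"
  by (subst (1) euclidean_representation[symmetric]) (simp add: linear_sum linear_scale assms)

lemma operator_trace_commute:
  fixes S T :: "'e::euclidean_space \<Rightarrow> 'e"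
  assumes "linear S" "linear T"
  shows "operator_trace (\<lambda>v. S (T v)) = operator_trace (\<lambda>v. T (S v))"
proof -
  have *: "S (T b) \<bullet> b = (\<Sum>c\<in>Basis. (T b \<bullet> c) * (S c \<bullet> b))"
    if "linear S" for S T :: "'e \<Rightarrow> 'e" and b
    by (subst linear_euclidean_sum[OF that]) (simp add: inner_sum_left)
  show ?thesis
    unfolding operator_trace_def *[OF assms(1), of T] *[OF assms(2), of S]
    by (subst sum.swap) (simp add: mult.commute)
qed

text \<open>Commuting the trace moves \<open>Q\<close> next to \<open>P\<close>, where they cancel.
  Thus \<open>divergence\<close>, defined with a fixed basis, can be computed in any chart and in
  any adapted basis.\<close>

lemma operator_trace_conjugate:
  fixes L P Q :: "'e::euclidean_space \<Rightarrow> 'e"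
  assumes "linear L" "linear P" "linear Q" "\<And>v. P (Q v) = v"
  shows "operator_trace (\<lambda>v. Q (L (P v))) = operator_trace L"
  using operator_trace_commute[OF assms(3) linear_compose[OF assms(2,1)]] assms(4)
  by (simp add: o_def)

text \<open>An index type with \<open>DIM('e)\<close> elements, which makes determinants and the change of variables
  theorem, both stated for \<open>real ^ 'n\<close>, available on \<open>'e\<close>.\<close>

typedef (overloaded) ('e::euclidean_space) basis_index = "Basis :: 'e set"
  using nonempty_Basis by blast

lemma basis_index_image: "Rep_basis_index ` UNIV = Basis"
  by (metis type_definition.Rep_range type_definition_basis_index)

instance basis_index :: (euclidean_space) finite
proof
  have "finite (Rep_basis_index ` (UNIV :: 'a basis_index set))"
    by (simp add: basis_index_image)
  then show "finite (UNIV :: 'a basis_index set)"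
    by (rule finite_imageD) (simp add: inj_on_def Rep_basis_index_inject)
qed

text \<open>The order on the indices is arbitrary; the change of variables theorem asks for a well-ordered
  index type.\<close>

definition basis_rank :: "'e::euclidean_space basis_index \<Rightarrow> nat" where
  "basis_rank = (SOME f. inj f)"

lemma inj_basis_rank: "inj (basis_rank :: 'e::euclidean_space basis_index \<Rightarrow> nat)"
proof -
  obtain f :: "'e basis_index \<Rightarrow> nat" where "inj f"
    using finite_imp_inj_to_nat_seg[of "UNIV :: 'e basis_index set"] by auto
  then show ?thesis unfolding basis_rank_def by (rule someI[where P = inj])
qed

instantiation basis_index :: (euclidean_space) wellorder
begin

definition "less_eq_basis_index (i :: 'a basis_index) (j :: 'a basis_index) \<longleftrightarrow> basis_rank i \<le> basis_rank j"
definition "less_basis_index (i :: 'a basis_index) (j :: 'a basis_index) \<longleftrightarrow> basis_rank i < basis_rank j"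

instance
proof
  fix P :: "'a basis_index \<Rightarrow> bool" and a :: "'a basis_index"
  assume step: "\<And>x. (\<And>y. y < x \<Longrightarrow> P y) \<Longrightarrow> P x"
  show "P a"
    by (induction a rule: measure_induct_rule[where f = basis_rank])
      (rule step, simp add: less_basis_index_def)
qed (auto simp: less_eq_basis_index_def less_basis_index_def inj_eq[OF inj_basis_rank])

end

lemma sum_basis_index: "(\<Sum>i\<in>UNIV. f (Rep_basis_index i)) = (\<Sum>b\<in>Basis. f b)"
  using sum.reindex[of Rep_basis_index UNIV f]
  by (simp add: basis_index_image inj_on_def Rep_basis_index_inject)

lemma prod_basis_index: "(\<Prod>i\<in>UNIV. f (Rep_basis_index i)) = (\<Prod>b\<in>Basis. f b)"
  using prod.reindex[of Rep_basis_index UNIV f]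
  by (simp add: basis_index_image inj_on_def Rep_basis_index_inject)

section \<open>Gram matrices and matrices of operators\<close>

definition form_matrix ::
  "('e::euclidean_space \<Rightarrow> 'e \<Rightarrow> real) \<Rightarrow> real ^ 'e basis_index ^ 'e basis_index" where
  "form_matrix q = (\<chi> i j. q (Rep_basis_index i) (Rep_basis_index j))"

text \<open>The swapped arguments make column j the image of the j-th basis vector, as in the usual
  matrix of a linear map.\<close>

definition operator_matrix ::
  "('e::euclidean_space \<Rightarrow> 'e) \<Rightarrow> real ^ 'e basis_index ^ 'e basis_index" where
  "operator_matrix L = form_matrix (\<lambda>u v. L v \<bullet> u)"

lemma form_matrix_pullback:
  assumes "bilinear q" "linear L"
  shows "form_matrix (\<lambda>u v. q (L u) (L v)) =
    transpose (operator_matrix L) ** form_matrix q ** operator_matrix L"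
proof -
  have 1: "q (L u) w = (\<Sum>b\<in>Basis. (L u \<bullet> b) * q b w)" for u w
    using linear_euclidean_sum[of "\<lambda>z. q z w" "L u"] assms by (simp add: bilinear_def)
  have 2: "q w (L v) = (\<Sum>b\<in>Basis. q w b * (L v \<bullet> b))" for v w
    using linear_euclidean_sum[of "\<lambda>z. q w z" "L v"] assms by (simp add: bilinear_def mult.commute)
  have "q (L u) (L v) = (\<Sum>c\<in>Basis. (\<Sum>b\<in>Basis. (L u \<bullet> b) * q b c) * (L v \<bullet> c))" for u v
    by (subst 2) (simp add: 1)
  then show ?thesis
    by (simp add: operator_matrix_def form_matrix_def matrix_matrix_mult_def vec_eq_iff transpose_def
        sum_basis_index[where f = "\<lambda>b. (L u \<bullet> b) * q b c" for u c]
        sum_basis_index[where f = "\<lambda>c. (\<Sum>b\<in>Basis. (L u \<bullet> b) * q b c) * (L v \<bullet> c)" for u v])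
qed

lemma det_form_pullback:
  assumes "bilinear q" "linear L"
  shows "det (form_matrix (\<lambda>u v. q (L u) (L v))) = (det (operator_matrix L))\<^sup>2 * det (form_matrix q)"
  by (simp add: form_matrix_pullback[OF assms] det_mul power2_eq_square)

lemma trace_operator_matrix: "trace (operator_matrix L) = operator_trace L"
  by (simp add: trace_def operator_trace_def operator_matrix_def form_matrix_def
      sum_basis_index[where f = "\<lambda>b. L b \<bullet> b"])

text \<open>In the basis \<open>E\<close> the Gram matrix is diagonal with exactly one entry -1, so
  its determinant is -1. A change of basis multiplies the determinant by a square, which cannot
  alter its sign.\<close>

lemma det_lorentz_form_neg:
  assumes "lorentz_form q"
  shows "det (form_matrix q) < 0"
proof -
  from assms obtain E :: "'a \<Rightarrow> 'a" and e0 where q: "bilinear q" and E: "linear E" "e0 \<in> Basis"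
    "\<And>b b'. b \<in> Basis \<Longrightarrow> b' \<in> Basis \<Longrightarrow>
       q (E b) (E b') = (if b \<noteq> b' then 0 else if b = e0 then -1 else 1)"
    unfolding lorentz_form_def by metis
  have "det (form_matrix (\<lambda>u v. q (E u) (E v))) =
      (\<Prod>i\<in>UNIV. form_matrix (\<lambda>u v. q (E u) (E v)) $ i $ i)"
    by (rule det_diagonal)
      (simp add: form_matrix_def E(3) Rep_basis_index Rep_basis_index_inject)
  also have "\<dots> = (\<Prod>b\<in>Basis. if b = e0 then -1 else 1)"
    using E(3) by (simp add: form_matrix_def prod_basis_index[where f = "\<lambda>b. q (E b) (E b)"])
  also have "\<dots> = -1"
    using E(2) by (simp add: prod.delta)
  finally have "(det (operator_matrix E))\<^sup>2 * det (form_matrix q) = -1"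
    by (simp add: det_form_pullback[OF q E(1)])
  then show ?thesis
    by (metis mult_nonneg_nonneg not_less zero_le_power2 neg_0_le_iff_le not_one_le_zero)
qed

section \<open>Differentiating determinants\<close>

text \<open>The derivative of the determinant at \<open>M\<close> in the direction \<open>H\<close>,
  obtained by the product rule from each term of the Leibniz formula.\<close>

definition det_deriv :: "real ^ 'n ^ 'n \<Rightarrow> real ^ 'n ^ 'n \<Rightarrow> real" where
  "det_deriv M H = (\<Sum>p | p permutes UNIV. of_int (sign p) *
     (\<Sum>i\<in>UNIV. H $ i $ p i * (\<Prod>j\<in>UNIV - {i}. M $ j $ p j)))"

lemma has_derivative_det:
  fixes M :: "'a::real_normed_vector \<Rightarrow> real ^ 'n ^ 'n"
  assumes "\<And>i j. ((\<lambda>x. M x $ i $ j) has_derivative (\<lambda>v. M' v $ i $ j)) (at x)"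
  shows "((\<lambda>x. det (M x)) has_derivative (\<lambda>v. det_deriv (M x) (M' v))) (at x)"
  unfolding det_def det_deriv_def
  by (intro has_derivative_sum has_derivative_mult_right has_derivative_prod assms)

text \<open>A permutation other than the identity moves at least two points. After the factor with
  index i is removed, an off-diagonal entry of the identity matrix remains in the product.\<close>

lemma det_deriv_identity: "det_deriv (mat 1) H = trace (H :: real ^ 'n ^ 'n)"
proof -
  have 0: "(\<Sum>i\<in>UNIV. H $ i $ p i * (\<Prod>j\<in>UNIV - {i}. mat 1 $ j $ p j)) = 0"
    if p: "p permutes UNIV" "p \<noteq> id" for p
  proof (rule sum.neutral, rule ballI)
    fix i
    have "\<exists>j. j \<noteq> i \<and> p j \<noteq> j"
    proof (rule ccontr)
      assume "\<nexists>j. j \<noteq> i \<and> p j \<noteq> j"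
      then have "p j = j" if "j \<noteq> i" for j using that by blast
      moreover from this have "p i = i"
        using permutes_inj[OF p(1)] by (metis injD)
      ultimately show False using p(2) by (metis eq_id_iff)
    qed
    then obtain j where "j \<noteq> i" "p j \<noteq> j" by blast
    then have "(\<Prod>j\<in>UNIV - {i}. mat 1 $ j $ p j :: real) = 0"
      by (intro prod_zero) (auto simp: mat_def intro!: bexI[of _ j])
    then show "H $ i $ p i * (\<Prod>j\<in>UNIV - {i}. mat 1 $ j $ p j) = 0" by simp
  qed
  have "det_deriv (mat 1) H = (\<Sum>p | (p :: 'n \<Rightarrow> 'n) permutes UNIV. if p = id then trace H else 0)"
    unfolding det_deriv_def
  proof (rule sum.cong[OF refl])
    fix p :: "'n \<Rightarrow> 'n" assume "p \<in> {p. p permutes UNIV}"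
    then show "of_int (sign p) * (\<Sum>i\<in>UNIV. H $ i $ p i * (\<Prod>j\<in>UNIV - {i}. mat 1 $ j $ p j)) =
        (if p = id then trace H else 0)"
      using 0[of p] by (auto simp: trace_def mat_def sign_id)
  qed
  also have "\<dots> = trace H" by (simp add: finite_permutations permutes_id)
  finally show ?thesis .
qed

text \<open>The two-sided Jacobi formula, by differentiating \<open>det ((1 + t\<Gamma>)\<^sup>T G (1 + t\<Gamma>))\<close> at \<open>t = 0\<close>
  in two ways.\<close>

lemma det_deriv_congruence:
  fixes G \<Gamma> :: "real ^ 'n ^ 'n"
  shows "det_deriv G (transpose \<Gamma> ** G + G ** \<Gamma>) = 2 * trace \<Gamma> * det G"
proof -
  define P :: "real \<Rightarrow> real ^ 'n ^ 'n" where "P t = mat 1 + t *\<^sub>R \<Gamma>" for t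
  have expand: "transpose (P t) ** G ** P t =
      G + t *\<^sub>R (transpose \<Gamma> ** G + G ** \<Gamma>) + (t * t) *\<^sub>R (transpose \<Gamma> ** G ** \<Gamma>)" for t
  proof -
    have add: "(X + Y) ** Z = X ** Z + Y ** Z" for X Y Z :: "real ^ 'n ^ 'n"
      by (simp add: matrix_matrix_mult_def vec_eq_iff sum.distrib distrib_right)
    have scale: "(r *\<^sub>R X) ** Z = r *\<^sub>R (X ** Z)" "X ** (r *\<^sub>R Z) = r *\<^sub>R (X ** Z)"
      for X Z :: "real ^ 'n ^ 'n" and r
      by (simp_all add: matrix_matrix_mult_def vec_eq_iff sum_distrib_left mult.assoc mult.left_commute)
    have "transpose (P t) = mat 1 + t *\<^sub>R transpose \<Gamma>"
      by (auto simp: P_def transpose_def vec_eq_iff mat_def)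
    then show ?thesis
      by (simp add: P_def matrix_add_ldistrib add scale scaleR_add_right matrix_mul_assoc ac_simps)
  qed
  have "((\<lambda>t. det (transpose (P t) ** G ** P t)) has_derivative
      (\<lambda>v. det_deriv (transpose (P 0) ** G ** P 0) (v *\<^sub>R (transpose \<Gamma> ** G + G ** \<Gamma>)))) (at 0)"
    by (rule has_derivative_det) (auto simp: expand intro!: derivative_eq_intros)
  then have 1: "((\<lambda>t. det (transpose (P t) ** G ** P t)) has_derivative
      (\<lambda>v. det_deriv G (v *\<^sub>R (transpose \<Gamma> ** G + G ** \<Gamma>)))) (at 0)"
    by (simp add: expand)
  have "((\<lambda>t. det (P t)) has_derivative (\<lambda>v. det_deriv (P 0) (v *\<^sub>R \<Gamma>))) (at 0)"
    by (rule has_derivative_det) (auto simp: P_def intro!: derivative_eq_intros)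
  then have P': "((\<lambda>t. det (P t)) has_derivative (\<lambda>v. trace (v *\<^sub>R \<Gamma>))) (at 0)"
    by (simp add: P_def det_deriv_identity)
  have "((\<lambda>t. det (P t) * det G * det (P t)) has_derivative
      (\<lambda>v. det (P 0) * det G * trace (v *\<^sub>R \<Gamma>) + trace (v *\<^sub>R \<Gamma>) * det G * det (P 0))) (at 0)"
    by (rule derivative_eq_intros P' refl)+ auto
  then have 2: "((\<lambda>t. det (transpose (P t) ** G ** P t)) has_derivative
      (\<lambda>v. 2 * trace (v *\<^sub>R \<Gamma>) * det G)) (at 0)"
    by (simp add: det_mul P_def algebra_simps)
  show ?thesis
    using fun_cong[OF has_derivative_unique[OF 1 2], of 1] by simp
qed

text \<open>Any orthonormal basis can be reflected in the sum or the difference of \<open>n\<close> and its timelike member,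
  one of which is timelike and hence not null.\<close>

lemma lorentz_orthonormal_basis:
  fixes q :: "'e::euclidean_space \<Rightarrow> 'e \<Rightarrow> real"
  assumes "lorentz_form q" "q n n = -1"
  obtains E E' :: "'e \<Rightarrow> 'e" and e0 s where "linear E" "linear E'" "\<And>v. E (E' v) = v" "\<And>v. E' (E v) = v"
    "e0 \<in> Basis" "E e0 = s *\<^sub>R n" "s * s = 1"
    "\<And>b b'. b \<in> Basis \<Longrightarrow> b' \<in> Basis \<Longrightarrow>
       q (E b) (E b') = (if b \<noteq> b' then 0 else if b = e0 then -1 else 1)"
proof -
  from assms obtain F :: "'e \<Rightarrow> 'e" and e0 where q: "bilinear q" "\<And>v w. q v w = q w v"
    and F: "linear F" "bij F" "e0 \<in> Basis"
    "\<And>b b'. b \<in> Basis \<Longrightarrow> b' \<in> Basis \<Longrightarrow>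
       q (F b) (F b') = (if b \<noteq> b' then 0 else if b = e0 then -1 else 1)"
    unfolding lorentz_form_def by metis
  note bil = bilinear_ladd[OF q(1)] bilinear_radd[OF q(1)] bilinear_lmul[OF q(1)] bilinear_rmul[OF q(1)]
    bilinear_lsub[OF q(1)] bilinear_rsub[OF q(1)]
  \<comment> \<open>The sign gives s q(n, F e0) \<le> 0, hence x \<le> -1. So \<open>w\<close> is
    timelike with q(w, w) = 2 x, and since k = 2 / q(w, w) the map \<open>R\<close> is the
    reflection along \<open>w\<close>; it sends F e0 to - s n.\<close>
  define s :: real where "s = (if q n (F e0) \<le> 0 then 1 else -1)"
  define w where "w = n + s *\<^sub>R F e0"
  define x where "x = s * q n (F e0) - 1"
  define k where "k = 1 / x"
  define R where "R v = v - (k * q v w) *\<^sub>R w" for v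
  have ss: "s * s = 1" by (simp add: s_def)
  have F0: "q (F e0) (F e0) = -1" using F(3,4) by simp
  have "s * q n (F e0) \<le> 0" by (simp add: s_def)
  then have kx: "k * x = 1" by (simp add: k_def x_def)
  have ww: "q w w = 2 * x"
    using ss assms(2) F0 q(2)[of "F e0" n] by (simp add: w_def x_def bil algebra_simps)
  have Fw: "q (F e0) w = s * x"
    using ss F0 q(2)[of "F e0" n] by (simp add: w_def x_def bil algebra_simps flip: mult.assoc)
  have RE0: "R (F e0) = (- s) *\<^sub>R n"
  proof -
    have "k * q (F e0) w = s" using kx by (simp add: Fw mult.left_commute)
    then show ?thesis by (simp add: R_def w_def scaleR_add_right ss)
  qed
  have linR: "linear R"
    unfolding R_def by (rule linearI) (simp_all add: bil algebra_simps)
  have Rw: "q (R v) w = - q v w" for v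
    using kx by (simp add: R_def bil ww)
  have RR: "R (R v) = v" for v
    by (simp add: R_def[of "R v"] Rw) (simp add: R_def)
  have qR: "q (R u) (R v) = q u v" for u v
  proof -
    have "q (R u) (R v) = q u v - k * q v w * q u w - k * q u w * (q w v - k * q v w * q w w)"
      by (simp add: R_def bil algebra_simps)
    then show ?thesis using kx q(2)[of w v] by (simp add: ww) algebra
  qed
  obtain F' where F': "linear F'" "\<And>v. F (F' v) = v" "\<And>v. F' (F v) = v"
    using linear_injective_left_inverse[OF F(1) bij_is_inj[OF F(2)]]
    by (metis F(2) bij_pointE comp_apply id_apply)
  show thesis
  proof (rule that[of "\<lambda>v. R (F v)" "\<lambda>v. F' (R v)" e0 "- s"])
    show "linear (\<lambda>v. R (F v))" "linear (\<lambda>v. F' (R v))"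
      using linear_compose[OF F(1) linR] linear_compose[OF linR F'(1)] by (simp_all add: o_def)
  qed (use RR F' F ss RE0 qR in simp_all)
qed

text \<open>As \<open>L\<close> takes values orthogonal to \<open>n\<close>, the timelike diagonal
  entry vanishes and the trace is a sum of values of the form q (L v) v on spacelike basis vectors.
  If this sum of nonpositive terms is zero, each term is, and by semidefiniteness and symmetry each
  such basis vector lies in the kernel.\<close>

lemma lorentz_operator_trace:
  fixes q :: "'e::euclidean_space \<Rightarrow> 'e \<Rightarrow> real"
  assumes q: "lorentz_form q" "q n n = -1"
    and L: "linear L" "\<And>v. q (L v) n = 0" "\<And>v. q v n = 0 \<Longrightarrow> q (L v) v \<le> 0"
  shows lorentz_operator_trace_nonpos: "operator_trace L \<le> 0"
    and lorentz_operator_trace_eq_0: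
      "operator_trace L = 0 \<Longrightarrow> (\<And>v w. q v n = 0 \<Longrightarrow> q w n = 0 \<Longrightarrow> q (L v) w = q (L w) v) \<Longrightarrow>
       q v n = 0 \<Longrightarrow> L v = 0"
proof -
  obtain E E' :: "'e \<Rightarrow> 'e" and e0 s where E: "linear E" "linear E'" "\<And>v. E (E' v) = v" "\<And>v. E' (E v) = v"
    "e0 \<in> Basis" "E e0 = s *\<^sub>R n" "s * s = 1"
    "\<And>b b'. b \<in> Basis \<Longrightarrow> b' \<in> Basis \<Longrightarrow>
       q (E b) (E b') = (if b \<noteq> b' then 0 else if b = e0 then -1 else 1)"
    using lorentz_orthonormal_basis[OF q] by blast
  have q': "bilinear q" "\<And>v w. q v w = q w v" using q(1) by (auto simp: lorentz_form_def)
  note bil = bilinear_ladd[OF q'(1)] bilinear_radd[OF q'(1)] bilinear_lmul[OF q'(1)] bilinear_rmul[OF q'(1)]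
  have s0: "s \<noteq> 0" using E(7) by auto
  have rep: "v = (\<Sum>b\<in>Basis. (E' v \<bullet> b) *\<^sub>R E b)" for v
    using linear_euclidean_sum[OF E(1), of "E' v"] unfolding E(3) .
  have coef: "q v (E b) = (if b = e0 then - 1 else 1) * (E' v \<bullet> b)" if "b \<in> Basis" for v b
  proof -
    have "q v (E b) = (\<Sum>c\<in>Basis. (E' v \<bullet> c) * q (E c) (E b))"
      using linear_euclidean_sum[of "\<lambda>x. q (E x) (E b)" "E' v"] E(1,3) q'(1)
        linear_compose[of E "\<lambda>x. q x (E b)"]
      by (simp add: bilinear_def o_def)
    also have "\<dots> = (\<Sum>c\<in>Basis. if c = b then (E' v \<bullet> b) * (if b = e0 then - 1 else 1) else 0)"
      by (rule sum.cong) (use E(8) that in auto)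
    finally show ?thesis using that by simp
  qed
  have perp: "q (E b) n = 0" if "b \<in> Basis" "b \<noteq> e0" for b
  proof -
    have "s * q (E b) n = 0" using E(8)[OF that(1) E(5)] that by (simp add: E(6) bil)
    then show ?thesis using s0 by simp
  qed
  have "operator_trace L = operator_trace (\<lambda>v. E' (L (E v)))"
    by (rule operator_trace_conjugate[OF L(1) E(1,2,3), symmetric])
  also have "\<dots> = (\<Sum>b\<in>Basis - {e0}. q (L (E b)) (E b))"
  proof -
    have "q (L (E e0)) (E e0) = 0" using L(2) by (simp add: E(6) bil)
    then have "E' (L (E e0)) \<bullet> e0 = 0" using coef[OF E(5), of "L (E e0)"] by simp
    moreover have "E' (L (E b)) \<bullet> b = q (L (E b)) (E b)" if "b \<in> Basis - {e0}" for b
      using coef[of b "L (E b)"] that by simp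
    ultimately show ?thesis
      unfolding operator_trace_def using E(5) by (simp add: sum.remove[of _ e0])
  qed
  finally have tr: "operator_trace L = (\<Sum>b\<in>Basis - {e0}. q (L (E b)) (E b))" .
  have neg: "q (L (E b)) (E b) \<le> 0" if "b \<in> Basis - {e0}" for b
    using L(3) perp that by simp
  show "operator_trace L \<le> 0" unfolding tr by (rule sum_nonpos[OF neg])
  assume 0: "operator_trace L = 0"
    and sym: "\<And>v w. q v n = 0 \<Longrightarrow> q w n = 0 \<Longrightarrow> q (L v) w = q (L w) v" and v: "q v n = 0"
  have zero: "L (E b) = 0" if b: "b \<in> Basis - {e0}" for b
  proof -
    have "(\<Sum>b\<in>Basis - {e0}. - q (L (E b)) (E b)) = 0" using 0 tr by (simp add: sum_negf)
    then have Qb: "q (L (E b)) (E b) = 0"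
      using sum_nonneg_eq_0_iff[of "Basis - {e0}" "\<lambda>b. - q (L (E b)) (E b)"] neg b by force
    have *: "q (L (E b)) w = 0" if w: "q w n = 0" for w
    proof (rule ccontr)
      assume ne: "q (L (E b)) w \<noteq> 0"
      \<comment> \<open>As q (L (E b)) (E b) = 0, the quadratic form is affine in t along w + t E b
        with slope 2 q (L (E b)) w. This t makes its value 1, against nonpositivity.\<close>
      define t where "t = (1 - q (L w) w) / (2 * q (L (E b)) w)"
      have "q (w + t *\<^sub>R E b) n = 0" using w perp b by (simp add: bil)
      then have "q (L (w + t *\<^sub>R E b)) (w + t *\<^sub>R E b) \<le> 0" by (rule L(3))
      also have "L (w + t *\<^sub>R E b) = L w + t *\<^sub>R L (E b)"
        using L(1) by (simp add: linear_add linear_scale)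
      also have "q (L w + t *\<^sub>R L (E b)) (w + t *\<^sub>R E b) = q (L w) w + t * (2 * q (L (E b)) w)"
        using sym[of "E b" w] w perp b Qb by (simp add: bil)
      also have "\<dots> = 1" using ne by (simp add: t_def)
      finally show False by simp
    qed
    have "E' (L (E b)) \<bullet> c = 0" if c: "c \<in> Basis" for c
    proof (cases "c = e0")
      case True
      then show ?thesis using coef[OF E(5), of "L (E b)"] L(2) by (simp add: E(6) bil)
    next
      case False
      then show ?thesis using coef[OF c, of "L (E b)"] *[OF perp[OF c False]] by simp
    qed
    then show ?thesis by (subst rep) simp
  qed
  have "q v (E e0) = 0" using v by (simp add: E(6) bil)
  then have e0: "E' v \<bullet> e0 = 0" using coef[OF E(5), of v] by simp
  have "L v = (\<Sum>b\<in>Basis. (E' v \<bullet> b) *\<^sub>R L (E b))"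
    by (subst rep[of v]) (simp add: linear_sum[OF L(1)] linear_scale[OF L(1)])
  also have "\<dots> = 0"
  proof (rule sum.neutral, rule ballI)
    fix b :: 'e assume "b \<in> Basis"
    then show "(E' v \<bullet> b) *\<^sub>R L (E b) = 0" by (cases "b = e0") (use zero e0 in auto)
  qed
  finally show "L v = 0" .
qed

section \<open>Integration in coordinates\<close>

definition basis_coords :: "'e::euclidean_space \<Rightarrow> real ^ 'e basis_index" where
  "basis_coords v = (\<chi> i. v \<bullet> Rep_basis_index i)"

definition of_basis_coords :: "real ^ 'e basis_index \<Rightarrow> 'e::euclidean_space" where
  "of_basis_coords w = (\<Sum>i\<in>UNIV. (w $ i) *\<^sub>R Rep_basis_index i)"

lemma basis_coords_nth [simp]: "basis_coords v $ i = v \<bullet> Rep_basis_index i"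
  by (simp add: basis_coords_def)

lemma of_basis_coords_inner [simp]: "of_basis_coords w \<bullet> Rep_basis_index i = w $ i"
proof -
  have "of_basis_coords w \<bullet> Rep_basis_index i = (\<Sum>j\<in>UNIV. if j = i then w $ j else 0)"
    unfolding of_basis_coords_def inner_sum_left
    by (rule sum.cong) (auto simp: inner_Basis Rep_basis_index Rep_basis_index_inject)
  then show ?thesis by simp
qed

lemma basis_coords_inverse [simp]:
  "basis_coords (of_basis_coords w) = w" "of_basis_coords (basis_coords v) = v"
proof -
  show "basis_coords (of_basis_coords w) = w" by (simp add: vec_eq_iff)
  show "of_basis_coords (basis_coords v) = v"
    by (simp add: of_basis_coords_def sum_basis_index[where f = "\<lambda>b. (v \<bullet> b) *\<^sub>R b"] euclidean_representation)
qed

lemma bounded_linear_basis_coords: "bounded_linear basis_coords"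
  by (rule linear_conv_bounded_linear[THEN iffD1], rule linearI)
    (simp_all add: vec_eq_iff inner_add_left)

lemma bounded_linear_of_basis_coords: "bounded_linear of_basis_coords"
  by (rule linear_conv_bounded_linear[THEN iffD1], rule linearI)
    (simp_all add: of_basis_coords_def scaleR_add_left sum.distrib scaleR_sum_right)

lemma of_basis_coords_axis: "of_basis_coords (axis i 1) = Rep_basis_index i"
  unfolding of_basis_coords_def
  by (subst sum.remove[of _ i]) (auto simp: axis_def intro!: sum.neutral)

text \<open>The map matches orthonormal bases, so boxes pull back to boxes with the same side
  lengths, and volumes of boxes determine Lebesgue measure.\<close>

lemma distr_basis_coords: "distr lborel lborel (basis_coords :: 'e::euclidean_space \<Rightarrow> _) = lborel"
proof (rule lborel_eqI[symmetric])
  have meas: "(basis_coords :: 'e \<Rightarrow> _) \<in> borel \<rightarrow>\<^sub>M borel"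
    by (intro borel_measurable_continuous_onI linear_continuous_on bounded_linear_basis_coords)
  fix l u :: "real ^ 'e basis_index"
  assume lu: "\<And>b. b \<in> Basis \<Longrightarrow> l \<bullet> b \<le> u \<bullet> b"
  have le: "l $ i \<le> u $ i" for i
    using lu[of "axis i 1"] by (auto simp: inner_axis axis_in_Basis_iff)
  have box: "basis_coords -` box l u = box (of_basis_coords l) (of_basis_coords u)"
  proof (intro set_eqI iffI)
    fix x :: 'e
    have "x \<in> basis_coords -` box l u \<longleftrightarrow>
        (\<forall>i. of_basis_coords l \<bullet> Rep_basis_index i < x \<bullet> Rep_basis_index i \<and>
           x \<bullet> Rep_basis_index i < of_basis_coords u \<bullet> Rep_basis_index i)"
      by (simp add: mem_box_cart)
    also have "\<dots> \<longleftrightarrow> x \<in> box (of_basis_coords l) (of_basis_coords u)"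
      unfolding mem_box by (metis Rep_basis_index Rep_basis_index_cases)
    finally show "x \<in> basis_coords -` box l u \<Longrightarrow> x \<in> box (of_basis_coords l) (of_basis_coords u)"
      "x \<in> box (of_basis_coords l) (of_basis_coords u) \<Longrightarrow> x \<in> basis_coords -` box l u" by simp_all
  qed
  have le': "of_basis_coords l \<bullet> b \<le> of_basis_coords u \<bullet> b" if "b \<in> Basis" for b
    using that le by (metis Rep_basis_index_cases of_basis_coords_inner)
  have "emeasure (distr lborel lborel basis_coords) (box l u) =
      emeasure lborel (box (of_basis_coords l) (of_basis_coords u :: 'e))"
    by (subst emeasure_distr) (use meas in \<open>simp_all add: box\<close>)
  also have "\<dots> = (\<Prod>b\<in>Basis. (of_basis_coords u - of_basis_coords l) \<bullet> b)"
    by (rule emeasure_lborel_box[OF le'])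
  also have "(\<Prod>b\<in>Basis. (of_basis_coords u - of_basis_coords l) \<bullet> b) = (\<Prod>i\<in>UNIV. (u - l) $ i)"
    using prod_basis_index[where f = "\<lambda>b. (of_basis_coords u - of_basis_coords l) \<bullet> b"]
    by (simp add: inner_diff_left)
  also have "\<dots> = (\<Prod>b\<in>Basis. (u - l) \<bullet> b)"
  proof -
    have B: "Basis = range (\<lambda>i. axis i 1 :: real ^ 'e basis_index)"
      by (auto simp: Basis_vec_def)
    have "inj (\<lambda>i. axis i 1 :: real ^ 'e basis_index)"
      by (auto simp: inj_def axis_eq_axis)
    then show ?thesis unfolding B by (subst prod.reindex) (simp_all add: inner_axis)
  qed
  finally show "emeasure (distr lborel lborel (basis_coords :: 'e \<Rightarrow> _)) (box l u) =
      (\<Prod>b\<in>Basis. (u - l) \<bullet> b)" .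
qed simp

section \<open>Integrals of compactly supported functions\<close>

lemma integrable_continuous_compact_support:
  fixes f :: "'a::euclidean_space \<Rightarrow> real"
  assumes "continuous_on UNIV f" "compact K" "\<And>x. x \<notin> K \<Longrightarrow> f x = 0"
  shows "integrable lborel f"
proof -
  have "integrable lborel (\<lambda>x. indicator K x *\<^sub>R f x)"
    by (rule borel_integrable_compact[OF assms(2)]) (rule continuous_on_subset[OF assms(1) subset_UNIV])
  also have "(\<lambda>x. indicator K x *\<^sub>R f x) = f"
    using assms(3) by (auto simp: indicator_def fun_eq_iff)
  finally show ?thesis .
qed

text \<open>The set where \<open>f\<close> is nonzero is open and negligible, hence empty.\<close>

lemma integral_eq_0_continuous_nonneg:
  fixes f :: "'a::euclidean_space \<Rightarrow> real"
  assumes "continuous_on UNIV f" "integrable lborel f" "\<And>x. 0 \<le> f x" "integral\<^sup>L lborel f = 0"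
  shows "f x = 0"
proof -
  have "AE x in lborel. f x = 0"
    using integral_nonneg_eq_0_iff_AE[OF assms(2)] assms(3,4) by simp
  then have "AE x in lebesgue. f x = 0" by (rule AE_completion)
  then have "negligible {x. f x \<noteq> 0}"
    by (simp add: negligible_iff_null_sets completion.AE_iff_null_sets)
  moreover have "open {x. f x \<noteq> 0}"
    using open_vimage[OF open_Compl[OF closed_singleton[of 0]]] assms(1)
    by (simp add: vimage_def)
  ultimately show ?thesis using open_not_negligible by blast
qed

text \<open>By translation invariance every difference quotient of \<open>F\<close> along
  \<open>e\<close> has integral zero. The mean value theorem bounds the quotients uniformly, so
  dominated convergence carries this over to the derivative, for an arbitrary direction and without
  iterated integrals.\<close>

lemma integral_directional_derivative_eq_0:
  fixes F :: "'a::euclidean_space \<Rightarrow> real"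
  assumes F: "\<And>x. (F has_derivative F' x) (at x)" "continuous_on UNIV (\<lambda>x. F' x e)"
    and K: "compact K" "\<And>x. x \<notin> K \<Longrightarrow> F x = 0"
  shows "integral\<^sup>L lborel (\<lambda>x. F' x e) = 0"
proof -
  have cont: "continuous_on UNIV F"
    using F(1) by (meson continuous_at_imp_continuous_on has_derivative_continuous)
  have F'0: "F' x e = 0" if "x \<notin> K" for x
  proof -
    have "(F has_derivative (\<lambda>_. 0)) (at x)"
      by (subst has_derivative_cong_open[where S = "- K" and g = "\<lambda>_. 0"])
        (use K that in \<open>auto simp: compact_imp_closed open_Compl\<close>)
    then show ?thesis using has_derivative_unique[OF F(1)] by metis
  qed
  define t where "t n = 1 / real (Suc n)" for n
  have t: "0 < t n" "t n \<le> 1" for n by (auto simp: t_def)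
  have t0: "t \<longlonglongrightarrow> 0" unfolding t_def by (rule LIMSEQ_Suc[OF lim_1_over_n])
  define s where "s n x = (F (x + t n *\<^sub>R e) - F x) / t n" for n x
  \<comment> \<open>The points x for which the segment from x to x + e meets \<open>K\<close>. As
    the step sizes are at most 1, this one compact set carries all difference quotients.\<close>
  define K' where "K' = (\<lambda>p. fst p - snd p *\<^sub>R e) ` (K \<times> {0..1::real})"
  have K': "compact K'" unfolding K'_def
    by (intro compact_continuous_image compact_Times K compact_Icc continuous_intros)
  have out: "x + r *\<^sub>R e \<notin> K" if "x \<notin> K'" "0 \<le> r" "r \<le> 1" for x r
  proof
    assume "x + r *\<^sub>R e \<in> K"
    then have "x \<in> K'" unfolding K'_def
      by (intro image_eqI[where x = "(x + r *\<^sub>R e, r)"]) (use that in auto)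
    then show False using that by simp
  qed
  have "compact ((\<lambda>x. F' x e) ` K)"
    by (rule compact_continuous_image[OF continuous_on_subset[OF F(2)] K(1)]) simp
  then have "bounded ((\<lambda>x. F' x e) ` K)" by (rule compact_imp_bounded)
  then obtain B where B: "B > 0" "\<And>x. x \<in> K \<Longrightarrow> norm (F' x e) \<le> B"
    unfolding bounded_pos by auto
  then have B': "\<bar>F' x e\<bar> \<le> B" for x using F'0 by (cases "x \<in> K") force+
  have line: "((\<lambda>r. F (x + r *\<^sub>R e)) has_real_derivative F' (x + r *\<^sub>R e) e) (at r)" for x r
  proof -
    have "((\<lambda>r. F (x + r *\<^sub>R e)) has_derivative (\<lambda>h. F' (x + r *\<^sub>R e) (h *\<^sub>R e))) (at r)"
      by (rule has_derivative_compose[OF _ F(1)]) (auto intro!: derivative_eq_intros)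
    moreover have "F' (x + r *\<^sub>R e) (h *\<^sub>R e) = F' (x + r *\<^sub>R e) e * h" for h
      using has_derivative_linear[OF F(1)] by (simp add: linear_scale)
    ultimately show ?thesis by (simp add: has_field_derivative_def)
  qed
  have cont_shift: "continuous_on UNIV (\<lambda>x. F (x + c))" for c
    by (rule continuous_on_compose2[OF cont]) (auto intro!: continuous_intros)
  have bound: "\<bar>s n x\<bar> \<le> B * indicator K' x" for n x
  proof (cases "x \<in> K'")
    case True
    obtain z where "0 < z" "z < t n" "F (x + t n *\<^sub>R e) - F (x + 0 *\<^sub>R e) = (t n - 0) * F' (x + z *\<^sub>R e) e"
      using MVT2[OF t(1) line] by blast
    then have "s n x = F' (x + z *\<^sub>R e) e" using t(1)[of n] by (simp add: s_def)
    then show ?thesis using B' True by simp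
  next
    case False
    then show ?thesis using out[OF False, of 0] out[OF False, of "t n"] t[of n] K(2) by (simp add: s_def)
  qed
  have int0: "integral\<^sup>L lborel (s n) = 0" for n
  proof -
    have int: "integrable lborel F" by (rule integrable_continuous_compact_support[OF cont K])
    have distr: "lborel = distr lborel lborel (\<lambda>x. t n *\<^sub>R e + x)"
      using lborel_distr_plus[of "t n *\<^sub>R e"] by (simp cong: distr_cong)
    have "integral\<^sup>L lborel F = integral\<^sup>L (distr lborel lborel (\<lambda>x. t n *\<^sub>R e + x)) F"
      using distr by simp
    also have "\<dots> = integral\<^sup>L lborel (\<lambda>x. F (x + t n *\<^sub>R e))"
      by (subst integral_distr) (use cont in \<open>auto simp: add.commute intro!: borel_measurable_continuous_onI\<close>)
    finally have eq: "integral\<^sup>L lborel (\<lambda>x. F (x + t n *\<^sub>R e)) = integral\<^sup>L lborel F" by simp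
    have "integrable lborel (\<lambda>x. F (x + t n *\<^sub>R e))"
      by (rule integrable_continuous_compact_support[OF cont_shift K'])
        (use out[of _ "t n"] t[of n] K(2) in auto)
    then show ?thesis using eq int unfolding s_def by simp
  qed
  have "(\<lambda>n. integral\<^sup>L lborel (s n)) \<longlonglongrightarrow> integral\<^sup>L lborel (\<lambda>x. F' x e)"
  proof (rule integral_dominated_convergence[where w = "\<lambda>x. B * indicator K' x"])
    show "(\<lambda>x. F' x e) \<in> borel_measurable lborel" using F(2) by (simp add: borel_measurable_continuous_onI)
    show "s n \<in> borel_measurable lborel" for n
      unfolding s_def using cont cont_shift
      by (auto intro!: borel_measurable_continuous_onI continuous_intros simp: t_def)
    show "integrable lborel (\<lambda>x. B * indicator K' x)"
      using borel_integrable_compact[OF K', of "\<lambda>_. B"] by (simp add: mult.commute)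
    have "(\<lambda>n. s n x) \<longlonglongrightarrow> F' x e" for x
    proof -
      have "((\<lambda>h. (F (x + h *\<^sub>R e) - F x) / h) \<longlongrightarrow> F' x e) (at 0)"
        using line[of x 0] by (simp add: DERIV_def)
      then show ?thesis unfolding s_def
        by (rule filterlim_compose[OF _ filterlim_atI[OF t0]]) (use t in \<open>auto simp: less_imp_neq[THEN not_sym]\<close>)
    qed
    then show "AE x in lborel. (\<lambda>n. s n x) \<longlonglongrightarrow> F' x e" by simp
    show "AE x in lborel. norm (s n x) \<le> B * indicator K' x" for n using bound by simp
  qed
  then show ?thesis unfolding int0 by (rule LIMSEQ_unique[OF _ tendsto_const])
qed

text \<open>The map is read in \<open>real ^ 'n\<close> through \<open>basis_coords\<close>. Compact
  support inside the open sets lets integrals over them be replaced by integrals over the whole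
  space, so both sides concern continuous functions extended by zero.\<close>

lemma integral_change_of_variables_compact_support:
  fixes \<phi> :: "'e::euclidean_space \<Rightarrow> 'e" and f h :: "'e \<Rightarrow> real"
  assumes S: "open S" and \<phi>: "\<And>x. x \<in> S \<Longrightarrow> (\<phi> has_derivative \<phi>' x) (at x)" "inj_on \<phi> S"
    and f: "continuous_on UNIV f" "compact K" "K \<subseteq> \<phi> ` S" "\<And>x. x \<notin> K \<Longrightarrow> f x = 0"
    and h: "continuous_on UNIV h" "compact K'" "K' \<subseteq> S" "\<And>x. x \<notin> K' \<Longrightarrow> h x = 0"
    and eq: "\<And>x. x \<in> S \<Longrightarrow> h x = \<bar>det (operator_matrix (\<phi>' x))\<bar> * f (\<phi> x)"
  shows "integral\<^sup>L lborel h = integral\<^sup>L lborel f"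
proof -
  note bl = bounded_linear_basis_coords bounded_linear_of_basis_coords
  define S' where "S' = basis_coords ` S"
  define \<Phi> where "\<Phi> = (\<lambda>y. basis_coords (\<phi> (of_basis_coords y)))"
  define \<Phi>' where "\<Phi>' y = (\<lambda>v. basis_coords (\<phi>' (of_basis_coords y) (of_basis_coords v)))" for y
  have S'_eq: "S' = of_basis_coords -` S" unfolding S'_def by (force intro: image_eqI[of _ _ "of_basis_coords _"])
  have oS': "open S'"
    unfolding S'_eq by (simp add: continuous_open_vimage[OF S] linear_continuous_at[OF bl(2)])
  have transfer: "integral\<^sup>L lborel k = integral UNIV (\<lambda>y. k (of_basis_coords y))"
    "(\<lambda>y. k (of_basis_coords y)) absolutely_integrable_on UNIV"
    if k: "continuous_on UNIV k" "compact C" "\<And>x. x \<notin> C \<Longrightarrow> k x = 0" for k :: "'e \<Rightarrow> real" and C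
  proof -
    let ?k = "\<lambda>y. k (of_basis_coords y)"
    have c: "continuous_on UNIV ?k"
      by (rule continuous_on_compose2[OF k(1) linear_continuous_on[OF bl(2)]]) simp
    have "compact (basis_coords ` C)"
      by (intro compact_continuous_image linear_continuous_on bl k)
    then have int: "integrable lborel ?k"
      by (rule integrable_continuous_compact_support[OF c]) (metis basis_coords_inverse(1) image_eqI k(3))
    have "integral\<^sup>L lborel ?k = integral\<^sup>L (distr lborel lborel basis_coords) ?k"
      by (simp add: distr_basis_coords)
    also have "\<dots> = integral\<^sup>L lborel k"
      by (subst integral_distr)
        (use c in \<open>auto intro!: borel_measurable_continuous_onI linear_continuous_on bl\<close>)
    finally show "integral\<^sup>L lborel k = integral UNIV ?k"
      using has_integral_integral_lborel[OF int] by (simp add: integral_unique)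
    have "integrable lebesgue ?k" using int by (simp add: integrable_completion)
    then show "?k absolutely_integrable_on UNIV" by (simp add: set_integrable_def)
  qed
  let ?f = "\<lambda>y. f (of_basis_coords y)" and ?h = "\<lambda>y. h (of_basis_coords y)"
  have det: "matrix (\<Phi>' y) = operator_matrix (\<phi>' (of_basis_coords y))" for y
    by (simp add: matrix_def \<Phi>'_def operator_matrix_def form_matrix_def vec_eq_iff of_basis_coords_axis)
  have hS': "?h y = \<bar>det (matrix (\<Phi>' y))\<bar> *\<^sub>R ?f (\<Phi> y)" if "y \<in> S'" for y
    using that eq[of "of_basis_coords y"] S'_eq by (simp add: det \<Phi>_def)
  have f0: "?f y = 0" if "y \<notin> \<Phi> ` S'" for y
  proof (rule f(4), rule notI)
    assume "of_basis_coords y \<in> K"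
    then obtain x where "x \<in> S" "of_basis_coords y = \<phi> x" using f(3) by blast
    then have "y = \<Phi> (basis_coords x)" by (metis \<Phi>_def basis_coords_inverse)
    then show False using that \<open>x \<in> S\<close> by (simp add: S'_def)
  qed
  have h0: "?h y = 0" if "y \<notin> S'" for y
    using that h(3,4) S'_eq by auto
  \<comment> \<open>The theorem concerns vector-valued integrands, so the real function is wrapped
    into \<open>real ^ 1\<close> and unwrapped afterwards.\<close>
  have iff: "((\<lambda>y. \<bar>det (matrix (\<Phi>' y))\<bar> *\<^sub>R vec (?f (\<Phi> y)) :: real ^ 1) absolutely_integrable_on S' \<and>
      integral S' (\<lambda>y. \<bar>det (matrix (\<Phi>' y))\<bar> *\<^sub>R vec (?f (\<Phi> y)) :: real ^ 1) = b) \<longleftrightarrow>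
      (\<lambda>y. vec (?f y) :: real ^ 1) absolutely_integrable_on (\<Phi> ` S') \<and>
      integral (\<Phi> ` S') (\<lambda>y. vec (?f y)) = b" for b
  proof (rule has_absolute_integral_change_of_variables)
    show "S' \<in> sets lebesgue" using oS' by auto
    show "(\<Phi> has_derivative \<Phi>' y) (at y within S')" if "y \<in> S'" for y
      unfolding \<Phi>_def \<Phi>'_def
      by (rule has_derivative_at_withinI, rule bounded_linear.has_derivative[OF bl(1)],
          rule has_derivative_compose[OF bounded_linear_imp_has_derivative[OF bl(2)] \<phi>(1)])
        (use that S'_eq in simp)
    show "inj_on \<Phi> S'"
    proof (rule inj_onI)
      fix y z assume "y \<in> S'" "z \<in> S'" "\<Phi> y = \<Phi> z"
      then have "\<phi> (of_basis_coords y) = \<phi> (of_basis_coords z)"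
        unfolding \<Phi>_def by (metis basis_coords_inverse(2))
      then have "of_basis_coords y = of_basis_coords z"
        using \<phi>(2) \<open>y \<in> S'\<close> \<open>z \<in> S'\<close> S'_eq by (auto simp: inj_on_def)
      then show "y = z" by (metis basis_coords_inverse(1))
    qed
  qed
  have Uf: "(\<lambda>y. if y \<in> \<Phi> ` S' then ?f y else 0) = ?f" using f0 by auto
  have Uh: "(\<lambda>y. if y \<in> S' then \<bar>det (matrix (\<Phi>' y))\<bar> * ?f (\<Phi> y) else 0) = ?h"
    using h0 hS' by auto
  have ai: "?f absolutely_integrable_on (\<Phi> ` S')"
    using transfer(2)[OF f(1,2,4)]
    by (subst absolutely_integrable_restrict_UNIV[symmetric]) (simp add: Uf)
  have "integral S' (\<lambda>y. \<bar>det (matrix (\<Phi>' y))\<bar> * ?f (\<Phi> y)) = integral (\<Phi> ` S') ?f"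
    using iff[of "vec (integral (\<Phi> ` S') ?f)"] ai
    by (simp add: absolutely_integrable_on_1_iff integral_on_1_eq vec_eq_iff)
  then have "integral UNIV ?h = integral UNIV ?f"
    by (simp add: Uf Uh flip: integral_restrict_UNIV[of "\<Phi> ` S'"] integral_restrict_UNIV[of S'])
  then show ?thesis using transfer(1)[OF f(1,2,4)] transfer(1)[OF h(1,2,4)] by simp
qed

section \<open>The divergence theorem on a manifold\<close>

text \<open>An exponent of at least two makes the one-sided derivatives at 0 agree, so powers of a
  positive part serve as C^1 cutoffs in the value of f.\<close>

lemma max_0_power_has_derivative:
  "((\<lambda>x::real. max 0 x ^ Suc (Suc n)) has_real_derivative real (Suc (Suc n)) * max 0 x ^ Suc n) (at x)"
proof -
  consider "x < 0" | "x = 0" | "x > 0" by linarith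
  then show ?thesis
  proof cases
    case 1
    have "((\<lambda>x::real. 0) has_real_derivative 0) (at x)" by simp
    then have "((\<lambda>x::real. max 0 x ^ Suc (Suc n)) has_real_derivative 0) (at x)"
      by (rule DERIV_cong_ev[THEN iffD1, rotated -1])
        (use 1 in \<open>auto simp: eventually_nhds intro!: exI[of _ "{..<0}"]\<close>)
    then show ?thesis using 1 by simp
  next
    case 2
    have eq: "max 0 h ^ Suc (Suc n) / h = max 0 h ^ Suc n" for h :: real
      by (cases "h > 0") auto
    have "((\<lambda>h::real. max 0 h ^ Suc n) \<longlongrightarrow> max 0 0 ^ Suc n) (at 0)"
      by (intro tendsto_intros)
    then show ?thesis using 2 eq by (simp add: DERIV_def del: power_Suc)
  next
    case 3
    have "((\<lambda>x::real. x ^ Suc (Suc n)) has_real_derivative real (Suc (Suc n)) * x ^ Suc n) (at x)"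
      by (rule derivative_eq_intros refl | simp)+
    then have "((\<lambda>x::real. max 0 x ^ Suc (Suc n)) has_real_derivative real (Suc (Suc n)) * x ^ Suc n) (at x)"
      by (rule DERIV_cong_ev[THEN iffD1, rotated -1])
        (use 3 in \<open>auto simp: eventually_nhds intro!: exI[of _ "{0<..}"]\<close>)
    then show ?thesis using 3 by (simp add: max_def)
  qed
qed

lemma Ck_on_1_real:
  assumes "\<And>x. (f has_real_derivative f' x) (at x)" "continuous_on UNIV f'"
  shows "Ck_on (Suc 0) UNIV f"
  by (rule Ck_on_SucI[OF open_UNIV has_field_derivative_imp_has_derivative[OF assms(1)]])
    (auto intro!: continuous_intros assms(2))

lemma C1_max_0_power: "Ck_on (Suc 0) UNIV (\<lambda>x::real. max 0 x ^ Suc (Suc n))"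
  by (rule Ck_on_1_real[OF max_0_power_has_derivative]) (intro continuous_intros)

text \<open>A positive \<open>C\<^sup>1\<close> function on the whole line that coincides with the reciprocal on \<open>[1, \<infinity>)\<close>. If
  \<open>H\<close> is a sum of cutoff functions, then multiplying them by \<open>normalizer H\<close> makes them add up to \<open>1\<close>
  wherever \<open>H \<ge> 1\<close>, without any trouble where \<open>H\<close> vanishes.\<close>

definition normalizer :: "real \<Rightarrow> real" where
  "normalizer t = inverse (t + max 0 (1 - t) ^ Suc (Suc 0))"

lemma normalizer_denominator_pos: "t + max 0 (1 - t) ^ Suc (Suc 0) > (0 :: real)"
proof -
  have "t + (1 - t) * (1 - t) = (t - 1 / 2)\<^sup>2 + 3 / 4"
    by (simp add: power2_eq_square algebra_simps)
  then have "0 < t + (1 - t) * (1 - t)" by (simp add: add_nonneg_pos)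
  then show ?thesis by (auto simp: max_def)
qed

lemma normalizer_pos: "normalizer t > 0"
  unfolding normalizer_def using normalizer_denominator_pos[of t] by simp

lemma normalizer_ge_1: "t \<ge> 1 \<Longrightarrow> normalizer t = inverse t"
  by (simp add: normalizer_def)

lemma C1_normalizer: "Ck_on (Suc 0) UNIV normalizer"
  unfolding normalizer_def
proof (rule Ck_on_compose[OF open_UNIV open_greaterThan _ Ck_on_inverse])
  show "(\<lambda>t::real. t + max 0 (1 - t) ^ Suc (Suc 0)) ` UNIV \<subseteq> {0<..}"
    by (rule image_subsetI) (simp only: greaterThan_iff normalizer_denominator_pos)
  have "Ck_on (Suc 0) UNIV (\<lambda>t::real. 1 - t)"
    by (intro Ck_on_diff open_UNIV Ck_on_const Ck_on_bounded_linear bounded_linear_ident)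
  then have "Ck_on (Suc 0) UNIV (\<lambda>t::real. max 0 (1 - t) ^ Suc (Suc 0))"
    by (rule Ck_on_compose[OF open_UNIV open_UNIV subset_UNIV C1_max_0_power])
  then show "Ck_on (Suc 0) UNIV (\<lambda>t::real. t + max 0 (1 - t) ^ Suc (Suc 0))"
    by (rule Ck_on_add[OF open_UNIV Ck_on_bounded_linear[OF open_UNIV bounded_linear_ident]])
qed

context smooth_manifold
begin

section \<open>Operations on functions and fields of class C^k\<close>

lemma Ck_fun_const: "Ck_fun k (\<lambda>p. c)"
  by (simp add: Ck_fun_def o_def Ck_on_const)

lemma Ck_fun_add: "Ck_fun k f \<Longrightarrow> Ck_fun k h \<Longrightarrow> Ck_fun k (\<lambda>p. f p + h p)"
  by (simp add: Ck_fun_def o_def Ck_on_add is_chart_open_image atlas_is_chart)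

lemma Ck_fun_mult: "Ck_fun k f \<Longrightarrow> Ck_fun k h \<Longrightarrow> Ck_fun k (\<lambda>p. f p * h p)"
  by (simp add: Ck_fun_def o_def Ck_on_mult is_chart_open_image atlas_is_chart)

lemma Ck_fun_sum: "(\<And>i. i \<in> I \<Longrightarrow> Ck_fun k (f i)) \<Longrightarrow> Ck_fun k (\<lambda>p. \<Sum>i\<in>I. f i p)"
  by (induction I rule: infinite_finite_induct) (auto intro: Ck_fun_const Ck_fun_add)

lemma Ck_fun_compose:
  fixes \<kappa> :: "real \<Rightarrow> real"
  assumes "Ck_on k UNIV \<kappa>" "Ck_fun k f"
  shows "Ck_fun k (\<lambda>p. \<kappa> (f p))"
  unfolding Ck_fun_def o_def
proof
  fix c assume c: "c \<in> A"
  show "Ck_on k (snd c ` fst c) (\<lambda>x. \<kappa> (f (chart_inv c x)))"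
    by (rule Ck_on_compose[OF is_chart_open_image[OF atlas_is_chart[OF c]] open_UNIV subset_UNIV assms(1)])
      (use Ck_funD[OF assms(2) c] in \<open>simp add: o_def\<close>)
qed

lemma Ck_fun_mono: "Ck_fun k f \<Longrightarrow> j \<le> k \<Longrightarrow> Ck_fun j f"
  unfolding Ck_fun_def by (blast intro: Ck_on_mono)

lemma Ck_field_mono: "Ck_field k X \<Longrightarrow> j \<le> k \<Longrightarrow> Ck_field j X"
  unfolding Ck_field_def by (blast intro: Ck_on_mono)

lemma chart_field_scale:
  assumes "c \<in> A" "x \<in> snd c ` fst c"
  shows "chart_field c (\<lambda>p. f p *\<^sub>R X p) x = f (chart_inv c x) *\<^sub>R chart_field c X x"
  using assms
  by (simp add: chart_field_def linear_scale[OF linear_components[OF atlas_admissible]] chart_inv_in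
      atlas_is_chart)

lemma chart_field_add:
  assumes "c \<in> A" "x \<in> snd c ` fst c"
  shows "chart_field c (\<lambda>p. X p + Y p) x = chart_field c X x + chart_field c Y x"
  using assms
  by (simp add: chart_field_def linear_add[OF linear_components[OF atlas_admissible]] chart_inv_in
      atlas_is_chart)

lemma Ck_field_scale:
  assumes "Ck_fun k f" "Ck_field k X"
  shows "Ck_field k (\<lambda>p. f p *\<^sub>R X p)"
  unfolding Ck_field_def
proof
  fix c assume c: "c \<in> A"
  note o = is_chart_open_image[OF atlas_is_chart[OF c]]
  show "Ck_on k (snd c ` fst c) (chart_field c (\<lambda>p. f p *\<^sub>R X p))"
    by (subst Ck_on_cong[OF o chart_field_scale[OF c]], assumption)
      (use Ck_on_scaleR[OF o Ck_funD[OF assms(1) c] Ck_fieldD[OF assms(2) c]] in \<open>simp add: o_def\<close>)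
qed

lemma Ck_field_add:
  assumes "Ck_field k X" "Ck_field k Y"
  shows "Ck_field k (\<lambda>p. X p + Y p)"
  unfolding Ck_field_def
proof
  fix c assume c: "c \<in> A"
  note o = is_chart_open_image[OF atlas_is_chart[OF c]]
  show "Ck_on k (snd c ` fst c) (chart_field c (\<lambda>p. X p + Y p))"
    by (subst Ck_on_cong[OF o chart_field_add[OF c]], assumption)
      (intro Ck_on_add[OF o] Ck_fieldD[OF assms(1) c] Ck_fieldD[OF assms(2) c])
qed

lemma dir_deriv_chart_field:
  assumes "Ck_fun (Suc 0) f" "c \<in> A" "x \<in> snd c ` fst c"
  shows "dir_deriv A f (chart_inv c x) (X (chart_inv c x)) =
    (\<Sum>b\<in>Basis. frechet_derivative (f \<circ> chart_inv c) (at x) b * (chart_field c X x \<bullet> b))"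
proof -
  note ch = atlas_is_chart[OF assms(2)]
  have d: "((f \<circ> chart_inv c) has_derivative frechet_derivative (f \<circ> chart_inv c) (at x)) (at x)"
    by (rule Ck_on_Suc_has_derivative[OF Ck_funD[OF assms(1,2)] assms(3)])
  then have "dir_deriv A f (chart_inv c x) (X (chart_inv c x)) =
      frechet_derivative (f \<circ> chart_inv c) (at x) (chart_field c X x)"
    using dir_deriv_chart[OF atlas_admissible[OF assms(2)] chart_inv_in[OF ch assms(3)], of f]
    by (simp add: chart_chart_inv[OF ch assms(3)] chart_field_def)
  then show ?thesis
    using linear_euclidean_sum[OF has_derivative_linear[OF d], of "chart_field c X x"]
    by (simp add: mult.commute)
qed

lemma Ck_fun_dir_deriv:
  assumes "Ck_fun (Suc k) f" "Ck_field k X"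
  shows "Ck_fun k (\<lambda>p. dir_deriv A f p (X p))"
  unfolding Ck_fun_def
proof
  fix c assume c: "c \<in> A"
  note o = is_chart_open_image[OF atlas_is_chart[OF c]]
  have f1: "Ck_fun (Suc 0) f" using Ck_fun_mono[OF assms(1)] by simp
  have "Ck_on k (snd c ` fst c) (\<lambda>x. frechet_derivative (f \<circ> chart_inv c) (at x) b)" for b
    using Ck_funD[OF assms(1) c] by simp
  then have "Ck_on k (snd c ` fst c) (\<lambda>x. \<Sum>b\<in>Basis.
      frechet_derivative (f \<circ> chart_inv c) (at x) b * (chart_field c X x \<bullet> b))"
    by (intro Ck_on_sum[OF o] Ck_on_mult[OF o] Ck_on_inner[OF o] Ck_on_const Ck_fieldD[OF assms(2) c])
  then show "Ck_on k (snd c ` fst c) ((\<lambda>p. dir_deriv A f p (X p)) \<circ> chart_inv c)"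
    by (subst Ck_on_cong[OF o, where g = "\<lambda>x. \<Sum>b\<in>Basis.
      frechet_derivative (f \<circ> chart_inv c) (at x) b * (chart_field c X x \<bullet> b)"])
      (simp_all only: o_apply dir_deriv_chart_field[OF f1 c])
qed

lemma dir_deriv_sum:
  assumes "\<And>i. i \<in> I \<Longrightarrow> Ck_fun (Suc 0) (f i)"
  shows "dir_deriv A (\<lambda>p. \<Sum>i\<in>I. f i p) p v = (\<Sum>i\<in>I. dir_deriv A (f i) p v)"
proof -
  note d = Ck_fun_has_derivative[OF _ chart_at]
  have "((\<lambda>x. \<Sum>i\<in>I. (f i \<circ> chart_inv (chart_at A p)) x) has_derivative
      (\<lambda>u. \<Sum>i\<in>I. dir_deriv A (f i) p (coord_vector A (chart_at A p) p u)))
      (at (snd (chart_at A p) p))"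
    by (rule has_derivative_sum) (rule d[OF assms])
  then have "(((\<lambda>p. \<Sum>i\<in>I. f i p) \<circ> chart_inv (chart_at A p)) has_derivative
      (\<lambda>u. \<Sum>i\<in>I. dir_deriv A (f i) p (coord_vector A (chart_at A p) p u)))
      (at (snd (chart_at A p) p))"
    by (simp add: o_def)
  from dir_deriv_chart[OF chart_at_admissible chart_at(2) this] show ?thesis
    by (simp add: chart_at)
qed

lemma dir_deriv_linear:
  assumes "Ck_fun (Suc 0) f"
  shows "linear (dir_deriv A f p)"
proof -
  have "((f \<circ> chart_inv (chart_at A p)) has_derivative
      frechet_derivative (f \<circ> chart_inv (chart_at A p)) (at (snd (chart_at A p) p)))
      (at (snd (chart_at A p) p))"
    by (rule Ck_on_Suc_has_derivative[OF Ck_funD[OF assms chart_at(1)]]) (simp add: chart_at)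
  then show ?thesis
    unfolding dir_deriv_def using has_derivative_linear by blast
qed

lemma dir_deriv_cong_open:
  assumes "open U" "p \<in> U" "\<And>q. q \<in> U \<Longrightarrow> f q = h q"
  shows "dir_deriv A f p v = dir_deriv A h p v"
proof -
  let ?c = "chart_at A p"
  note ch = atlas_is_chart[OF chart_at(1), of p]
  have "frechet_derivative (f \<circ> chart_inv ?c) (at (snd ?c p)) =
      frechet_derivative (h \<circ> chart_inv ?c) (at (snd ?c p))"
    by (rule frechet_derivative_cong_open[OF open_chart_image[OF ch assms(1)]])
      (use assms chart_at ch in \<open>auto simp: chart_inv_chart\<close>)
  then show ?thesis by (simp add: dir_deriv_def)
qed

lemma dir_deriv_const: "dir_deriv A (\<lambda>q. k) p v = 0"
  by (simp add: dir_deriv_def o_def frechet_derivative_const)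

section \<open>Densities and divergence in coordinates\<close>

text \<open>The absolute value in the transformation law is what the change of variables theorem
  produces, so no orientation enters.\<close>

definition is_density :: "(('m, 'e) chart \<Rightarrow> 'e \<Rightarrow> real) \<Rightarrow> bool" where
  "is_density \<rho> \<longleftrightarrow>
     (\<forall>c\<in>A. Ck_on (Suc 0) (snd c ` fst c) (\<rho> c) \<and> (\<forall>x\<in>snd c ` fst c. 0 < \<rho> c x)) \<and>
     (\<forall>c\<in>A. \<forall>d\<in>A. \<forall>p\<in>fst c \<inter> fst d.
        \<rho> c (snd c p) = \<bar>det (operator_matrix (transition c d p))\<bar> * \<rho> d (snd d p))"

text \<open>The coordinate formula for the divergence relative to a density, as a relation between a
  field and a function. It makes sense for C^1 fields, on which the connection is not controlled,
  and it propagates through the product rule.\<close>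

definition has_div :: "(('m, 'e) chart \<Rightarrow> 'e \<Rightarrow> real) \<Rightarrow> ('m \<Rightarrow> 'e) \<Rightarrow> ('m \<Rightarrow> real) \<Rightarrow> bool" where
  "has_div \<rho> W D \<longleftrightarrow> (\<forall>c\<in>A. \<forall>x\<in>snd c ` fst c.
     (\<Sum>b\<in>Basis. frechet_derivative (\<lambda>y. \<rho> c y * (chart_field c W y \<bullet> b)) (at x) b) =
       \<rho> c x * D (chart_inv c x))"

lemma has_divD:
  "has_div \<rho> W D \<Longrightarrow> c \<in> A \<Longrightarrow> x \<in> snd c ` fst c \<Longrightarrow>
     (\<Sum>b\<in>Basis. frechet_derivative (\<lambda>y. \<rho> c y * (chart_field c W y \<bullet> b)) (at x) b) =
       \<rho> c x * D (chart_inv c x)"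
  by (simp only: has_div_def)

text \<open>The value 0 off the chart image is the correct extension when \<open>f\<close> is
  supported in the chart domain, which is the case wherever the integral of this function is
  used.\<close>

definition chart_density ::
  "(('m, 'e) chart \<Rightarrow> 'e \<Rightarrow> real) \<Rightarrow> ('m, 'e) chart \<Rightarrow> ('m \<Rightarrow> real) \<Rightarrow> 'e \<Rightarrow> real" where
  "chart_density \<rho> c f x = (if x \<in> snd c ` fst c then \<rho> c x * f (chart_inv c x) else 0)"

lemma extend_zero_Ck:
  fixes F :: "'e \<Rightarrow> real"
  assumes c: "c \<in> A" and K: "compact K" "K \<subseteq> fst c" "\<And>p. p \<in> fst c \<Longrightarrow> p \<notin> K \<Longrightarrow> F (snd c p) = 0"
    and F: "Ck_on k (snd c ` fst c) F"
  shows "Ck_on k UNIV (\<lambda>x. if x \<in> snd c ` fst c then F x else 0)" (is "Ck_on k UNIV ?G")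
    and "compact (snd c ` K)"
    and "x \<notin> snd c ` K \<Longrightarrow> (if x \<in> snd c ` fst c then F x else 0) = 0"
proof -
  note ch = atlas_is_chart[OF c]
  show cK: "compact (snd c ` K)"
    by (rule compact_continuous_image[OF continuous_on_subset[OF is_chart_continuous[OF ch] K(2)] K(1)])
  show out: "?G x = 0" if "x \<notin> snd c ` K" for x
    using that K(3) by auto
  show "Ck_on k UNIV ?G"
  proof (rule Ck_on_local)
    fix x :: 'e
    show "\<exists>U. open U \<and> x \<in> U \<and> Ck_on k U ?G"
    proof (cases "x \<in> snd c ` K")
      case True
      have "Ck_on k (snd c ` fst c) ?G"
        by (subst Ck_on_cong[OF is_chart_open_image[OF ch], where g = F]) (use F in auto)
      then show ?thesis using True K(2) is_chart_open_image[OF ch] by blast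
    next
      case False
      have o: "open (- (snd c ` K))" using cK by (simp add: compact_imp_closed open_Compl)
      have "Ck_on k (- (snd c ` K)) ?G"
        by (subst Ck_on_cong[OF o, where g = "\<lambda>_. 0"]) (use out in \<open>auto simp: Ck_on_const\<close>)
      then show ?thesis using o False by blast
    qed
  qed
qed

lemma has_div_scale:
  assumes \<rho>: "is_density \<rho>" and W: "Ck_field (Suc 0) W" "has_div \<rho> W D" and f: "Ck_fun (Suc 0) f"
  shows "has_div \<rho> (\<lambda>p. f p *\<^sub>R W p) (\<lambda>p. f p * D p + dir_deriv A f p (W p))"
  unfolding has_div_def
proof (intro ballI)
  fix c x assume c: "c \<in> A" and x: "x \<in> snd c ` fst c"
  note o = is_chart_open_image[OF atlas_is_chart[OF c]]
  let ?f = "f \<circ> chart_inv c" and ?R = "\<lambda>b y. \<rho> c y * (chart_field c W y \<bullet> b)"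
  have "Ck_on (Suc 0) (snd c ` fst c) (?R b)" for b
    using \<rho> c by (intro Ck_on_mult[OF o] Ck_on_inner[OF o] Ck_on_const Ck_fieldD[OF W(1)])
      (auto simp: is_density_def simp del: Ck_on.simps)
  then have R: "(?R b has_derivative frechet_derivative (?R b) (at x)) (at x)" for b
    by (rule Ck_on_Suc_has_derivative[OF _ x])
  have F: "(?f has_derivative frechet_derivative ?f (at x)) (at x)"
    by (rule Ck_on_Suc_has_derivative[OF Ck_funD[OF f c] x])
  have "frechet_derivative (\<lambda>y. \<rho> c y * (chart_field c (\<lambda>p. f p *\<^sub>R W p) y \<bullet> b)) (at x) b =
      ?f x * frechet_derivative (?R b) (at x) b + frechet_derivative ?f (at x) b * ?R b x" for b
  proof -
    have "frechet_derivative (\<lambda>y. \<rho> c y * (chart_field c (\<lambda>p. f p *\<^sub>R W p) y \<bullet> b)) (at x) =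
        frechet_derivative (\<lambda>y. ?f y * ?R b y) (at x)"
      by (rule frechet_derivative_cong_open[OF o x]) (simp add: chart_field_scale[OF c])
    also have "\<dots> = (\<lambda>v. ?f x * frechet_derivative (?R b) (at x) v + frechet_derivative ?f (at x) v * ?R b x)"
      by (rule frechet_derivative_eqI[OF has_derivative_mult[OF F R]])
    finally show ?thesis by simp
  qed
  then have "(\<Sum>b\<in>Basis. frechet_derivative (\<lambda>y. \<rho> c y * (chart_field c (\<lambda>p. f p *\<^sub>R W p) y \<bullet> b)) (at x) b) =
      ?f x * (\<Sum>b\<in>Basis. frechet_derivative (?R b) (at x) b) +
      \<rho> c x * (\<Sum>b\<in>Basis. frechet_derivative ?f (at x) b * (chart_field c W x \<bullet> b))"
    by (simp add: sum.distrib sum_distrib_left mult_ac)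
  also have "\<dots> = \<rho> c x * (f (chart_inv c x) * D (chart_inv c x) +
      dir_deriv A f (chart_inv c x) (W (chart_inv c x)))"
    by (simp add: has_divD[OF W(2) c x] dir_deriv_chart_field[OF f c x] distrib_left)
  finally show "(\<Sum>b\<in>Basis. frechet_derivative (\<lambda>y. \<rho> c y * (chart_field c (\<lambda>p. f p *\<^sub>R W p) y \<bullet> b)) (at x) b) =
      \<rho> c x * (f (chart_inv c x) * D (chart_inv c x) + dir_deriv A f (chart_inv c x) (W (chart_inv c x)))" .
qed

lemma has_div_add:
  assumes \<rho>: "is_density \<rho>" and X: "Ck_field (Suc 0) X" "has_div \<rho> X D" and Y: "Ck_field (Suc 0) Y" "has_div \<rho> Y D'"
  shows "has_div \<rho> (\<lambda>p. X p + Y p) (\<lambda>p. D p + D' p)"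
  unfolding has_div_def
proof (intro ballI)
  fix c x assume c: "c \<in> A" and x: "x \<in> snd c ` fst c"
  note o = is_chart_open_image[OF atlas_is_chart[OF c]]
  let ?R = "\<lambda>X b y. \<rho> c y * (chart_field c X y \<bullet> b)"
  have R: "(?R X b has_derivative frechet_derivative (?R X b) (at x)) (at x)" if "Ck_field (Suc 0) X" for X b
  proof (rule Ck_on_Suc_has_derivative[OF _ x])
    show "Ck_on (Suc 0) (snd c ` fst c) (?R X b)"
      using \<rho> c by (intro Ck_on_mult[OF o] Ck_on_inner[OF o] Ck_on_const Ck_fieldD[OF that])
        (auto simp: is_density_def simp del: Ck_on.simps)
  qed
  have "frechet_derivative (?R (\<lambda>p. X p + Y p) b) (at x) b =
      frechet_derivative (?R X b) (at x) b + frechet_derivative (?R Y b) (at x) b" for b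
  proof -
    have "frechet_derivative (?R (\<lambda>p. X p + Y p) b) (at x) =
        frechet_derivative (\<lambda>y. ?R X b y + ?R Y b y) (at x)"
      by (rule frechet_derivative_cong_open[OF o x])
        (simp add: chart_field_add[OF c] inner_add_left distrib_left)
    also have "\<dots> = (\<lambda>v. frechet_derivative (?R X b) (at x) v + frechet_derivative (?R Y b) (at x) v)"
      by (rule frechet_derivative_eqI[OF has_derivative_add[OF R[OF X(1)] R[OF Y(1)]]])
    finally show ?thesis by simp
  qed
  then show "(\<Sum>b\<in>Basis. frechet_derivative (?R (\<lambda>p. X p + Y p) b) (at x) b) =
      \<rho> c x * (D (chart_inv c x) + D' (chart_inv c x))"
    by (simp add: sum.distrib has_divD[OF X(2) c x] has_divD[OF Y(2) c x] distrib_left)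
qed

lemma has_div_zero_outside:
  assumes "is_density \<rho>" "has_div \<rho> W D" "closed K" "\<And>p. p \<notin> K \<Longrightarrow> W p = 0" "p \<notin> K"
  shows "D p = 0"
proof -
  let ?c = "chart_at A p"
  note ch = atlas_is_chart[OF chart_at(1), of p] and adm = chart_at_admissible[of p]
  let ?U = "snd ?c ` (fst ?c \<inter> - K)"
  have o: "open ?U" by (rule open_chart_image[OF ch]) (use assms in auto)
  have x: "snd ?c p \<in> ?U" using assms chart_at by blast
  have "chart_field ?c W y = 0" if "y \<in> ?U" for y
    using that assms(4) ch linear_0[OF linear_components[OF adm]]
    by (auto simp: chart_field_def chart_inv_chart)
  then have "frechet_derivative (\<lambda>y. \<rho> ?c y * (chart_field ?c W y \<bullet> b)) (at (snd ?c p)) =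
      frechet_derivative (\<lambda>y. 0) (at (snd ?c p))" for b
    by (intro frechet_derivative_cong_open[OF o x]) simp
  then have "\<rho> ?c (snd ?c p) * D p = 0"
    using has_divD[OF assms(2) chart_at(1) imageI[OF chart_at(2)], of p]
    by (simp add: chart_inv_chart[OF ch] chart_at frechet_derivative_const)
  moreover have "\<rho> ?c (snd ?c p) > 0" using assms(1) chart_at by (auto simp: is_density_def)
  ultimately show ?thesis by simp
qed

lemma chart_density_compact_support:
  assumes \<rho>: "is_density \<rho>" and c: "c \<in> A" and K: "compact K" "K \<subseteq> fst c" "\<And>p. p \<notin> K \<Longrightarrow> f p = 0"
    and f: "Ck_fun 0 f"
  shows chart_density_continuous: "continuous_on UNIV (chart_density \<rho> c f)"
    and compact_chart_image: "compact (snd c ` K)"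
    and chart_density_outside: "x \<notin> snd c ` K \<Longrightarrow> chart_density \<rho> c f x = 0"
    and chart_density_integrable: "integrable lborel (chart_density \<rho> c f)"
proof -
  have \<rho>c: "Ck_on 0 (snd c ` fst c) (\<rho> c)"
    using \<rho> c by (auto simp: is_density_def intro: Ck_on_SucD simp del: Ck_on.simps)
  note o = is_chart_open_image[OF atlas_is_chart[OF c]]
  have F: "Ck_on 0 (snd c ` fst c) (\<lambda>x. \<rho> c x * f (chart_inv c x))"
    using Ck_on_mult[OF o \<rho>c Ck_funD[OF f c]] by (simp add: o_def)
  have zero: "\<rho> c (snd c p) * f (chart_inv c (snd c p)) = 0" if "p \<in> fst c" "p \<notin> K" for p
    using that K(3) by (simp add: chart_inv_chart[OF atlas_is_chart[OF c]])
  note * = extend_zero_Ck[OF c K(1,2) zero F]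
  show 1: "continuous_on UNIV (chart_density \<rho> c f)"
    using *(1) by (simp add: chart_density_def[abs_def])
  show 2: "compact (snd c ` K)" by (rule *(2))
  show 3: "x \<notin> snd c ` K \<Longrightarrow> chart_density \<rho> c f x = 0" for x
    using *(3) by (simp add: chart_density_def)
  show "integrable lborel (chart_density \<rho> c f)"
    by (rule integrable_continuous_compact_support[OF 1 2 3])
qed

text \<open>The Jacobian factor in the transformation law of the density is exactly the one in the
  change of variables theorem.\<close>

lemma integral_chart_density_change:
  assumes \<rho>: "is_density \<rho>" and c: "c \<in> A" and d: "d \<in> A"
    and K: "compact K" "K \<subseteq> fst c" "K \<subseteq> fst d" "\<And>p. p \<notin> K \<Longrightarrow> f p = 0"
    and f: "Ck_fun 0 f"
  shows "integral\<^sup>L lborel (chart_density \<rho> c f) = integral\<^sup>L lborel (chart_density \<rho> d f)"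
proof -
  note ch = atlas_is_chart[OF c] atlas_is_chart[OF d]
  have cmp: "compatible c d" using c d atlas_admissible admissible_compatible by blast
  let ?S = "snd c ` (fst c \<inter> fst d)" and ?\<phi> = "snd d \<circ> chart_inv c"
  have img: "?\<phi> ` ?S = snd d ` (fst c \<inter> fst d)"
    using ch by (force simp: chart_inv_chart image_iff)
  show ?thesis
  proof (rule integral_change_of_variables_compact_support[where S = ?S and \<phi> = ?\<phi>
        and \<phi>' = "\<lambda>x. transition c d (chart_inv c x)" and K = "snd d ` K" and K' = "snd c ` K"])
    show "open ?S" by (rule open_chart_image[OF ch(1) is_chart_open[OF ch(2)]])
    show "(?\<phi> has_derivative transition c d (chart_inv c x)) (at x)" if "x \<in> ?S" for x
    proof -
      obtain p where p: "p \<in> fst c" "p \<in> fst d" "x = snd c p" using \<open>x \<in> ?S\<close> by blast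
      then show ?thesis using transition_has_derivative[OF cmp p(1,2)] ch by (simp add: chart_inv_chart)
    qed
    show "inj_on ?\<phi> ?S"
    proof (rule inj_onI)
      fix x y assume "x \<in> ?S" "y \<in> ?S" and eq: "?\<phi> x = ?\<phi> y"
      then obtain p q where p: "p \<in> fst c" "p \<in> fst d" "x = snd c p" and q: "q \<in> fst c" "q \<in> fst d" "y = snd c q"
        by blast
      then have "snd d p = snd d q" using eq ch by (simp add: chart_inv_chart)
      then have "p = q" using chart_inv_chart[OF ch(2)] p q by metis
      then show "x = y" using p q by simp
    qed
    show "continuous_on UNIV (chart_density \<rho> d f)" "compact (snd d ` K)"
      "\<And>x. x \<notin> snd d ` K \<Longrightarrow> chart_density \<rho> d f x = 0"
      using chart_density_compact_support[OF \<rho> d K(1,3,4) f] by auto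
    show "continuous_on UNIV (chart_density \<rho> c f)" "compact (snd c ` K)"
      "\<And>x. x \<notin> snd c ` K \<Longrightarrow> chart_density \<rho> c f x = 0"
      using chart_density_compact_support[OF \<rho> c K(1,2,4) f] by auto
    show "snd d ` K \<subseteq> ?\<phi> ` ?S" unfolding img using K by blast
    show "snd c ` K \<subseteq> ?S" using K by blast
    show "chart_density \<rho> c f x = \<bar>det (operator_matrix (transition c d (chart_inv c x)))\<bar> *
        chart_density \<rho> d f (?\<phi> x)" if "x \<in> ?S" for x
    proof -
      obtain p where p: "p \<in> fst c" "p \<in> fst d" "x = snd c p" using \<open>x \<in> ?S\<close> by blast
      moreover have "\<rho> c (snd c p) = \<bar>det (operator_matrix (transition c d p))\<bar> * \<rho> d (snd d p)"
        using \<rho> c d p unfolding is_density_def by blast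
      ultimately show ?thesis using ch by (simp add: chart_density_def chart_inv_chart)
    qed
  qed
qed

text \<open>Extended by zero, the density times each component of \<open>W\<close> is a compactly
  supported C^1 function on the whole space, whose partial derivative integrates to zero.\<close>

lemma integral_divergence_in_chart:
  assumes \<rho>: "is_density \<rho>" and c: "c \<in> A" and W: "Ck_field (Suc 0) W" "has_div \<rho> W D"
    and K: "compact K" "K \<subseteq> fst c" "\<And>p. p \<notin> K \<Longrightarrow> W p = 0"
  shows "integral\<^sup>L lborel (chart_density \<rho> c D) = 0"
proof -
  note ch = atlas_is_chart[OF c]
  note o = is_chart_open_image[OF ch]
  let ?R = "\<lambda>b y. \<rho> c y * (chart_field c W y \<bullet> b)"
  define G where "G b x = (if x \<in> snd c ` fst c then ?R b x else 0)" for b x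
  have R: "Ck_on (Suc 0) (snd c ` fst c) (?R b)" for b
    using \<rho> c by (intro Ck_on_mult[OF o] Ck_on_inner[OF o] Ck_on_const Ck_fieldD[OF W(1)])
      (auto simp: is_density_def simp del: Ck_on.simps)
  have zero: "?R b (snd c p) = 0" if "p \<in> fst c" "p \<notin> K" for p b
    using that K(3) linear_0[OF linear_components[OF atlas_admissible[OF c] that(1)]]
    by (simp add: chart_field_def chart_inv_chart[OF ch])
  have G: "Ck_on (Suc 0) UNIV (G b)" "compact (snd c ` K)" "x \<notin> snd c ` K \<Longrightarrow> G b x = 0" for b x
    unfolding G_def by (rule extend_zero_Ck[OF c K(1,2) zero R], assumption+)+
  have G': "(G b has_derivative frechet_derivative (G b) (at x)) (at x)" for b x
    by (rule Ck_on_Suc_has_derivative[OF G(1) UNIV_I])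
  have Gc: "continuous_on UNIV (\<lambda>x. frechet_derivative (G b) (at x) b)" for b
    using G(1)[of b] by simp
  have int0: "integral\<^sup>L lborel (\<lambda>x. frechet_derivative (G b) (at x) b) = 0" for b
    by (rule integral_directional_derivative_eq_0[OF G' Gc G(2,3)])
  have out: "frechet_derivative (G b) (at x) b = 0" if "x \<notin> snd c ` K" for b x
  proof -
    have "frechet_derivative (G b) (at x) = frechet_derivative (\<lambda>_. 0) (at x)"
      by (rule frechet_derivative_cong_open[of "- (snd c ` K)"])
        (use that G in \<open>auto simp: compact_imp_closed open_Compl\<close>)
    then show ?thesis by (simp add: frechet_derivative_const)
  qed
  have int: "integrable lborel (\<lambda>x. frechet_derivative (G b) (at x) b)" for b
    by (rule integrable_continuous_compact_support[OF Gc G(2) out])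
  have "chart_density \<rho> c D x = (\<Sum>b\<in>Basis. frechet_derivative (G b) (at x) b)" for x
  proof (cases "x \<in> snd c ` fst c")
    case True
    have "frechet_derivative (G b) (at x) = frechet_derivative (?R b) (at x)" for b
      by (rule frechet_derivative_cong_open[OF o True]) (simp add: G_def)
    then show ?thesis using True by (simp only: has_divD[OF W(2) c True] chart_density_def if_True)
  next
    case False
    then have "x \<notin> snd c ` K" using K(2) by blast
    then show ?thesis using False out by (simp add: chart_density_def)
  qed
  then have "chart_density \<rho> c D = (\<lambda>x. \<Sum>b\<in>Basis. frechet_derivative (G b) (at x) b)" by blast
  then show ?thesis using int int0 by (simp add: Bochner_Integration.integral_sum)
qed

text \<open>Dividing the coordinate formula by the positive density recovers \<open>D\<close>. Its
  continuity turns a vanishing integral into pointwise vanishing.\<close>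

lemma has_div_continuous:
  assumes \<rho>: "is_density \<rho>" and W: "Ck_field (Suc 0) W" "has_div \<rho> W D"
  shows "Ck_fun 0 D"
  unfolding Ck_fun_def
proof
  fix c assume c: "c \<in> A"
  note o = is_chart_open_image[OF atlas_is_chart[OF c]]
  let ?R = "\<lambda>b y. \<rho> c y * (chart_field c W y \<bullet> b)"
  have \<rho>c: "Ck_on (Suc 0) (snd c ` fst c) (\<rho> c)" "\<And>x. x \<in> snd c ` fst c \<Longrightarrow> 0 < \<rho> c x"
    using \<rho> c by (auto simp: is_density_def simp del: Ck_on.simps)
  have "Ck_on (Suc 0) (snd c ` fst c) (?R b)" for b
    by (intro Ck_on_mult[OF o \<rho>c(1)] Ck_on_inner[OF o] Ck_on_const Ck_fieldD[OF W(1) c])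
  then have "continuous_on (snd c ` fst c) (\<lambda>x. (\<Sum>b\<in>Basis. frechet_derivative (?R b) (at x) b) / \<rho> c x)"
    using Ck_on_continuous[OF \<rho>c(1)] \<rho>c(2)
    by (intro continuous_on_divide continuous_on_sum) (simp_all add: less_imp_neq[THEN not_sym])
  moreover have "(\<Sum>b\<in>Basis. frechet_derivative (?R b) (at x) b) / \<rho> c x = (D \<circ> chart_inv c) x"
    if "x \<in> snd c ` fst c" for x
    using has_divD[OF W(2) c that] \<rho>c(2)[OF that] by simp
  ultimately show "Ck_on 0 (snd c ` fst c) (D \<circ> chart_inv c)"
    by (simp cong: continuous_on_cong)
qed

section \<open>Gluing chart integrals over a compact set\<close>

lemma partition_of_unity_on_compact:
  assumes K: "compact K"
  obtains P :: "'m set" and \<psi> :: "'m \<Rightarrow> 'm \<Rightarrow> real" and C :: "'m \<Rightarrow> 'm set"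
  where "finite P" "\<And>p. p \<in> P \<Longrightarrow> Ck_fun (Suc 0) (\<psi> p)" "\<And>p q. p \<in> P \<Longrightarrow> 0 \<le> \<psi> p q"
    "\<And>p. p \<in> P \<Longrightarrow> compact (C p)" "\<And>p. p \<in> P \<Longrightarrow> C p \<subseteq> fst (chart_at A p)"
    "\<And>p q. p \<in> P \<Longrightarrow> q \<notin> C p \<Longrightarrow> \<psi> p q = 0" "\<And>q. q \<in> K \<Longrightarrow> (\<Sum>p\<in>P. \<psi> p q) = 1"
proof -
  have "\<exists>\<eta> V C. smooth_fun A \<eta> \<and> (\<forall>q. 0 \<le> \<eta> q) \<and> open V \<and> p \<in> V \<and> (\<forall>q\<in>V. \<eta> q = 1) \<and>
      compact C \<and> C \<subseteq> fst (chart_at A p) \<and> (\<forall>q. q \<notin> C \<longrightarrow> \<eta> q = 0)" for p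
    by (rule cutoff_function[OF chart_at_admissible chart_at(2) open_UNIV UNIV_I, of p]) blast
  then obtain \<eta> V C where \<eta>: "\<And>p. smooth_fun A (\<eta> p)" "\<And>p q. 0 \<le> \<eta> p q" "\<And>p. open (V p)" "\<And>p. p \<in> V p"
    "\<And>p q. q \<in> V p \<Longrightarrow> \<eta> p q = 1" "\<And>p. compact (C p)" "\<And>p. C p \<subseteq> fst (chart_at A p)"
    "\<And>p q. q \<notin> C p \<Longrightarrow> \<eta> p q = 0"
    by metis
  obtain P where P: "P \<subseteq> K" "finite P" "K \<subseteq> (\<Union>p\<in>P. V p)"
    using compactE_image[OF K, of K V] \<eta>(3,4) by blast
  define H where "H q = (\<Sum>p\<in>P. \<eta> p q)" for q
  define \<psi> where "\<psi> p q = normalizer (H q) * \<eta> p q" for p q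
  have \<eta>1: "Ck_fun (Suc 0) (\<eta> p)" for p using \<eta>(1) smooth_fun_iff by blast
  then have "Ck_fun (Suc 0) H" unfolding H_def[abs_def] by (intro Ck_fun_sum)
  then have \<psi>: "Ck_fun (Suc 0) (\<psi> p)" for p
    unfolding \<psi>_def by (intro Ck_fun_mult Ck_fun_compose[OF C1_normalizer] \<eta>1)
  have one: "(\<Sum>p\<in>P. \<psi> p q) = 1" if q: "q \<in> K" for q
  proof -
    obtain p where p: "p \<in> P" "q \<in> V p" using P q by blast
    have "\<eta> p q \<le> H q" unfolding H_def using member_le_sum[OF p(1), of "\<lambda>p. \<eta> p q"] \<eta>(2) P(2) by simp
    then have "H q \<ge> 1" using \<eta>(5)[OF p(2)] by simp
    moreover have "(\<Sum>p\<in>P. \<psi> p q) = normalizer (H q) * H q"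
      unfolding \<psi>_def H_def sum_distrib_left ..
    ultimately show ?thesis by (simp add: normalizer_ge_1)
  qed
  show thesis
    by (rule that[OF P(2) \<psi> _ \<eta>(6,7) _ one]) (use \<eta>(2,8) normalizer_pos in \<open>auto simp: \<psi>_def less_imp_le\<close>)
qed

text \<open>No integral on the manifold itself is defined. With D' t the divergence of \<psi> t W,
  the function D is the sum of the D' t, so the chart integral of \<psi> s D splits into pieces
  \<psi> s D' t. Each piece is supported in both chart domains and can be moved from chart s to
  chart t; summing over s restores D' t, whose integral in its own chart is zero. The nonnegative
  integrals of \<psi> s D thus add up to 0.\<close>

lemma nonneg_divergence_eq_0:
  assumes \<rho>: "is_density \<rho>" and K: "compact K" "\<And>p. p \<notin> K \<Longrightarrow> W p = 0"
    and W: "Ck_field (Suc 0) W" "has_div \<rho> W D" and D_nonneg: "\<And>p. 0 \<le> D p"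
  shows "D q = 0"
proof -
  obtain P \<psi> C where P: "finite P" and \<psi>: "\<And>p. p \<in> P \<Longrightarrow> Ck_fun (Suc 0) (\<psi> p)" "\<And>p q. p \<in> P \<Longrightarrow> 0 \<le> \<psi> p q"
    and C: "\<And>p. p \<in> P \<Longrightarrow> compact (C p)" "\<And>p. p \<in> P \<Longrightarrow> C p \<subseteq> fst (chart_at A p)"
    "\<And>p q. p \<in> P \<Longrightarrow> q \<notin> C p \<Longrightarrow> \<psi> p q = 0" and one: "\<And>q. q \<in> K \<Longrightarrow> (\<Sum>p\<in>P. \<psi> p q) = 1"
    using partition_of_unity_on_compact[OF K(1)] by blast
  have D_cont: "Ck_fun 0 D" by (rule has_div_continuous[OF \<rho> W])
  have clK: "closed K" using K(1) by (rule compact_imp_closed)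
  have D_out: "D p = 0" if "p \<notin> K" for p
    by (rule has_div_zero_outside[OF \<rho> W(2) clK K(2) that])
  define D' where "D' r p = \<psi> r p * D p + dir_deriv A (\<psi> r) p (W p)" for r p
  have \<psi>0: "Ck_fun 0 (\<psi> p)" if "p \<in> P" for p using Ck_fun_mono[OF \<psi>(1)[OF that]] by simp
  have D'0: "Ck_fun 0 (D' r)" if "r \<in> P" for r
    unfolding D'_def
    by (intro Ck_fun_add Ck_fun_mult \<psi>0 that D_cont Ck_fun_dir_deriv \<psi>(1) Ck_field_mono[OF W(1)]) simp
  have W': "Ck_field (Suc 0) (\<lambda>p. \<psi> r p *\<^sub>R W p)" "has_div \<rho> (\<lambda>p. \<psi> r p *\<^sub>R W p) (D' r)" if "r \<in> P" for r
    unfolding D'_def[abs_def]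
    by (rule Ck_field_scale[OF \<psi>(1)[OF that] W(1)], rule has_div_scale[OF \<rho> W \<psi>(1)[OF that]])
  have D'_out: "D' r p = 0" if "r \<in> P" "p \<notin> K \<inter> C r" for r p
    by (rule has_div_zero_outside[OF \<rho> W'(2)[OF that(1)] _ _ that(2)])
      (use clK C that K in \<open>auto simp: compact_imp_closed\<close>)
  \<comment> \<open>The cutoffs add up to 1 only on \<open>K\<close>, which need not be open. Where
    W p = 0 the derivative along it is trivially zero. Elsewhere W is nonzero on a neighbourhood,
    which lies inside \<open>K\<close> since W vanishes off \<open>K\<close>, and the sum is
    constant there.\<close>
  have grad: "(\<Sum>r\<in>P. dir_deriv A (\<psi> r) p (W p)) = 0" for p
  proof (cases "W p = 0")
    case True
    then show ?thesis using linear_0[OF dir_deriv_linear[OF \<psi>(1)]] by simp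
  next
    case False
    let ?c = "chart_at A p"
    note ch = atlas_is_chart[OF chart_at(1), of p] and adm = chart_at_admissible[of p]
    let ?S = "{x \<in> snd ?c ` fst ?c. chart_field ?c W x \<noteq> 0}"
    have "open ?S"
      using continuous_open_preimage[OF Ck_on_continuous[OF Ck_fieldD[OF W(1) chart_at(1)]]
          is_chart_open_image[OF ch] open_Compl[OF closed_singleton[of 0]]]
      by (simp add: vimage_def Int_def)
    then have "open (fst ?c \<inter> snd ?c -` ?S)"
      using continuous_open_preimage[OF is_chart_continuous[OF ch] is_chart_open[OF ch]] by blast
    moreover have "p \<in> fst ?c \<inter> snd ?c -` ?S"
    proof -
      have "chart_field ?c W (snd ?c p) \<noteq> 0"
        using False coord_vector_components[OF adm chart_at(2), of "W p"]
          linear_0[OF linear_coord_vector[OF adm chart_at(2)]]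
        by (auto simp: chart_field_def chart_inv_chart[OF ch chart_at(2)])
      then show ?thesis using chart_at by auto
    qed
    moreover have "(\<Sum>r\<in>P. \<psi> r q) = 1" if "q \<in> fst ?c \<inter> snd ?c -` ?S" for q
    proof (rule one, rule ccontr)
      assume "q \<notin> K"
      moreover have "q \<in> fst ?c" "chart_field ?c W (snd ?c q) \<noteq> 0" using that by blast+
      ultimately show False
        using K(2)[of q] linear_0[OF linear_components[OF adm]] ch
        by (simp add: chart_field_def chart_inv_chart)
    qed
    ultimately have "dir_deriv A (\<lambda>q. \<Sum>r\<in>P. \<psi> r q) p (W p) = dir_deriv A (\<lambda>q. 1) p (W p)"
      by (rule dir_deriv_cong_open)
    then show ?thesis by (simp add: dir_deriv_sum[OF \<psi>(1)] dir_deriv_const)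
  qed
  have D_sum: "D p = (\<Sum>r\<in>P. D' r p)" for p
  proof -
    have "(\<Sum>r\<in>P. D' r p) = (\<Sum>r\<in>P. \<psi> r p) * D p"
      by (simp add: D'_def sum.distrib grad sum_distrib_right)
    then show ?thesis using one D_out by (cases "p \<in> K") auto
  qed
  let ?c = "chart_at A" and ?I = "\<lambda>c f. integral\<^sup>L lborel (chart_density \<rho> c f)"
  have integrable: "integrable lborel (chart_density \<rho> (?c r) (\<lambda>p. \<psi> s p * D' t p))"
    if "r = s \<or> r = t" "s \<in> P" "t \<in> P" for r s t
    by (rule chart_density_integrable[OF \<rho> chart_at(1), of "C s \<inter> C t"])
      (use that C D'_out in \<open>auto intro!: compact_Int Ck_fun_mult \<psi>0 D'0\<close>)
  have swap: "?I (?c s) (\<lambda>p. \<psi> s p * D' t p) = ?I (?c t) (\<lambda>p. \<psi> s p * D' t p)"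
    if "s \<in> P" "t \<in> P" for s t
    by (rule integral_chart_density_change[OF \<rho> chart_at(1) chart_at(1), of "C s \<inter> C t"])
      (use that C D'_out in \<open>auto intro!: compact_Int Ck_fun_mult \<psi>0 D'0\<close>)
  have sum_density: "chart_density \<rho> c (\<lambda>p. \<Sum>i\<in>P. f i p) = (\<lambda>x. \<Sum>i\<in>P. chart_density \<rho> c (f i) x)" for c f
    by (auto simp: chart_density_def sum_distrib_left)
  have pieces: "?I (?c s) (\<lambda>p. \<psi> s p * D p) = (\<Sum>t\<in>P. ?I (?c s) (\<lambda>p. \<psi> s p * D' t p))" if "s \<in> P" for s
    unfolding D_sum sum_distrib_left sum_density
    by (rule Bochner_Integration.integral_sum) (use that integrable in auto)
  have total: "(\<Sum>s\<in>P. ?I (?c t) (\<lambda>p. \<psi> s p * D' t p)) = 0" if "t \<in> P" for t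
  proof -
    have "(\<Sum>s\<in>P. ?I (?c t) (\<lambda>p. \<psi> s p * D' t p)) = ?I (?c t) (\<lambda>p. \<Sum>s\<in>P. \<psi> s p * D' t p)"
      unfolding sum_density
      by (rule Bochner_Integration.integral_sum[symmetric]) (use that integrable in auto)
    also have "(\<lambda>p. \<Sum>s\<in>P. \<psi> s p * D' t p) = D' t"
    proof
      fix p
      show "(\<Sum>s\<in>P. \<psi> s p * D' t p) = D' t p"
        using one[of p] D'_out[OF that, of p] by (cases "p \<in> K") (auto simp flip: sum_distrib_right)
    qed
    also have "?I (?c t) (D' t) = 0"
      by (rule integral_divergence_in_chart[OF \<rho> chart_at(1) W'[OF that], of "C t"])
        (use C that in auto)
    finally show ?thesis .
  qed
  have "(\<Sum>s\<in>P. ?I (?c s) (\<lambda>p. \<psi> s p * D p)) = (\<Sum>s\<in>P. \<Sum>t\<in>P. ?I (?c t) (\<lambda>p. \<psi> s p * D' t p))"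
    by (rule sum.cong[OF refl]) (simp only: pieces, rule sum.cong[OF refl swap])
  also have "\<dots> = (\<Sum>t\<in>P. \<Sum>s\<in>P. ?I (?c t) (\<lambda>p. \<psi> s p * D' t p))" by (rule sum.swap)
  also have "\<dots> = 0" using total by simp
  finally have sum0: "(\<Sum>s\<in>P. ?I (?c s) (\<lambda>p. \<psi> s p * D p)) = 0" .
  have nonneg: "0 \<le> chart_density \<rho> (?c s) (\<lambda>p. \<psi> s p * D p) x" if "s \<in> P" for s x
  proof -
    have "0 < \<rho> (?c s) x" if "x \<in> snd (?c s) ` fst (?c s)"
      using \<rho> that chart_at(1) unfolding is_density_def by blast
    then show ?thesis using \<psi>(2)[OF that] D_nonneg by (auto simp: chart_density_def less_imp_le)
  qed
  have int0: "?I (?c s) (\<lambda>p. \<psi> s p * D p) = 0" if "s \<in> P" for s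
    using sum0 that P nonneg
    by (subst (asm) sum_nonneg_eq_0_iff) (auto intro!: integral_nonneg)
  have cont: "continuous_on UNIV (chart_density \<rho> (?c s) (\<lambda>p. \<psi> s p * D p))"
    "integrable lborel (chart_density \<rho> (?c s) (\<lambda>p. \<psi> s p * D p))" if "s \<in> P" for s
    by (rule chart_density_continuous[OF \<rho> chart_at(1) C(1,2)[OF that]]
        chart_density_integrable[OF \<rho> chart_at(1) C(1,2)[OF that]];
        use that C in \<open>auto intro!: Ck_fun_mult \<psi>0 D_cont\<close>)+
  have zero: "chart_density \<rho> (?c s) (\<lambda>p. \<psi> s p * D p) x = 0" if "s \<in> P" for s x
    by (rule integral_eq_0_continuous_nonneg[OF cont[OF that] nonneg[OF that] int0[OF that]])
  have "\<psi> s q * D q = 0" if "s \<in> P" for s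
  proof (cases "q \<in> C s")
    case True
    then have q: "q \<in> fst (?c s)" using C(2)[OF that] by blast
    then have "0 < \<rho> (?c s) (snd (?c s) q)"
      using \<rho> chart_at(1)[of s] unfolding is_density_def by blast
    then show ?thesis
      using zero[OF that, of "snd (?c s) q"] q
      by (simp add: chart_density_def chart_inv_chart[OF atlas_is_chart[OF chart_at(1)]])
  qed (use C(3) that in simp)
  then have "(\<Sum>s\<in>P. \<psi> s q) * D q = 0"
    unfolding sum_distrib_right by (intro sum.neutral) blast
  then show ?thesis using one[of q] D_out[of q] by (cases "q \<in> K") auto
qed

end

section \<open>The Levi-Civita connection in charts\<close>

text \<open>The infinitesimal version of \<open>form_matrix_pullback\<close>; it puts the derivative
  of the metric into the shape required by \<open>det_deriv_congruence\<close>.\<close>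

lemma form_matrix_derivation:
  assumes "bilinear q" "linear G"
  shows "form_matrix (\<lambda>u w. q (G u) w + q u (G w)) =
    transpose (operator_matrix G) ** form_matrix q + form_matrix q ** operator_matrix G"
proof -
  have 1: "q (G u) w = (\<Sum>b\<in>Basis. (G u \<bullet> b) * q b w)" for u w
    using linear_euclidean_sum[of "\<lambda>z. q z w" "G u"] assms by (simp add: bilinear_def)
  have 2: "q w (G v) = (\<Sum>b\<in>Basis. q w b * (G v \<bullet> b))" for v w
    using linear_euclidean_sum[of "\<lambda>z. q w z" "G v"] assms by (simp add: bilinear_def mult.commute)
  show ?thesis
    by (simp add: operator_matrix_def form_matrix_def matrix_matrix_mult_def vec_eq_iff transpose_def 1 2
        sum_basis_index[where f = "\<lambda>b. (G u \<bullet> b) * q b w" for u w]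
        sum_basis_index[where f = "\<lambda>b. q w b * (G v \<bullet> b)" for v w])
qed

lemma C1_sqrt: "Ck_on (Suc 0) {0<..} sqrt"
proof (rule Ck_on_SucI[OF open_greaterThan])
  fix x :: real assume "x \<in> {0<..}"
  then show "(sqrt has_derivative (\<lambda>v. inverse (sqrt x) / 2 * v)) (at x)"
    by (intro has_field_derivative_imp_has_derivative DERIV_real_sqrt) simp
qed (auto intro!: continuous_intros)

context smooth_manifold
begin

section \<open>Cut-off coordinate frames and coordinate functions\<close>

lemma Ck_fun_admissible:
  assumes f: "Ck_fun k f" and c: "admissible c"
  shows "Ck_on k (snd c ` fst c) (f \<circ> chart_inv c)"
proof (rule Ck_on_local)
  note ch = admissible_is_chart[OF c]
  fix x assume "x \<in> snd c ` fst c"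
  then obtain q where q: "q \<in> fst c" "x = snd c q" by blast
  let ?d = "chart_at A q"
  note chd = atlas_is_chart[OF chart_at(1), of q]
  let ?U = "snd c ` (fst c \<inter> fst ?d)"
  have o: "open ?U" by (rule open_chart_image[OF ch is_chart_open[OF chd]])
  have "Ck_on k ?U (\<lambda>x. (f \<circ> chart_inv ?d) ((snd ?d \<circ> chart_inv c) x))"
    by (rule Ck_on_compose[OF o is_chart_open_image[OF chd] _ Ck_funD[OF f chart_at(1)]
          compatible_Ck_on[OF admissible_compatible[OF c chart_at(1)]]])
      (use ch in \<open>auto simp: chart_inv_chart\<close>)
  then have "Ck_on k ?U (f \<circ> chart_inv c)"
    by (subst Ck_on_cong[OF o, where g = "\<lambda>x. (f \<circ> chart_inv ?d) ((snd ?d \<circ> chart_inv c) x)"])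
      (use ch chd in \<open>auto simp: chart_inv_chart\<close>)
  then show "\<exists>U. open U \<and> x \<in> U \<and> Ck_on k U (f \<circ> chart_inv c)"
    using o q chart_at(2)[of q] by blast
qed

text \<open>A coordinate field exists only on its chart domain, but the connection takes fields on
  the whole manifold. The factor \<eta> makes it global without changing it near the point of
  interest.\<close>

definition frame_field :: "('m \<Rightarrow> real) \<Rightarrow> ('m, 'e) chart \<Rightarrow> 'e \<Rightarrow> 'm \<Rightarrow> 'e" where
  "frame_field \<eta> c w q = \<eta> q *\<^sub>R coord_vector A c q w"

definition cutoff :: "('m, 'e) chart \<Rightarrow> 'm \<Rightarrow> ('m \<Rightarrow> real) \<Rightarrow> 'm set \<Rightarrow> bool" where
  "cutoff c p \<eta> V \<longleftrightarrow> smooth_fun A \<eta> \<and> open V \<and> p \<in> V \<and> V \<subseteq> fst c \<and> (\<forall>q\<in>V. \<eta> q = 1) \<and>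
     (\<exists>K. compact K \<and> K \<subseteq> fst c \<and> (\<forall>q. q \<notin> K \<longrightarrow> \<eta> q = 0))"

lemma cutoff_exists:
  assumes "admissible c" "p \<in> fst c"
  obtains \<eta> V where "cutoff c p \<eta> V"
proof (rule cutoff_function[OF assms open_UNIV UNIV_I])
  fix \<eta> V K
  assume "smooth_fun A \<eta>" "open V" "p \<in> V" "V \<subseteq> fst c" "\<And>q. q \<in> V \<Longrightarrow> \<eta> q = 1"
    "compact K" "K \<subseteq> fst c" "\<And>q. q \<notin> K \<Longrightarrow> \<eta> q = 0"
  then have "cutoff c p \<eta> V" unfolding cutoff_def by blast
  then show thesis by (rule that)
qed

lemma cutoffD:
  assumes "cutoff c p \<eta> V"
  shows "smooth_fun A \<eta>" "open V" "p \<in> V" "V \<subseteq> fst c" "\<And>q. q \<in> V \<Longrightarrow> \<eta> q = 1" "\<eta> p = 1" "p \<in> fst c"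
  using assms by (auto simp: cutoff_def)

lemma smooth_frame_field:
  assumes c: "admissible c" and \<eta>: "cutoff c p \<eta> V"
  shows "smooth_field A (frame_field \<eta> c w)"
proof -
  note ch = admissible_is_chart[OF c]
  obtain K where K: "compact K" "K \<subseteq> fst c" "\<And>q. q \<notin> K \<Longrightarrow> \<eta> q = 0"
    using \<eta> unfolding cutoff_def by blast
  have "Ck_field k (frame_field \<eta> c w)" for k
  proof (rule Ck_field_extend[OF c K(1,2)])
    have "Ck_fun k \<eta>" using cutoffD(1)[OF \<eta>] smooth_fun_iff by blast
    then show "Ck_on k (snd c ` fst c) (\<lambda>x. (\<eta> \<circ> chart_inv c) x *\<^sub>R w)"
      by (intro Ck_on_scaleR[OF is_chart_open_image[OF ch]] Ck_fun_admissible c Ck_on_const)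
    show "frame_field \<eta> c w q = coord_vector A c q ((\<eta> \<circ> chart_inv c) (snd c q) *\<^sub>R w)" if "q \<in> fst c" for q
      by (simp add: frame_field_def chart_inv_chart[OF ch that] linear_scale[OF linear_coord_vector[OF c that]])
  qed (simp add: frame_field_def K)
  then show ?thesis by (simp add: smooth_field_iff)
qed

lemma smooth_fun_cutoff_mult:
  assumes c: "admissible c" and \<eta>: "cutoff c p \<eta> V"
    and f: "\<And>k. Ck_on k (snd c ` fst c) (f \<circ> chart_inv c)"
  shows "smooth_fun A (\<lambda>q. \<eta> q * f q)"
proof -
  obtain K where K: "compact K" "K \<subseteq> fst c" "\<And>q. q \<notin> K \<Longrightarrow> \<eta> q = 0"
    using \<eta> unfolding cutoff_def by blast
  have "Ck_fun k (\<lambda>q. \<eta> q * f q)" for k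
  proof (rule Ck_fun_extend[OF c K(1,2)])
    have "Ck_fun k \<eta>" using cutoffD(1)[OF \<eta>] smooth_fun_iff by blast
    from Ck_on_mult[OF is_chart_open_image[OF admissible_is_chart[OF c]] Ck_fun_admissible[OF this c] f]
    show "Ck_on k (snd c ` fst c) ((\<lambda>q. \<eta> q * f q) \<circ> chart_inv c)" by (simp add: o_def)
  qed (simp add: K)
  then show ?thesis by (simp add: smooth_fun_iff)
qed

lemma dir_deriv_cutoff_mult:
  assumes c: "admissible c" and \<eta>: "cutoff c p \<eta> V" and q: "q \<in> V"
    and f: "((f \<circ> chart_inv c) has_derivative D) (at (snd c q))"
  shows "dir_deriv A (\<lambda>q. \<eta> q * f q) q v = D (components A c q v)"
proof -
  have "dir_deriv A (\<lambda>q. \<eta> q * f q) q v = dir_deriv A f q v"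
    by (rule dir_deriv_cong_open[OF cutoffD(2)[OF \<eta>] q]) (simp add: cutoffD(5)[OF \<eta>])
  also have "\<dots> = D (components A c q v)"
    using dir_deriv_chart[OF c _ f] cutoffD(4)[OF \<eta>] q by blast
  finally show ?thesis .
qed

text \<open>Derivatives of these global functions recover the components of a vector. They are the
  test functions for the torsion axiom, which mentions brackets only through their action on
  functions.\<close>

lemma coordinate_function:
  assumes c: "admissible c" and \<eta>: "cutoff c p \<eta> V"
  shows smooth_coordinate_function: "smooth_fun A (\<lambda>q. \<eta> q * (snd c q \<bullet> w))"
    and dir_deriv_coordinate_function:
      "q \<in> V \<Longrightarrow> dir_deriv A (\<lambda>q. \<eta> q * (snd c q \<bullet> w)) q v = components A c q v \<bullet> w"
proof -
  note ch = admissible_is_chart[OF c]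
  note o = is_chart_open_image[OF ch]
  have eq: "((\<lambda>q. snd c q \<bullet> w) \<circ> chart_inv c) x = x \<bullet> w" if "x \<in> snd c ` fst c" for x
    using chart_chart_inv[OF ch that] by simp
  show "smooth_fun A (\<lambda>q. \<eta> q * (snd c q \<bullet> w))"
    by (rule smooth_fun_cutoff_mult[OF c \<eta>])
      (subst Ck_on_cong[OF o eq], assumption,
        rule Ck_on_bounded_linear[OF o bounded_linear_inner_left])
  show "dir_deriv A (\<lambda>q. \<eta> q * (snd c q \<bullet> w)) q v = components A c q v \<bullet> w" if "q \<in> V"
  proof (rule dir_deriv_cutoff_mult[OF c \<eta> that])
    show "(((\<lambda>q. snd c q \<bullet> w) \<circ> chart_inv c) has_derivative (\<lambda>v. v \<bullet> w)) (at (snd c q))"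
      by (subst has_derivative_cong_open[OF o _ eq])
        (use cutoffD(4)[OF \<eta>] that in \<open>auto intro!: bounded_linear_imp_has_derivative bounded_linear_inner_left\<close>)
  qed
qed

end

locale lorentz_manifold = smooth_manifold A
  for A :: "('m::t2_space, 'e::euclidean_space) chart set" +
  fixes g :: "'m \<Rightarrow> 'e \<Rightarrow> 'e \<Rightarrow> real" and nabla :: "'m \<Rightarrow> 'e \<Rightarrow> ('m \<Rightarrow> 'e) \<Rightarrow> 'e"
  assumes metric: "lorentz_metric A g" and connection: "levi_civita A g nabla"
begin

section \<open>Locality of the connection and its Christoffel symbols\<close>

lemma lorentz: "lorentz_form (g p)"
  using metric by (simp add: lorentz_metric_def)

lemma g_bilinear: "bilinear (g p)" and g_sym: "g p v w = g p w v"
  using lorentz[of p] by (auto simp: lorentz_form_def)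

lemmas g_simps = bilinear_ladd[OF g_bilinear] bilinear_radd[OF g_bilinear]
  bilinear_lmul[OF g_bilinear] bilinear_rmul[OF g_bilinear] bilinear_lsub[OF g_bilinear]
  bilinear_rsub[OF g_bilinear] bilinear_lneg[OF g_bilinear] bilinear_rneg[OF g_bilinear]
  bilinear_lzero[OF g_bilinear] bilinear_rzero[OF g_bilinear]

lemma nabla_linear: "smooth_field A X \<Longrightarrow> linear (\<lambda>v. nabla p v X)"
  by (rule connection[unfolded levi_civita_def, THEN conjunct1, rule_format])

lemma nabla_add: "smooth_field A X \<Longrightarrow> smooth_field A Y \<Longrightarrow>
    nabla p v (\<lambda>q. X q + Y q) = nabla p v X + nabla p v Y"
  by (rule connection[unfolded levi_civita_def, THEN conjunct2, THEN conjunct2, THEN conjunct1, rule_format])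

lemma nabla_scale: "smooth_fun A f \<Longrightarrow> smooth_field A X \<Longrightarrow>
    nabla p v (\<lambda>q. f q *\<^sub>R X q) = dir_deriv A f p v *\<^sub>R X p + f p *\<^sub>R nabla p v X"
  by (rule connection[unfolded levi_civita_def, THEN conjunct2, THEN conjunct2, THEN conjunct2, THEN conjunct1, rule_format])

lemma nabla_torsion: "smooth_field A X \<Longrightarrow> smooth_field A Y \<Longrightarrow> smooth_fun A f \<Longrightarrow>
    dir_deriv A f p (nabla p (X p) Y - nabla p (Y p) X) =
      dir_deriv A (\<lambda>q. dir_deriv A f q (Y q)) p (X p) -
      dir_deriv A (\<lambda>q. dir_deriv A f q (X q)) p (Y p)"
  by (rule connection[unfolded levi_civita_def, THEN conjunct2, THEN conjunct2, THEN conjunct2, THEN conjunct2, THEN conjunct1, rule_format])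

lemma nabla_metric: "smooth_field A X \<Longrightarrow> smooth_field A Y \<Longrightarrow>
    dir_deriv A (\<lambda>q. g q (X q) (Y q)) p v = g p (nabla p v X) (Y p) + g p (X p) (nabla p v Y)"
  by (rule connection[unfolded levi_civita_def, THEN conjunct2, THEN conjunct2, THEN conjunct2, THEN conjunct2, THEN conjunct2, rule_format])

lemma smooth_field_add: "smooth_field A X \<Longrightarrow> smooth_field A Y \<Longrightarrow> smooth_field A (\<lambda>q. X q + Y q)"
  by (simp add: smooth_field_iff Ck_field_add)

lemma smooth_field_scale: "smooth_fun A f \<Longrightarrow> smooth_field A X \<Longrightarrow> smooth_field A (\<lambda>q. f q *\<^sub>R X q)"
  by (simp add: smooth_field_iff smooth_fun_iff Ck_field_scale)

text \<open>After multiplication by a cutoff the two fields coincide globally. In the Leibniz rule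
  the terms with the derivative of the cutoff agree because X p = Y p, which leaves the covariant
  derivatives themselves.\<close>

lemma nabla_local:
  assumes X: "smooth_field A X" "smooth_field A Y" and U: "open U" "p \<in> U" "\<And>q. q \<in> U \<Longrightarrow> X q = Y q"
  shows "nabla p v X = nabla p v Y"
proof -
  obtain \<eta> V K where \<eta>: "smooth_fun A \<eta>" "p \<in> V" "\<And>q. q \<in> V \<Longrightarrow> \<eta> q = 1" "K \<subseteq> U" "\<And>q. q \<notin> K \<Longrightarrow> \<eta> q = 0"
    using cutoff_function[OF chart_at_admissible chart_at(2) U(1,2)] by metis
  have "(\<lambda>q. \<eta> q *\<^sub>R X q) = (\<lambda>q. \<eta> q *\<^sub>R Y q)"
  proof
    fix q
    show "\<eta> q *\<^sub>R X q = \<eta> q *\<^sub>R Y q" using U(3)[of q] \<eta>(4,5) by (cases "q \<in> K") auto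
  qed
  then have "dir_deriv A \<eta> p v *\<^sub>R X p + \<eta> p *\<^sub>R nabla p v X = dir_deriv A \<eta> p v *\<^sub>R Y p + \<eta> p *\<^sub>R nabla p v Y"
    using nabla_scale[OF \<eta>(1) X(1)] nabla_scale[OF \<eta>(1) X(2)] by metis
  then show ?thesis using U \<eta>(2,3) by simp
qed

lemma nabla_sum:
  assumes "finite I" "I \<noteq> {}" "\<And>i. i \<in> I \<Longrightarrow> smooth_field A (X i)"
  shows "smooth_field A (\<lambda>q. \<Sum>i\<in>I. X i q) \<and> nabla p v (\<lambda>q. \<Sum>i\<in>I. X i q) = (\<Sum>i\<in>I. nabla p v (X i))"
  using assms
  by (induction I rule: finite_ne_induct) (simp_all add: nabla_add smooth_field_add)

text \<open>Torsion-freeness tested on the coordinate functions, whose derivatives along coordinate fields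
  are constant.\<close>

lemma nabla_frame_sym:
  assumes c: "admissible c" and \<eta>: "cutoff c p \<eta> V"
  shows "nabla p (coord_vector A c p u) (frame_field \<eta> c w) = nabla p (coord_vector A c p w) (frame_field \<eta> c u)"
proof -
  note E = smooth_frame_field[OF c \<eta>]
  note p = cutoffD[OF \<eta>]
  have Ep: "frame_field \<eta> c w q = coord_vector A c q w" if "q \<in> V" for w q
    using p(5)[OF that] by (simp add: frame_field_def)
  let ?z = "nabla p (coord_vector A c p u) (frame_field \<eta> c w) - nabla p (coord_vector A c p w) (frame_field \<eta> c u)"
  have comp: "components A c p ?z \<bullet> b = 0" for b
  proof -
    let ?f = "\<lambda>q. \<eta> q * (snd c q \<bullet> b)"
    have const: "dir_deriv A (\<lambda>q. dir_deriv A ?f q (frame_field \<eta> c w q)) p v = 0" for w v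
    proof -
      have "dir_deriv A (\<lambda>q. dir_deriv A ?f q (frame_field \<eta> c w q)) p v = dir_deriv A (\<lambda>q. w \<bullet> b) p v"
      proof (rule dir_deriv_cong_open[OF p(2,3)])
        fix q assume q: "q \<in> V"
        then have "q \<in> fst c" using p(4) by blast
        then show "dir_deriv A ?f q (frame_field \<eta> c w q) = w \<bullet> b"
          using dir_deriv_coordinate_function[OF c \<eta> q, of b] c by (simp add: Ep q)
      qed
      then show ?thesis by (simp add: dir_deriv_const)
    qed
    have "dir_deriv A ?f p ?z = 0"
      using nabla_torsion[OF E[of u] E[of w] smooth_coordinate_function[OF c \<eta>, of b], of p] const
      by (simp add: Ep[OF p(3)])
    then show ?thesis using dir_deriv_coordinate_function[OF c \<eta> p(3), of b ?z] by simp
  qed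
  have "components A c p ?z = 0" by (rule euclidean_eqI) (simp only: comp inner_zero_left)
  then have "?z = 0"
    using coord_vector_components[OF c p(7), of ?z] linear_0[OF linear_coord_vector[OF c p(7)]] by simp
  then show ?thesis by simp
qed

text \<open>\<open>christoffel \<eta> c p i u\<close> has the components \<open>\<Sum>j. u\<^sub>j \<Gamma>\<^sup>k\<^sub>j\<^sub>i\<close>. Differentiating in the direction \<open>u\<close> rather
  than \<open>i\<close>, it is linear in \<open>u\<close> by the axioms of a connection.\<close>

definition christoffel :: "('m \<Rightarrow> real) \<Rightarrow> ('m, 'e) chart \<Rightarrow> 'm \<Rightarrow> 'e \<Rightarrow> 'e \<Rightarrow> 'e" where
  "christoffel \<eta> c p i u = components A c p (nabla p (coord_vector A c p u) (frame_field \<eta> c i))"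

lemma linear_christoffel:
  assumes "admissible c" "cutoff c p \<eta> V"
  shows "linear (christoffel \<eta> c p i)"
  unfolding christoffel_def
  using linear_compose[OF linear_compose[OF linear_coord_vector nabla_linear] linear_components]
    smooth_frame_field[OF assms] assms(1) cutoffD(7)[OF assms(2)]
  by (simp add: o_def)

text \<open>Near p the field is the sum of its component functions times the cut-off frame. The
  Leibniz rule separates the derivative of the components from the Christoffel terms.\<close>

lemma nabla_in_chart:
  assumes c: "c \<in> A" and \<eta>: "cutoff c p \<eta> V" and X: "smooth_field A X"
  shows "components A c p (nabla p (coord_vector A c p u) X) =
    frechet_derivative (chart_field c X) (at (snd c p)) u +
    (\<Sum>i\<in>Basis. (chart_field c X (snd c p) \<bullet> i) *\<^sub>R christoffel \<eta> c p i u)"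
proof -
  note adm = atlas_admissible[OF c] and ch = atlas_is_chart[OF c] and p = cutoffD[OF \<eta>]
  note o = is_chart_open_image[OF ch]
  have Xc: "Ck_on k (snd c ` fst c) (chart_field c X)" for k
    using X c smooth_field_iff Ck_fieldD by blast
  have dX: "(chart_field c X has_derivative frechet_derivative (chart_field c X) (at (snd c p))) (at (snd c p))"
    by (rule Ck_on_Suc_has_derivative[OF Xc[of "Suc 0"]]) (use p in auto)
  define h where "h i q = components A c q (X q) \<bullet> i" for i q
  have hc: "h i \<circ> chart_inv c = (\<lambda>x. chart_field c X x \<bullet> i)" for i
    by (auto simp: h_def chart_field_def)
  have h_smooth: "smooth_fun A (\<lambda>q. \<eta> q * h i q)" for i
    by (rule smooth_fun_cutoff_mult[OF adm \<eta>]) (unfold hc, intro Ck_on_inner[OF o Xc] Ck_on_const)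
  have h_dir: "dir_deriv A (\<lambda>q. \<eta> q * h i q) p (coord_vector A c p u) =
      frechet_derivative (chart_field c X) (at (snd c p)) u \<bullet> i" for i
  proof -
    have "((h i \<circ> chart_inv c) has_derivative
        (\<lambda>v. frechet_derivative (chart_field c X) (at (snd c p)) v \<bullet> i)) (at (snd c p))"
      unfolding hc by (rule has_derivative_inner_left[OF dX])
    from dir_deriv_cutoff_mult[OF adm \<eta> p(3) this] show ?thesis using adm p by simp
  qed
  let ?E = "frame_field \<eta> c" and ?v = "coord_vector A c p u"
  note E = smooth_frame_field[OF adm \<eta>]
  have Ep: "?E i p = coord_vector A c p i" for i by (simp add: frame_field_def p(6))
  let ?Y = "\<lambda>q. \<Sum>i\<in>Basis. (\<eta> q * h i q) *\<^sub>R ?E i q"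
  have Y: "smooth_field A ?Y" "nabla p ?v ?Y = (\<Sum>i\<in>Basis. nabla p ?v (\<lambda>q. (\<eta> q * h i q) *\<^sub>R ?E i q))"
    using nabla_sum[of Basis "\<lambda>i q. (\<eta> q * h i q) *\<^sub>R ?E i q"] smooth_field_scale[OF h_smooth E] by auto
  have "nabla p ?v X = nabla p ?v ?Y"
  proof (rule nabla_local[OF X Y(1) p(2,3)])
    fix q assume q: "q \<in> V"
    then have qc: "q \<in> fst c" using p(4) by blast
    have "?Y q = (\<Sum>i\<in>Basis. (components A c q (X q) \<bullet> i) *\<^sub>R coord_vector A c q i)"
      by (simp add: p(5)[OF q] frame_field_def h_def)
    also have "\<dots> = coord_vector A c q (components A c q (X q))"
      by (rule linear_euclidean_sum[OF linear_coord_vector[OF adm qc], symmetric])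
    finally show "X q = ?Y q" using adm qc by simp
  qed
  also have "\<dots> = (\<Sum>i\<in>Basis. (frechet_derivative (chart_field c X) (at (snd c p)) u \<bullet> i) *\<^sub>R coord_vector A c p i +
      h i p *\<^sub>R nabla p ?v (?E i))"
    unfolding Y(2)
    by (rule sum.cong[OF refl]) (simp only: nabla_scale[OF h_smooth E] h_dir Ep p(6) mult_1)
  finally have "components A c p (nabla p ?v X) =
      (\<Sum>i\<in>Basis. (frechet_derivative (chart_field c X) (at (snd c p)) u \<bullet> i) *\<^sub>R i +
        h i p *\<^sub>R christoffel \<eta> c p i u)"
    using linear_components[OF adm p(7)] adm p(7)
    by (simp add: linear_sum linear_add linear_scale christoffel_def)
  moreover have "h i p = chart_field c X (snd c p) \<bullet> i" for i
    by (simp add: h_def chart_field_def chart_inv_chart[OF ch p(7)])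
  ultimately show ?thesis by (simp add: sum.distrib euclidean_representation)
qed

section \<open>The volume density of the metric\<close>

definition chart_metric :: "('m, 'e) chart \<Rightarrow> 'e \<Rightarrow> 'e \<Rightarrow> 'e \<Rightarrow> real" where
  "chart_metric c x u w =
     g (chart_inv c x) (coord_vector A c (chart_inv c x) u) (coord_vector A c (chart_inv c x) w)"

text \<open>The Lorentzian volume density: the determinant is negative in every chart, so the minus
  sign stands for the absolute value.\<close>

definition metric_density :: "('m, 'e) chart \<Rightarrow> 'e \<Rightarrow> real" where
  "metric_density c x = sqrt (- det (form_matrix (chart_metric c x)))"

lemma Ck_on_chart_metric: "c \<in> A \<Longrightarrow> Ck_on k (snd c ` fst c) (\<lambda>x. chart_metric c x u w)"
  using metric unfolding lorentz_metric_def smooth_on_def chart_metric_def by blast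

lemma chart_metric_change:
  assumes "c \<in> A" "d \<in> A" "p \<in> fst c" "p \<in> fst d"
  shows "chart_metric c (snd c p) u w =
    chart_metric d (snd d p) (transition c d p u) (transition c d p w)"
proof -
  have "coord_vector A d p (transition c d p u) = coord_vector A c p u" for u
    using coord_vector_components[OF atlas_admissible[OF assms(2)] assms(4), of "coord_vector A c p u"]
      components_coord_vector[OF atlas_admissible[OF assms(1)] atlas_admissible[OF assms(2)] assms(3,4)] by simp
  then show ?thesis
    using assms by (simp add: chart_metric_def chart_inv_chart atlas_is_chart)
qed

lemma bilinear_chart_metric:
  assumes "c \<in> A" "x \<in> snd c ` fst c"
  shows "bilinear (chart_metric c x)"
proof -
  have "linear (coord_vector A c (chart_inv c x))"
    by (rule linear_coord_vector[OF atlas_admissible[OF assms(1)]])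
      (use assms in \<open>simp add: chart_inv_in atlas_is_chart\<close>)
  then show ?thesis
    unfolding bilinear_def chart_metric_def
    by (auto intro!: linearI simp: linear_add linear_scale g_simps)
qed

lemma det_chart_metric_neg:
  assumes c: "c \<in> A" and p: "p \<in> fst c"
  shows "det (form_matrix (chart_metric c (snd c p))) < 0"
proof -
  note ch = atlas_is_chart[OF c] and adm = atlas_admissible[OF c]
  let ?P = "coord_vector A c p" and ?Q = "components A c p"
  have eq: "chart_metric c (snd c p) = (\<lambda>u w. g p (?P u) (?P w))"
    by (auto simp: chart_metric_def chart_inv_chart[OF ch p] fun_eq_iff)
  have lin: "linear ?P" "linear ?Q" using linear_coord_vector linear_components adm p by blast+
  \<comment> \<open>Pulling back in this direction puts the unknown determinant next to the square:
    a negative product with a nonnegative factor forces the other factor to be negative.\<close>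
  have "form_matrix (g p) = form_matrix (\<lambda>u w. chart_metric c (snd c p) (?Q u) (?Q w))"
    by (simp add: eq adm p)
  then have "det (form_matrix (g p)) =
      (det (operator_matrix ?Q))\<^sup>2 * det (form_matrix (chart_metric c (snd c p)))"
    using det_form_pullback[OF bilinear_chart_metric lin(2), of c "snd c p"] c p by simp
  with det_lorentz_form_neg[OF lorentz[of p]] show ?thesis
    by (metis mult_nonneg_nonneg not_less zero_le_power2)
qed

lemma is_density_metric_density: "is_density metric_density"
  unfolding is_density_def
proof (intro conjI ballI)
  fix c assume c: "c \<in> A"
  note o = is_chart_open_image[OF atlas_is_chart[OF c]]
  have "Ck_on (Suc 0) (snd c ` fst c) (\<lambda>x. - det (form_matrix (chart_metric c x)))"
    unfolding det_def form_matrix_def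
    by (intro Ck_on_uminus[OF o] Ck_on_sum[OF o] Ck_on_mult[OF o] Ck_on_const Ck_on_prod[OF o])
      (simp add: Ck_on_chart_metric[OF c] del: Ck_on.simps)
  then show "Ck_on (Suc 0) (snd c ` fst c) (metric_density c)"
    unfolding metric_density_def[abs_def]
    by (intro Ck_on_compose[OF o open_greaterThan _ C1_sqrt]) (use det_chart_metric_neg[OF c] in auto)
  show "0 < metric_density c x" if "x \<in> snd c ` fst c" for x
    using that det_chart_metric_neg[OF c] by (auto simp: metric_density_def)
  fix d p assume d: "d \<in> A" and p: "p \<in> fst c \<inter> fst d"
  have cmp: "compatible c d" using c d atlas_admissible admissible_compatible by blast
  have "chart_metric c (snd c p) =
      (\<lambda>u w. chart_metric d (snd d p) (transition c d p u) (transition c d p w))"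
    using chart_metric_change[OF c d] p by blast
  then have "det (form_matrix (chart_metric c (snd c p))) =
      (det (operator_matrix (transition c d p)))\<^sup>2 * det (form_matrix (chart_metric d (snd d p)))"
    using det_form_pullback[OF bilinear_chart_metric[OF d] linear_transition[OF cmp]] p by simp
  then have "- det (form_matrix (chart_metric c (snd c p))) =
      (det (operator_matrix (transition c d p)))\<^sup>2 * (- det (form_matrix (chart_metric d (snd d p))))"
    by simp
  then show "metric_density c (snd c p) =
      \<bar>det (operator_matrix (transition c d p))\<bar> * metric_density d (snd d p)"
    by (simp only: metric_density_def real_sqrt_mult real_sqrt_abs)
qed

lemma chart_metric_derivative:
  assumes c: "c \<in> A" and \<eta>: "cutoff c p \<eta> V"
  shows "frechet_derivative (\<lambda>x. chart_metric c x u w) (at (snd c p)) i =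
    chart_metric c (snd c p) (christoffel \<eta> c p i u) w + chart_metric c (snd c p) u (christoffel \<eta> c p i w)"
proof -
  note adm = atlas_admissible[OF c] and ch = atlas_is_chart[OF c] and p = cutoffD[OF \<eta>]
  note E = smooth_frame_field[OF adm \<eta>]
  let ?E = "frame_field \<eta> c" and ?v = "coord_vector A c p i"
  have Ep: "?E u p = coord_vector A c p u" for u by (simp add: frame_field_def p(6))
  \<comment> \<open>\<open>christoffel\<close> differentiates in the direction of its last argument.
    The symmetry of frame derivatives turns this into the derivative in direction \<open>i\<close>
    that the metric axiom produces.\<close>
  have chr: "coord_vector A c p (christoffel \<eta> c p i u) = nabla p ?v (?E u)" for u
    unfolding christoffel_def nabla_frame_sym[OF adm \<eta>, of u i]
    by (rule coord_vector_components[OF adm p(7)])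
  let ?h = "\<lambda>q. g q (coord_vector A c q u) (coord_vector A c q w)"
  have h: "?h \<circ> chart_inv c = (\<lambda>x. chart_metric c x u w)"
    by (auto simp: chart_metric_def)
  have "(?h \<circ> chart_inv c has_derivative frechet_derivative (\<lambda>x. chart_metric c x u w) (at (snd c p))) (at (snd c p))"
    unfolding h by (rule Ck_on_Suc_has_derivative[OF Ck_on_chart_metric[OF c]]) (use p in auto)
  from dir_deriv_chart[OF adm p(7) this]
  have "frechet_derivative (\<lambda>x. chart_metric c x u w) (at (snd c p)) i = dir_deriv A ?h p ?v"
    using adm p by simp
  also have "\<dots> = dir_deriv A (\<lambda>q. g q (?E u q) (?E w q)) p ?v"
    by (rule dir_deriv_cong_open[OF p(2,3)]) (simp add: frame_field_def p(5))
  also have "\<dots> = g p (nabla p ?v (?E u)) (?E w p) + g p (?E u p) (nabla p ?v (?E w))"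
    by (rule nabla_metric[OF E E])
  also have "\<dots> = g p (coord_vector A c p (christoffel \<eta> c p i u)) (coord_vector A c p w) +
      g p (coord_vector A c p u) (coord_vector A c p (christoffel \<eta> c p i w))"
    by (simp only: chr Ep)
  finally show ?thesis by (simp add: chart_metric_def chart_inv_chart[OF ch p(7)])
qed

text \<open>In direction i the Gram matrix G has derivative \<Gamma>^T G + G \<Gamma>, where
  \<Gamma> is the matrix of \<open>christoffel \<eta> c p i\<close>. The two-sided Jacobi formula
  gives twice the trace times det G, and the square root halves it.\<close>

lemma metric_density_derivative:
  assumes c: "c \<in> A" and \<eta>: "cutoff c p \<eta> V"
  shows "frechet_derivative (metric_density c) (at (snd c p)) i =
    metric_density c (snd c p) * operator_trace (christoffel \<eta> c p i)"
proof -
  note adm = atlas_admissible[OF c] and p = cutoffD[OF \<eta>]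
  let ?x = "snd c p" and ?G = "christoffel \<eta> c p i"
  let ?M = "\<lambda>x. form_matrix (chart_metric c x)"
  define M' where "M' v = form_matrix (\<lambda>u w. frechet_derivative (\<lambda>x. chart_metric c x u w) (at ?x) v)" for v
  have x: "?x \<in> snd c ` fst c" using p by blast
  have "((\<lambda>x. det (?M x)) has_derivative (\<lambda>v. det_deriv (?M ?x) (M' v))) (at ?x)"
    by (rule has_derivative_det)
      (simp add: form_matrix_def M'_def Ck_on_Suc_has_derivative[OF Ck_on_chart_metric[OF c] x])
  then have "((\<lambda>x. - det (?M x)) has_derivative (\<lambda>v. - det_deriv (?M ?x) (M' v))) (at ?x)"
    by (rule has_derivative_minus)
  from has_derivative_compose[OF this DERIV_real_sqrt[THEN has_field_derivative_imp_has_derivative]]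
  have "(metric_density c has_derivative
      (\<lambda>v. (inverse (sqrt (- det (?M ?x))) / 2) * (- det_deriv (?M ?x) (M' v)))) (at ?x)"
    using det_chart_metric_neg[OF c p(7)] by (simp add: metric_density_def[abs_def] o_def)
  then have "frechet_derivative (metric_density c) (at ?x) i =
      (inverse (sqrt (- det (?M ?x))) / 2) * (- det_deriv (?M ?x) (M' i))"
    by (simp add: frechet_derivative_eqI)
  moreover have "M' i = transpose (operator_matrix ?G) ** ?M ?x + ?M ?x ** operator_matrix ?G"
    unfolding M'_def chart_metric_derivative[OF c \<eta>]
    by (rule form_matrix_derivation[OF bilinear_chart_metric[OF c x] linear_christoffel[OF adm \<eta>]])
  ultimately have f1: "frechet_derivative (metric_density c) (at ?x) i =
      inverse (sqrt (- det (?M ?x))) * operator_trace ?G * (- det (?M ?x))"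
    by (simp add: det_deriv_congruence trace_operator_matrix)
  have f2: "- det (?M ?x) = sqrt (- det (?M ?x)) * sqrt (- det (?M ?x))"
    and f3: "sqrt (- det (?M ?x)) > 0"
    using det_chart_metric_neg[OF c p(7)] by simp_all
  have alg: "inverse s * t * d = s * t" if "d = s * s" "s > 0" for s t d :: real
    using that by simp
  show ?thesis unfolding f1 alg[OF f2 f3] by (simp add: metric_density_def)
qed

text \<open>Taking the trace of nabla X in the chart leaves the sum of the partial derivatives plus
  traces of Christoffel operators weighted by the components of X. By
  \<open>metric_density_derivative\<close> these are the terms in which the density is
  differentiated.\<close>

lemma has_div_divergence:
  assumes X: "smooth_field A X"
  shows "has_div metric_density X (divergence nabla X)"
  unfolding has_div_def
proof (intro ballI)
  fix c x assume c: "c \<in> A" and "x \<in> snd c ` fst c"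
  then obtain p where p: "p \<in> fst c" "x = snd c p" by blast
  note adm = atlas_admissible[OF c] and ch = atlas_is_chart[OF c]
  obtain \<eta> V where \<eta>: "cutoff c p \<eta> V" using cutoff_exists[OF adm p(1)] .
  let ?\<rho> = "metric_density c" and ?X = "chart_field c X" and ?G = "christoffel \<eta> c p"
  have x: "x \<in> snd c ` fst c" using p by blast
  have \<rho>: "(?\<rho> has_derivative frechet_derivative ?\<rho> (at x)) (at x)"
    using is_density_metric_density c
    by (intro Ck_on_Suc_has_derivative[where k = 0, OF _ x]) (simp add: is_density_def del: Ck_on.simps)
  have "Ck_field (Suc 0) X" using X smooth_field_iff by blast
  then have dX: "(?X has_derivative frechet_derivative ?X (at x)) (at x)"
    by (intro Ck_on_Suc_has_derivative[OF Ck_fieldD[OF _ c] x])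
  have deriv: "frechet_derivative (\<lambda>y. ?\<rho> y * (?X y \<bullet> b)) (at x) b =
      ?\<rho> x * (frechet_derivative ?X (at x) b \<bullet> b) + ?\<rho> x * operator_trace (?G b) * (?X x \<bullet> b)" for b
    using fun_cong[OF frechet_derivative_eqI[OF has_derivative_mult[OF \<rho> has_derivative_inner_left[OF dX, of b]]], of b]
    by (simp add: metric_density_derivative[OF c \<eta>] p(2))
  have "divergence nabla X p = operator_trace (\<lambda>v. nabla p v X)"
    by (simp add: divergence_def operator_trace_def)
  also have "\<dots> = operator_trace (\<lambda>u. components A c p (nabla p (coord_vector A c p u) X))"
    by (rule operator_trace_conjugate[symmetric])
      (use nabla_linear[OF X] linear_coord_vector linear_components adm p in auto)
  also have "\<dots> = (\<Sum>b\<in>Basis. frechet_derivative ?X (at x) b \<bullet> b) +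
      (\<Sum>b\<in>Basis. \<Sum>i\<in>Basis. (?X x \<bullet> i) * (?G i b \<bullet> b))"
    by (simp add: operator_trace_def nabla_in_chart[OF c \<eta> X] p(2) inner_add_left inner_sum_left sum.distrib)
  also have "(\<Sum>b\<in>Basis. \<Sum>i\<in>Basis. (?X x \<bullet> i) * (?G i b \<bullet> b)) =
      (\<Sum>i\<in>Basis. (?X x \<bullet> i) * operator_trace (?G i))"
    by (subst sum.swap) (simp add: operator_trace_def sum_distrib_left)
  finally have div: "divergence nabla X p = (\<Sum>b\<in>Basis. frechet_derivative ?X (at x) b \<bullet> b) +
      (\<Sum>i\<in>Basis. (?X x \<bullet> i) * operator_trace (?G i))" .
  show "(\<Sum>b\<in>Basis. frechet_derivative (\<lambda>y. ?\<rho> y * (?X y \<bullet> b)) (at x) b) =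
      ?\<rho> x * divergence nabla X (chart_inv c x)"
    unfolding deriv using p
    by (simp add: chart_inv_chart[OF ch] div sum.distrib sum_distrib_left distrib_left mult_ac)
qed

end

section \<open>Spacelike foliations and a parallel timelike field\<close>

context smooth_manifold
begin

lemma Ck_fun_open_nonzero:
  assumes "Ck_fun 0 f"
  shows "open {q. f q \<noteq> 0}"
proof -
  have "open (fst c \<inter> snd c -` {x \<in> snd c ` fst c. (f \<circ> chart_inv c) x \<noteq> 0})" if c: "c \<in> A" for c
  proof -
    note ch = atlas_is_chart[OF c]
    have "open {x \<in> snd c ` fst c. (f \<circ> chart_inv c) x \<noteq> 0}"
      using continuous_open_preimage[OF Ck_on_continuous[OF Ck_funD[OF assms c]]
          is_chart_open_image[OF ch] open_Compl[OF closed_singleton[of 0]]]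
      by (simp add: vimage_def Int_def)
    then show ?thesis
      using continuous_open_preimage[OF is_chart_continuous[OF ch] is_chart_open[OF ch]] by blast
  qed
  moreover have "{q. f q \<noteq> 0} =
      (\<Union>c\<in>A. fst c \<inter> snd c -` {x \<in> snd c ` fst c. (f \<circ> chart_inv c) x \<noteq> 0})"
  proof (intro set_eqI iffI)
    fix q assume "q \<in> {q. f q \<noteq> 0}"
    then have "q \<in> fst (chart_at A q) \<inter> snd (chart_at A q) -`
        {x \<in> snd (chart_at A q) ` fst (chart_at A q). (f \<circ> chart_inv (chart_at A q)) x \<noteq> 0}"
      using chart_at(2)[of q] by (simp add: chart_inv_chart[OF atlas_is_chart[OF chart_at(1)]])
    then show "q \<in> (\<Union>c\<in>A. fst c \<inter> snd c -` {x \<in> snd c ` fst c. (f \<circ> chart_inv c) x \<noteq> 0})"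
      using chart_at(1)[of q] by blast
  next
    fix q assume "q \<in> (\<Union>c\<in>A. fst c \<inter> snd c -` {x \<in> snd c ` fst c. (f \<circ> chart_inv c) x \<noteq> 0})"
    then obtain c where "c \<in> A" "q \<in> fst c" "(f \<circ> chart_inv c) (snd c q) \<noteq> 0" by blast
    then show "q \<in> {q. f q \<noteq> 0}" by (simp add: chart_inv_chart[OF atlas_is_chart])
  qed
  ultimately show ?thesis by auto
qed

lemma dir_deriv_compose:
  fixes \<kappa> :: "real \<Rightarrow> real"
  assumes f: "Ck_fun (Suc 0) f" and \<kappa>: "(\<kappa> has_real_derivative k) (at (f p))"
  shows "dir_deriv A (\<lambda>q. \<kappa> (f q)) p v = k * dir_deriv A f p v"
proof -
  let ?c = "chart_at A p"
  note ch = atlas_is_chart[OF chart_at(1), of p]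
  have eq: "(f \<circ> chart_inv ?c) (snd ?c p) = f p" by (simp add: chart_inv_chart[OF ch chart_at(2)])
  have "((\<lambda>x. \<kappa> ((f \<circ> chart_inv ?c) x)) has_derivative
      (\<lambda>u. k * dir_deriv A f p (coord_vector A ?c p u))) (at (snd ?c p))"
    by (rule has_derivative_compose[OF Ck_fun_has_derivative[OF f chart_at]
          has_field_derivative_imp_has_derivative]) (simp only: eq \<kappa>)
  then have "(((\<lambda>q. \<kappa> (f q)) \<circ> chart_inv ?c) has_derivative
      (\<lambda>u. k * dir_deriv A f p (coord_vector A ?c p u))) (at (snd ?c p))"
    by (simp add: o_def)
  from dir_deriv_chart[OF chart_at_admissible chart_at(2) this] show ?thesis
    by (simp add: chart_at)
qed

section \<open>Leaf tangent spaces and the unit normal\<close>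

lemma foliated_chart_exists:
  assumes "foliated_atlas A b F"
  obtains d where "d \<in> F" "p \<in> fst d" "admissible d"
proof -
  have "p \<in> (\<Union>c\<in>F. fst c)" using assms by (simp add: foliated_atlas_def)
  then obtain d where d: "d \<in> F" "p \<in> fst d" by blast
  moreover have "admissible d" using assms d(1) by (simp add: foliated_atlas_def admissible_def)
  ultimately show thesis by (rule that)
qed

text \<open>Changes of foliated charts preserve the hyperplane orthogonal to \<open>b\<close>, so
  the condition quantified over all foliated charts can be tested in one.\<close>

lemma leaf_tangent_iff:
  assumes F: "foliated_atlas A b F" and d: "d \<in> F" "p \<in> fst d"
  shows "v \<in> leaf_tangent A b F p \<longleftrightarrow> components A d p v \<bullet> b = 0"
proof
  assume v: "components A d p v \<bullet> b = 0"
  have "components A c p v \<bullet> b = 0" if c: "c \<in> F" "p \<in> fst c" for c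
  proof -
    have adm: "admissible c" "admissible d"
      using F c(1) d(1) by (simp_all add: foliated_atlas_def admissible_def)
    have "snd d p \<in> snd d ` (fst d \<inter> fst c)" using c d by blast
    then have "transition d c p (components A d p v) \<bullet> b = 0"
      using F c(1) d(1) v unfolding foliated_atlas_def transition_def by blast
    then show ?thesis by (simp add: transition_components adm c d)
  qed
  then show "v \<in> leaf_tangent A b F p" by (simp add: leaf_tangent_def)
qed (use d in \<open>simp add: leaf_tangent_def\<close>)

end

context lorentz_manifold
begin

text \<open>Smoothness of the metric is given for coordinate vectors with constant components, so
  both fields are expanded in these.\<close>

lemma smooth_fun_metric:
  assumes X: "smooth_field A X" and Y: "smooth_field A Y"
  shows "smooth_fun A (\<lambda>q. g q (X q) (Y q))"
proof -
  have "Ck_fun k (\<lambda>q. g q (X q) (Y q))" for k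
    unfolding Ck_fun_def
  proof
    fix c assume c: "c \<in> A"
    note ch = atlas_is_chart[OF c] and adm = atlas_admissible[OF c]
    note o = is_chart_open_image[OF ch]
    let ?G = "\<lambda>x. \<Sum>i\<in>Basis. \<Sum>j\<in>Basis.
      (chart_field c X x \<bullet> i) * (chart_field c Y x \<bullet> j) * chart_metric c x i j"
    have "Ck_field k X" "Ck_field k Y" using X Y smooth_field_iff by blast+
    then have "Ck_on k (snd c ` fst c) ?G"
      by (intro Ck_on_sum[OF o] Ck_on_mult[OF o] Ck_on_inner[OF o] Ck_on_const
          Ck_on_chart_metric[OF c] Ck_fieldD[OF _ c])
    moreover have "((\<lambda>q. g q (X q) (Y q)) \<circ> chart_inv c) x = ?G x" if x: "x \<in> snd c ` fst c" for x
    proof -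
      have q: "chart_inv c x \<in> fst c" by (rule chart_inv_in[OF ch x])
      note bil = bilinear_chart_metric[OF c x]
      have lin: "linear (\<lambda>v. chart_metric c x v w)" "linear (chart_metric c x w)" for w
        using bil by (simp_all add: bilinear_def)
      have "g (chart_inv c x) (X (chart_inv c x)) (Y (chart_inv c x)) =
          chart_metric c x (chart_field c X x) (chart_field c Y x)"
        by (simp add: chart_metric_def chart_field_def coord_vector_components[OF adm q])
      also have "\<dots> = (\<Sum>i\<in>Basis. (chart_field c X x \<bullet> i) * chart_metric c x i (chart_field c Y x))"
        by (subst linear_euclidean_sum[OF lin(1)]) simp
      also have "\<dots> = ?G x"
        by (subst linear_euclidean_sum[OF lin(2)]) (simp add: sum_distrib_left mult.assoc)
      finally show ?thesis by simp
    qed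
    ultimately show "Ck_on k (snd c ` fst c) ((\<lambda>q. g q (X q) (Y q)) \<circ> chart_inv c)"
      by (subst Ck_on_cong[OF o, where g = ?G]) auto
  qed
  then show ?thesis by (simp add: smooth_fun_iff)
qed

lemma closed_conformal_unit_parallel:
  assumes "closed_conformal A nabla \<xi>" "\<And>p. g p (\<xi> p) (\<xi> p) = -1"
  shows "nabla p v \<xi> = 0"
proof -
  obtain \<sigma> where \<xi>: "smooth_field A \<xi>" and \<sigma>: "\<And>p v. nabla p v \<xi> = \<sigma> p *\<^sub>R v"
    using assms(1) unfolding closed_conformal_def by blast
  have "0 = dir_deriv A (\<lambda>q. g q (\<xi> q) (\<xi> q)) p (\<xi> p)"
    by (simp add: assms(2) dir_deriv_const)
  also have "\<dots> = - 2 * \<sigma> p"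
    unfolding nabla_metric[OF \<xi> \<xi>] by (simp add: \<sigma> g_simps assms(2))
  finally show ?thesis by (simp add: \<sigma>)
qed

lemma nabla_unit_orthogonal:
  assumes "smooth_field A N" "\<And>p. g p (N p) (N p) = k"
  shows "g p (nabla p v N) (N p) = 0"
proof -
  have "0 = dir_deriv A (\<lambda>q. g q (N q) (N q)) p v"
    by (simp add: assms(2) dir_deriv_const)
  also have "\<dots> = 2 * g p (nabla p v N) (N p)"
    unfolding nabla_metric[OF assms(1) assms(1)] using g_sym[of p "N p"] by simp
  finally show ?thesis by simp
qed

text \<open>The leaf tangent space is the kernel of one linear functional, and this functional is
  nonzero on N. Subtracting a multiple of N moves a vector into the kernel; pairing with N shows
  that the multiple is zero if the vector was orthogonal to N.\<close>

lemma normal_orthogonal_iff: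
  assumes F: "foliated_atlas A b F" and N: "timelike_unit_normal A g b F N"
  shows "g p v (N p) = 0 \<longleftrightarrow> v \<in> leaf_tangent A b F p"
proof
  obtain d where d: "d \<in> F" "p \<in> fst d" "admissible d" using foliated_chart_exists[OF F] .
  have NN: "g p (N p) (N p) = -1" and perp: "\<And>w. w \<in> leaf_tangent A b F p \<Longrightarrow> g p (N p) w = 0"
    using N by (auto simp: timelike_unit_normal_def)
  show "g p v (N p) = 0" if "v \<in> leaf_tangent A b F p"
    using perp[OF that] g_sym by metis
  assume v: "g p v (N p) = 0"
  let ?l = "\<lambda>w. components A d p w \<bullet> b"
  note lin = linear_components[OF d(3,2)]
  have "N p \<notin> leaf_tangent A b F p" using perp[of "N p"] NN by auto
  then have N0: "?l (N p) \<noteq> 0" using leaf_tangent_iff[OF F d(1,2)] by blast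
  define w where "w = v - (?l v / ?l (N p)) *\<^sub>R N p"
  have "?l w = 0"
    using N0 by (simp add: w_def linear_diff[OF lin] linear_scale[OF lin] inner_diff_left)
  then have "g p (N p) w = 0" using perp leaf_tangent_iff[OF F d(1,2)] by blast
  then have "?l v / ?l (N p) = 0"
    using v NN g_sym[of p "N p" v] by (simp add: w_def g_simps)
  then show "v \<in> leaf_tangent A b F p"
    using N0 leaf_tangent_iff[OF F d(1,2)] by simp
qed

text \<open>Coordinate fields of a foliated chart along the leaves stay tangent to the leaves and commute.\<close>

lemma second_ff_symmetric:
  assumes F: "foliated_atlas A b F" and N: "timelike_unit_normal A g b F N"
    and v: "v \<in> leaf_tangent A b F p" and w: "w \<in> leaf_tangent A b F p"
  shows "g p (nabla p v N) w = g p (nabla p w N) v"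
proof -
  obtain d where d: "d \<in> F" "p \<in> fst d" "admissible d" using foliated_chart_exists[OF F] .
  obtain \<eta> V where \<eta>: "cutoff d p \<eta> V" using cutoff_exists[OF d(3,2)] .
  have N': "smooth_field A N" using N by (simp add: timelike_unit_normal_def)
  let ?E = "\<lambda>u. frame_field \<eta> d (components A d p u)"
  note E = smooth_frame_field[OF d(3) \<eta>]
  have Ep: "?E u p = u" for u
    by (simp add: frame_field_def cutoffD(6)[OF \<eta>] coord_vector_components[OF d(3,2)])
  have tangent: "?E u q \<in> leaf_tangent A b F q" if u: "u \<in> leaf_tangent A b F p" for u q
  proof (cases "q \<in> fst d")
    case True
    have "components A d q (?E u q) = \<eta> q *\<^sub>R components A d p u"
      by (simp add: frame_field_def linear_scale[OF linear_components[OF d(3) True]]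
          components_coord_vector_self[OF d(3) True])
    then show ?thesis
      using u leaf_tangent_iff[OF F d(1) True] leaf_tangent_iff[OF F d(1,2)] by simp
  next
    case False
    then have "?E u q = 0" using \<eta> unfolding cutoff_def frame_field_def by auto
    moreover obtain d' where d': "d' \<in> F" "q \<in> fst d'" "admissible d'" using foliated_chart_exists[OF F] .
    ultimately show ?thesis
      using leaf_tangent_iff[OF F d'(1,2)] linear_0[OF linear_components[OF d'(3,2)]] by simp
  qed
  \<comment> \<open>Differentiating g(N, E w) = 0 trades the derivative of N for the normal
    component of a frame derivative, and the latter is symmetric.\<close>
  have 0: "g p (nabla p v N) w = - g p (N p) (nabla p v (?E w))"
    if "v \<in> leaf_tangent A b F p" "w \<in> leaf_tangent A b F p" for v w
  proof -
    have "(\<lambda>q. g q (N q) (?E w q)) = (\<lambda>q. 0)"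
      using tangent[OF that(2)] N by (auto simp: timelike_unit_normal_def)
    then have "0 = dir_deriv A (\<lambda>q. g q (N q) (?E w q)) p v" by (simp add: dir_deriv_const)
    also have "\<dots> = g p (nabla p v N) w + g p (N p) (nabla p v (?E w))"
      unfolding nabla_metric[OF N' E] Ep ..
    finally show ?thesis by simp
  qed
  have "nabla p v (?E w) = nabla p w (?E v)"
    using nabla_frame_sym[OF d(3) \<eta>, of "components A d p v" "components A d p w"]
    by (simp add: coord_vector_components[OF d(3,2)])
  then show ?thesis using 0[OF v w] 0[OF w v] by simp
qed

end

section \<open>Divergence argument for the normal field\<close>

theorem theorem4p3:
  fixes A F :: "('m::{t2_space,second_countable_topology}, 'e::euclidean_space) chart set"
    and g :: "'m \<Rightarrow> 'e \<Rightarrow> 'e \<Rightarrow> real"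
    and nabla :: "'m \<Rightarrow> 'e \<Rightarrow> ('m \<Rightarrow> 'e) \<Rightarrow> 'e"
    and \<xi> N :: "'m \<Rightarrow> 'e"
    and b :: 'e
    and \<theta> :: "'m \<Rightarrow> real"
  assumes "smooth_atlas A"
    and "lorentz_metric A g"
    and "levi_civita A g nabla"
    and "closed_conformal A nabla \<xi>"
    and "timelike g \<xi>"
    and "\<forall>p. timelike_norm g \<xi> p = 1"
    and "foliated_atlas A b F"
    and "\<forall>L\<in>leaves b F. spacelike_leaf A g b F L"
    and "\<forall>L\<in>leaves b F. complete_leaf A g b F L"
    and "\<forall>L\<in>leaves b F. \<not> compact_leaf b F L"
    and "timelike_unit_normal A g b F N"
    and "\<forall>p. g p (N p) (\<xi> p) < 0"
    and "transversal A b F \<xi>"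
    and "\<forall>p. g p (N p) (H_conf g nabla \<xi> p *\<^sub>R \<xi> p) \<ge> 0"
    and "\<forall>L\<in>leaves b F. second_ff_nonneg A g nabla b F N L"
    and "hyperbolic_angle g N \<xi> \<theta>"
    and "tends_to_zero_at_infinity \<theta>"
  shows "\<forall>L\<in>leaves b F. totally_geodesic_leaf A nabla b F N L"
proof -
  interpret lorentz_manifold A g nabla
    by unfold_locales (use assms in auto)
  note F = assms(7) and N = assms(11)
  have leaf: "leaf_through b F p \<in> leaves b F" "p \<in> leaf_through b F p" for p
    by (auto simp: leaves_def leaf_through_def)
  have N_smooth: "smooth_field A N" and NN: "\<And>p. g p (N p) (N p) = -1"
    using N by (simp_all add: timelike_unit_normal_def)
  have \<xi>_smooth: "smooth_field A \<xi>" using assms(4) by (simp add: closed_conformal_def)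
  have \<xi>\<xi>: "g p (\<xi> p) (\<xi> p) = -1" for p
    using assms(6) by (simp add: timelike_norm_def)
  note parallel = closed_conformal_unit_parallel[OF assms(4) \<xi>\<xi>]
  note normal = normal_orthogonal_iff[OF F N]
  note orth = nabla_unit_orthogonal[OF N_smooth NN]
  \<comment> \<open>Every point lies on its own leaf, and tangent vectors are those orthogonal to N.
    The sign is reversed because \<open>second_ff\<close> is minus the derivative of N.\<close>
  have nonpos: "g p (nabla p v N) v \<le> 0" if "g p v (N p) = 0" for p v
    using assms(15) leaf that normal
    by (force simp: second_ff_nonneg_def second_ff_def g_simps)
  define \<tau> where "\<tau> = divergence nabla N"
  have \<tau>: "\<tau> p = operator_trace (\<lambda>v. nabla p v N)" for p
    by (simp add: \<tau>_def divergence_def operator_trace_def)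
  have \<tau>_nonpos: "\<tau> p \<le> 0" for p
    unfolding \<tau>
    by (rule lorentz_operator_trace_nonpos[OF lorentz NN nabla_linear[OF N_smooth] orth nonpos])
  have div_N: "has_div metric_density N \<tau>" unfolding \<tau>_def by (rule has_div_divergence[OF N_smooth])
  have "divergence nabla \<xi> = (\<lambda>p. 0)" by (simp add: divergence_def parallel fun_eq_iff)
  then have div_\<xi>: "has_div metric_density \<xi> (\<lambda>p. 0)" using has_div_divergence[OF \<xi>_smooth] by simp
  have C1: "Ck_field (Suc 0) N" "Ck_field (Suc 0) \<xi>"
    using N_smooth \<xi>_smooth smooth_field_iff by blast+
  define f where "f q = g q (N q) (\<xi> q)" for q
  have f_C1: "Ck_fun (Suc 0) f"
    using smooth_fun_metric[OF N_smooth \<xi>_smooth] unfolding f_def[abs_def] smooth_fun_iff by blast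
  have df: "dir_deriv A f p v = g p (nabla p v N) (\<xi> p)" for p v
    unfolding f_def[abs_def] nabla_metric[OF N_smooth \<xi>_smooth] by (simp add: parallel g_simps)
  have f_cosh: "f p = - cosh (\<theta> p)" and \<theta>: "0 \<le> \<theta> p" for p
    using assms(16) by (simp_all add: hyperbolic_angle_def f_def)
  define T where "T p = \<xi> p + f p *\<^sub>R N p" for p
  have T: "g p (T p) (N p) = 0" for p
    using g_sym[of p "\<xi> p" "N p"] by (simp add: T_def g_simps NN f_def)
  have \<tau>_0: "\<tau> p = 0" if pos: "\<theta> p > 0" for p
  proof -
    \<comment> \<open>Half the angle separates the two requirements: \<theta> stays below it outside
      a compact set, so W vanishes there, while at p itself cosh (\<theta> p) exceeds a, so
      \<alpha>(f p) is strictly negative.\<close>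
    define a where "a = cosh (\<theta> p / 2)"
    have "a > 1" using cosh_real_nonneg_less_iff[of 0 "\<theta> p / 2"] pos by (simp add: a_def)
    obtain K where K: "compact K" "\<And>q. q \<notin> K \<Longrightarrow> \<theta> q < \<theta> p / 2"
      using assms(17) pos unfolding tends_to_zero_at_infinity_def by (meson half_gt_zero)
    define d where "d u = max 0 (- a - u)" for u :: real
    define \<beta> where "\<beta> u = d u ^ Suc (Suc 0)" for u
    \<comment> \<open>The primitive of u \<beta>'(u) = - 2 d u that vanishes for u \<ge> -a. Where d
      > 0 one has u = - (a + d), so the integrand is 2 a d + 2 d^2; integrating with d' = -1 yields
      the coefficients a and 2/3.\<close>
    define \<alpha> where "\<alpha> u = - (2 / 3 * d u ^ Suc (Suc (Suc 0)) + a * d u ^ Suc (Suc 0))" for u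
    have inner: "((\<lambda>u. - a - u) has_real_derivative -1) (at u)" for u
      by (auto intro!: derivative_eq_intros)
    have power: "((\<lambda>u. d u ^ Suc (Suc n)) has_real_derivative - real (Suc (Suc n)) * d u ^ Suc n) (at u)" for n u
      unfolding d_def
      by (rule DERIV_cong[OF DERIV_chain2[OF max_0_power_has_derivative inner]]) (simp add: algebra_simps)
    have \<beta>': "(\<beta> has_real_derivative - 2 * d u) (at u)" for u
      using power[of 0 u] by (simp add: \<beta>_def[abs_def])
    have \<alpha>': "(\<alpha> has_real_derivative - 2 * d u * u) (at u)" for u
    proof -
      have "(\<alpha> has_real_derivative - (2 / 3 * (- 3 * d u ^ 2) + a * (- 2 * d u))) (at u)"
        using power[of 0 u] power[of 1 u] unfolding \<alpha>_def[abs_def]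
        by (intro DERIV_minus DERIV_add DERIV_cmult) (simp_all add: numeral_2_eq_2 numeral_3_eq_3)
      moreover have "- (2 / 3 * (- 3 * d u ^ 2) + a * (- 2 * d u)) = - 2 * d u * u"
        by (auto simp: d_def max_def power2_eq_square algebra_simps)
      ultimately show ?thesis by simp
    qed
    have d_cont: "continuous_on UNIV d" unfolding d_def[abs_def] by (intro continuous_intros)
    have \<beta>_C1: "Ck_fun (Suc 0) (\<lambda>q. \<beta> (f q))"
      by (rule Ck_fun_compose[OF Ck_on_1_real[OF \<beta>'] f_C1]) (intro continuous_intros d_cont)
    have \<alpha>_C1: "Ck_fun (Suc 0) (\<lambda>q. \<alpha> (f q))"
      by (rule Ck_fun_compose[OF Ck_on_1_real[OF \<alpha>'] f_C1]) (intro continuous_intros d_cont)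
    have d_nonneg: "0 \<le> d u" for u by (simp add: d_def)
    define W where "W q = \<alpha> (f q) *\<^sub>R N q + \<beta> (f q) *\<^sub>R \<xi> q" for q
    \<comment> \<open>Kept in the shape produced by \<open>has_div_add\<close> and
      \<open>has_div_scale\<close>; the factor 0 is the divergence of xi.\<close>
    define D where "D q = (\<alpha> (f q) * \<tau> q + dir_deriv A (\<lambda>q. \<alpha> (f q)) q (N q)) +
        (\<beta> (f q) * 0 + dir_deriv A (\<lambda>q. \<beta> (f q)) q (\<xi> q))" for q
    note \<rho> = is_density_metric_density
    have W_C1: "Ck_field (Suc 0) W"
      unfolding W_def[abs_def] by (intro Ck_field_add Ck_field_scale \<alpha>_C1 \<beta>_C1 C1)
    have W_div: "has_div metric_density W D"
      unfolding W_def[abs_def] D_def[abs_def]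
      by (intro has_div_add has_div_scale \<rho> Ck_field_scale \<alpha>_C1 \<beta>_C1 C1 div_N div_\<xi>)
    have W_out: "W q = 0" if "q \<notin> K" for q
    proof -
      have "cosh (\<theta> q) < a"
        unfolding a_def using K(2)[OF that] \<theta>[of q] pos by (simp add: cosh_real_nonneg_less_iff)
      then have "d (f q) = 0" by (simp add: d_def f_cosh)
      then show ?thesis by (simp add: W_def \<alpha>_def \<beta>_def)
    qed
    have D_eq: "D q = \<alpha> (f q) * \<tau> q + 2 * d (f q) * (- g q (nabla q (T q) N) (T q))" for q
    proof -
      have lin: "nabla q (T q) N = nabla q (\<xi> q) N + f q *\<^sub>R nabla q (N q) N"
        unfolding T_def linear_add[OF nabla_linear[OF N_smooth, of q]]
          linear_scale[OF nabla_linear[OF N_smooth, of q]] ..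
      \<comment> \<open>T and xi differ by a multiple of N, and derivatives of N are orthogonal to
        N, so the second argument may be exchanged.\<close>
      have "g q (nabla q (T q) N) (T q) = g q (nabla q (T q) N) (\<xi> q)"
        by (simp add: T_def[of q] g_simps orth)
      then have "g q (nabla q (T q) N) (T q) =
          g q (nabla q (\<xi> q) N) (\<xi> q) + f q * g q (nabla q (N q) N) (\<xi> q)"
        by (simp add: lin g_simps)
      then show ?thesis
        by (simp add: D_def dir_deriv_compose[OF f_C1 \<alpha>'] dir_deriv_compose[OF f_C1 \<beta>'] df algebra_simps)
    qed
    have \<alpha>_nonpos: "\<alpha> u \<le> 0" for u
      unfolding \<alpha>_def neg_le_0_iff_le
      by (intro add_nonneg_nonneg mult_nonneg_nonneg zero_le_power d_nonneg) (use \<open>a > 1\<close> in auto)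
    have parts: "0 \<le> \<alpha> (f q) * \<tau> q" "0 \<le> 2 * d (f q) * (- g q (nabla q (T q) N) (T q))" for q
      using \<alpha>_nonpos \<tau>_nonpos d_nonneg nonpos[OF T] by (simp_all add: mult_nonpos_nonpos mult_nonneg_nonpos)
    have "D p = 0"
      by (rule nonneg_divergence_eq_0[OF \<rho> K(1) W_out W_C1 W_div])
        (simp_all only: D_eq add_nonneg_nonneg[OF parts] not_False_eq_True)
    then have "\<alpha> (f p) * \<tau> p = 0" using parts[of p] D_eq[of p] by linarith
    moreover have "\<alpha> (f p) < 0"
    proof -
      have "a < cosh (\<theta> p)" unfolding a_def using pos by (simp add: cosh_real_nonneg_less_iff)
      then have "d (f p) > 0" by (simp add: d_def f_cosh)
      then show ?thesis
        unfolding \<alpha>_def neg_less_0_iff_less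
        by (intro add_pos_pos mult_pos_pos zero_less_power) (use \<open>a > 1\<close> in auto)
    qed
    ultimately show ?thesis by simp
  qed
  have \<tau>_all: "\<tau> p = 0" for p
  proof (rule ccontr)
    assume "\<tau> p \<noteq> 0"
    \<comment> \<open>On this open set \<open>\<tau>_0\<close> leaves only \<theta> = 0. Thus N and
      xi agree on a neighbourhood of p, and their covariant derivatives at p coincide.\<close>
    have U: "open {q. \<tau> q \<noteq> 0}"
      by (rule Ck_fun_open_nonzero[OF has_div_continuous[OF is_density_metric_density C1(1) div_N]])
    have "N q = \<xi> q" if "q \<in> {q. \<tau> q \<noteq> 0}" for q
    proof -
      have "\<theta> q = 0" using that \<tau>_0[of q] \<theta>[of q] by force
      then have fq: "f q = -1" by (simp add: f_cosh)
      \<comment> \<open>In general g(T, T) = f^2 - 1. Since T is tangent to a spacelike leaf, its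
        vanishing norm forces T = 0.\<close>
      have "g q (T q) (T q) = 0"
        using fq g_sym[of q "\<xi> q" "N q"] by (simp add: T_def g_simps NN \<xi>\<xi> flip: f_def)
      moreover have "T q \<in> leaf_tangent A b F q" using T normal by blast
      ultimately have "T q = 0"
        using assms(8) leaf[of q] unfolding spacelike_leaf_def by force
      then show ?thesis by (simp add: T_def fq)
    qed
    then have "nabla p v N = 0" for v
      using nabla_local[OF N_smooth \<xi>_smooth U] \<open>\<tau> p \<noteq> 0\<close> parallel by simp
    then show False using \<open>\<tau> p \<noteq> 0\<close> by (simp add: \<tau> operator_trace_def)
  qed
  have "nabla p v N = 0" if v: "v \<in> leaf_tangent A b F p" for p v
  proof (rule lorentz_operator_trace_eq_0[OF lorentz NN nabla_linear[OF N_smooth] orth nonpos])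
    show "operator_trace (\<lambda>v. nabla p v N) = 0" using \<tau>_all \<tau> by metis
    show "g p (nabla p v N) w = g p (nabla p w N) v" if "g p v (N p) = 0" "g p w (N p) = 0" for v w
      using second_ff_symmetric[OF F N] normal that by blast
    show "g p v (N p) = 0" using v normal by blast
  qed
  then show ?thesis by (simp add: totally_geodesic_leaf_def second_ff_def)
qed

end
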